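(* Let $(Y_j)_{j\in\mathbb{Z}}$ be a stationary $\alpha$-mixing process with mixing coefficients $(\alpha_k)_{k\ge1}$, let $f:\mathbb{R}^{\mathbb{Z}}\to\mathbb{R}$ be measurable, and let $X_i=f((Y_{i+k})_{k\in\mathbb{Z}})$ for $i\ge1$, so that $(X_i)_{i\ge1}$ is stationary. Suppose that $E|X_1|^{2+\delta}<\infty$ for some $\delta>0$, that the approximation coefficients satisfy \[ \sum_{k=1}^\infty \psi_k^{\frac{1+\delta}{2+\delta}}<\infty, \] and that $\alpha_k=O(k^{-\mu})$ for some $\mu>(2+\delta)^2/\delta$. Let $(l_n)_{n\ge1}$ be a nondecreasing sequence of positive integers with $l_n\to\infty$ and $l_n=o(n)$. Then $\hat B_n\to\sigma$ in $L_2$, i.e. $E|\hat B_n-\sigma|^2\to0$ as $n\to\infty$, where $\sigma\ge 0$ is the square root of $\sigma^2$.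
   Context: For a process $(Y_j)$, $\mathcal{F}_k^m$ denotes the $\sigma$-field generated by $Y_k,\dots,Y_m$ (with $k=-\infty$ or $m=\infty$ allowed). The mixing coefficients are $\alpha_k=\sup_{n\ge1}\sup_{A\in\mathcal{F}_{-\infty}^n,\,B\in\mathcal{F}_{n+k}^\infty}|P(A\cap B)-P(A)P(B)|$, and the process is called $\alpha$-mixing if $\alpha_k\to0$. The approximation coefficients are \[ \psi_m=E\Big|f((Y_{i+k})_{k\in\mathbb{Z}})-E\big(f((Y_{i+k})_{k\in\mathbb{Z}})\,\big|\,Y_{i-m},\dots,Y_{i+m}\big)\Big|^{\frac{2+\delta}{1+\delta}} \] (independent of $i$ by stationarity). Let $m_X=EX_1$ and \[ \sigma^2=\mathrm{Var}(X_1)+2\sum_{k=2}^\infty\mathrm{Cov}(X_1,X_k). \] Given observations $X_1,\dots,X_n$ and block length $l=l_n$, let $k_n=[n/l_n]$ (integer part), $\bar X_n=\frac1n\sum_{j=1}^nX_j$, $S_i(l)=\sum_{j=(i-1)l+1}^{il}X_j$, and \[ \hat B_n=\frac{1}{k_n}\sqrt{\frac{\pi}{2}}\sum_{i=1}^{k_n}\frac{|S_i(l_n)-l_n\bar X_n|}{\sqrt{l_n}}. \] *)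

theory Defs
  imports "HOL-Probability.Probability" "HOL-Library.Landau_Symbols"
begin

definition gen_sets :: "'a measure \<Rightarrow> (int \<Rightarrow> 'a \<Rightarrow> real) \<Rightarrow> int set \<Rightarrow> 'a set set" where
  "gen_sets M Y I = {Y j -` B \<inter> space M | j B. j \<in> I \<and> B \<in> sets (borel :: real measure)}"

definition gen_sigma :: "'a measure \<Rightarrow> (int \<Rightarrow> 'a \<Rightarrow> real) \<Rightarrow> int set \<Rightarrow> 'a set set" where
  "gen_sigma M Y I = sigma_sets (space M) (gen_sets M Y I)"

definition gen_subalg :: "'a measure \<Rightarrow> (int \<Rightarrow> 'a \<Rightarrow> real) \<Rightarrow> int set \<Rightarrow> 'a measure" where
  "gen_subalg M Y I = sigma (space M) (gen_sets M Y I)"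

definition alpha_mix :: "'a measure \<Rightarrow> (int \<Rightarrow> 'a \<Rightarrow> real) \<Rightarrow> nat \<Rightarrow> real" where
  "alpha_mix M Y k = Sup {\<bar>measure M (A \<inter> B) - measure M A * measure M B\<bar> | n A B.
      n \<ge> 1 \<and> A \<in> gen_sigma M Y {..n} \<and> B \<in> gen_sigma M Y {n + int k..}}"

definition stationary_proc :: "'a measure \<Rightarrow> (int \<Rightarrow> 'a \<Rightarrow> real) \<Rightarrow> bool" where
  "stationary_proc M Y \<longleftrightarrow> (\<forall>h::int.
      distr M (PiM UNIV (\<lambda>_::int. borel :: real measure)) (\<lambda>\<omega> j. Y (j + h) \<omega>) =
      distr M (PiM UNIV (\<lambda>_::int. borel :: real measure)) (\<lambda>\<omega> j. Y j \<omega>))"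

definition Xproc :: "((int \<Rightarrow> real) \<Rightarrow> real) \<Rightarrow> (int \<Rightarrow> 'a \<Rightarrow> real) \<Rightarrow> int \<Rightarrow> 'a \<Rightarrow> real" where
  "Xproc f Y i \<omega> = f (\<lambda>k. Y (i + k) \<omega>)"

definition psi_coeff :: "'a measure \<Rightarrow> (int \<Rightarrow> 'a \<Rightarrow> real) \<Rightarrow> ((int \<Rightarrow> real) \<Rightarrow> real) \<Rightarrow> real \<Rightarrow> nat \<Rightarrow> real" where
  "psi_coeff M Y f \<delta> m = integral\<^sup>L M (\<lambda>\<omega>.
      \<bar>Xproc f Y 1 \<omega> - real_cond_exp M (gen_subalg M Y {1 - int m .. 1 + int m}) (Xproc f Y 1) \<omega>\<bar>
        powr ((2 + \<delta>) / (1 + \<delta>)))"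

definition sigma2 :: "'a measure \<Rightarrow> (int \<Rightarrow> 'a \<Rightarrow> real) \<Rightarrow> real" where
  "sigma2 M X = (integral\<^sup>L M (\<lambda>\<omega>. (X 1 \<omega>)\<^sup>2) - (integral\<^sup>L M (X 1))\<^sup>2)
     + 2 * (\<Sum>k. integral\<^sup>L M (\<lambda>\<omega>. X 1 \<omega> * X (int k + 2) \<omega>) - integral\<^sup>L M (X 1) * integral\<^sup>L M (X (int k + 2)))"

definition Bhat :: "(int \<Rightarrow> 'a \<Rightarrow> real) \<Rightarrow> nat \<Rightarrow> nat \<Rightarrow> 'a \<Rightarrow> real" where
  "Bhat X l n \<omega> =
     (let k = n div l;
          Xbar = (1 / real n) * (\<Sum>j=1..n. X (int j) \<omega>);
          S = (\<lambda>i. \<Sum>j=(i-1)*l+1..i*l. X (int j) \<omega>)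
      in (1 / real k) * sqrt (pi / 2) *
           (\<Sum>i=1..k. \<bar>S i - real l * Xbar\<bar> / sqrt (real l)))"

end

theory Submission
  imports Defs
begin

text \<open>
  The estimator is unchanged when a constant is added to the process, and it is Lipschitz in the
  block sums, so an \<open>L\<^sup>2\<close>-approximation of the process whose residual has a small absolutely summed
  autocovariance moves both the estimator and \<open>\<sigma>\<close> only slightly. Clipping the conditional
  expectation of \<open>X\<close> given a finite window of \<open>Y\<close> yields such an approximation by a bounded
  functional of finitely many \<open>Y\<close>: at lags beyond three window lengths the autocovariance of the
  residual is controlled by the approximation coefficients and the mixing rate, uniformly in the
  window, while for the remaining lags the residual itself is small. For a bounded window
  functional, Bernstein blocks give the central limit theorem and hence the limit
  \<open>\<sigma> sqrt (2 / \<pi>)\<close> of the mean of a normalised absolute block sum, and the covariance of two nonadjacent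
  blocks of length \<open>l\<close> is \<open>O(l \<alpha>(l - 2 m))\<close> for window radius \<open>m\<close>, so the average over blocks
  concentrates.
\<close>

section \<open>Moments and covariances\<close>

text \<open>The hypothesis on the \<psi>-coefficients controls the approximation error only in L^q
  with q = (2+\<delta>)/(1+\<delta>) < 2. This exponent is conjugate to p = 2+\<delta>, so an error
  enters an autocovariance linearly, through its L^q-norm, when it is paired with a factor having a
  p-th moment. The number of lags near a window of radius m grows like m, so the residual must be
  small compared with 1/m; summability of the error norms gives this for suitable, arbitrarily large
  m. The bound (2+\<delta>)^2/\<delta> = 4/\<delta> + 4 + \<delta> on \<mu> is used twice: it
  exceeds 4/\<delta> + 2, which pays for truncating unbounded window functionals, and it is at least
  8 because (2-\<delta>)^2 \<ge> 0, which pays for the blocks of bounded ones. Only moments of order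
  2+\<delta> of X are available, so the variance of the mean of the absolute block sums is estimated
  after the passage to a bounded functional. Nothing excludes \<sigma> = 0; hence standard
  deviations are compared by the reverse triangle inequality in L^2, without division.\<close>

definition moment_le :: "'a measure \<Rightarrow> real \<Rightarrow> real \<Rightarrow> ('a \<Rightarrow> real) \<Rightarrow> bool" where
  "moment_le M p B U \<longleftrightarrow> U \<in> borel_measurable M \<and> integrable M (\<lambda>x. \<bar>U x\<bar> powr p)
     \<and> (\<integral>x. \<bar>U x\<bar> powr p \<partial>M) \<le> B"

definition covar :: "'a measure \<Rightarrow> ('a \<Rightarrow> real) \<Rightarrow> ('a \<Rightarrow> real) \<Rightarrow> real" where
  "covar M U V = (\<integral>x. U x * V x \<partial>M) - (\<integral>x. U x \<partial>M) * (\<integral>x. V x \<partial>M)"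

definition clip :: "real \<Rightarrow> real \<Rightarrow> real" where
  "clip A x = max (- A) (min A x)"

lemma abs_clip_le: "0 \<le> A \<Longrightarrow> \<bar>clip A x\<bar> \<le> A"
  by (auto simp: clip_def)

lemma abs_clip_le_abs: "0 \<le> A \<Longrightarrow> \<bar>clip A x\<bar> \<le> \<bar>x\<bar>"
  by (auto simp: clip_def)

lemma abs_diff_clip_le_abs: "0 \<le> A \<Longrightarrow> \<bar>x - clip A x\<bar> \<le> \<bar>x\<bar>"
  by (auto simp: clip_def)

lemma clip_eq: "\<bar>x\<bar> \<le> A \<Longrightarrow> clip A x = x"
  by (auto simp: clip_def)

lemma borel_measurable_clip [measurable]: "clip A \<in> borel_measurable borel"
  unfolding clip_def by measurable

lemma powr_le_one_add_powr:
  fixes x :: real assumes "0 \<le> x" "0 < s" "s \<le> p" shows "x powr s \<le> 1 + x powr p"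
proof (cases "x \<le> 1")
  case True
  then have "x powr s \<le> 1" using assms by (simp add: powr_le1)
  then show ?thesis using powr_ge_zero[of x p] by linarith
next
  case False
  then have "x powr s \<le> x powr p" using assms by (intro powr_mono) auto
  then show ?thesis by simp
qed

lemma powr_le_powr_mult:
  fixes x A :: real assumes "0 < A" "A < x" "s \<le> p" shows "x powr s \<le> x powr p * A powr (s - p)"
proof -
  have "x powr s = x powr p * x powr (s - p)" by (simp add: powr_add[symmetric])
  also have "\<dots> \<le> x powr p * A powr (s - p)"
    using assms by (intro mult_left_mono powr_mono2') auto
  finally show ?thesis .
qed

text \<open>A Markov-type tail bound: the left side vanishes for |x| \<le> A, and beyond A the
  factor (|x|/A)^(p-s) \<ge> 1 may be inserted. In expectation it turns a p-th moment into a rate in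
  the truncation level.\<close>

lemma diff_clip_powr_le:
  assumes "0 < A" "0 < s" "s \<le> p"
  shows "\<bar>x - clip A x\<bar> powr s \<le> \<bar>x\<bar> powr p * A powr (s - p)"
proof (cases "\<bar>x\<bar> \<le> A")
  case True then show ?thesis by (simp add: clip_eq)
next
  case False
  have "\<bar>x - clip A x\<bar> powr s \<le> \<bar>x\<bar> powr s"
    using assms abs_diff_clip_le_abs[of A x] by (intro powr_mono2) auto
  also have "\<dots> \<le> \<bar>x\<bar> powr p * A powr (s - p)" using False assms by (intro powr_le_powr_mult) auto
  finally show ?thesis .
qed

text \<open>Unless both arguments lie within the level, the larger absolute value exceeds
  \<open>A\<close>, and the product is at most its square; the surplus over the second power is
  traded for a power of \<open>A\<close>.\<close>

lemma mult_diff_clip_le: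
  assumes "0 < A" "2 \<le> p"
  shows "\<bar>x * y - clip A x * clip A y\<bar> \<le> (\<bar>x\<bar> powr p + \<bar>y\<bar> powr p) * A powr (2 - p)"
proof (cases "\<bar>x\<bar> \<le> A \<and> \<bar>y\<bar> \<le> A")
  case True then show ?thesis by (simp add: clip_eq)
next
  case False
  define m where "m = max \<bar>x\<bar> \<bar>y\<bar>"
  have m: "A < m" using False by (auto simp: m_def)
  have 1: "\<bar>x * y - clip A x * clip A y\<bar> \<le> \<bar>x\<bar> * \<bar>y\<bar>"
  proof -
    \<comment> \<open>Clipping multiplies its argument by a factor in [0,1], so the clipped product
      is a fraction between 0 and 1 of \<open>x * y\<close>, and the difference is bounded by the
      product itself.\<close>
    have a: "\<exists>u. 0 \<le> u \<and> u \<le> 1 \<and> clip A z = u * z" for z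
      using assms(1)
    proof (cases "\<bar>z\<bar> \<le> A")
      case True then show ?thesis by (intro exI[of _ 1]) (auto simp: clip_eq)
    next
      case False
      then have "clip A z = A / \<bar>z\<bar> * z" using assms(1) by (cases "0 \<le> z") (auto simp: clip_def)
      then show ?thesis using assms(1) False by (intro exI[of _ "A / \<bar>z\<bar>"]) auto
    qed
    obtain u v where uv: "0 \<le> u" "u \<le> 1" "clip A x = u * x" "0 \<le> v" "v \<le> 1" "clip A y = v * y"
      using a by metis
    have "u * v \<le> 1" using uv by (simp add: mult_le_one)
    have "x * y - clip A x * clip A y = (1 - u * v) * (x * y)" using uv by (simp add: algebra_simps)
    also have "\<bar>\<dots>\<bar> = (1 - u * v) * \<bar>x * y\<bar>" using \<open>u * v \<le> 1\<close> by (simp add: abs_mult)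
    also have "\<dots> \<le> \<bar>x * y\<bar>" using uv by (intro mult_left_le_one_le) (auto simp: mult_le_one \<open>u * v \<le> 1\<close>)
    finally show ?thesis by (simp add: abs_mult)
  qed
  also have "\<dots> \<le> m * m" unfolding m_def by (intro mult_mono) auto
  also have "\<dots> = m powr 2" using m assms by (simp add: powr_numeral power2_eq_square)
  also have "\<dots> \<le> m powr p * A powr (2 - p)" using m assms by (intro powr_le_powr_mult) auto
  also have "\<dots> \<le> (\<bar>x\<bar> powr p + \<bar>y\<bar> powr p) * A powr (2 - p)"
    by (intro mult_right_mono) (auto simp: m_def max_def)
  finally show ?thesis .
qed

text \<open>Bounding |x + y| by twice the maximum avoids convexity, so every positive exponent is
  covered.\<close>

lemma abs_add_powr_le:
  fixes x y :: real assumes "0 < p"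
  shows "\<bar>x + y\<bar> powr p \<le> 2 powr p * (\<bar>x\<bar> powr p + \<bar>y\<bar> powr p)"
proof -
  have "\<bar>x + y\<bar> powr p \<le> (2 * max \<bar>x\<bar> \<bar>y\<bar>) powr p" using assms by (intro powr_mono2) auto
  also have "\<dots> = 2 powr p * (max \<bar>x\<bar> \<bar>y\<bar>) powr p" by (simp add: powr_mult)
  also have "\<dots> \<le> 2 powr p * (\<bar>x\<bar> powr p + \<bar>y\<bar> powr p)" by (intro mult_left_mono) (auto simp: max_def)
  finally show ?thesis .
qed

section \<open>Moments, Cauchy-Schwarz and covariance estimates on a probability space\<close>

context prob_space
begin

lemma moment_leD:
  assumes "moment_le M p B U"
  shows "U \<in> borel_measurable M" "integrable M (\<lambda>x. \<bar>U x\<bar> powr p)" "expectation (\<lambda>x. \<bar>U x\<bar> powr p) \<le> B" "0 \<le> B"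
proof -
  show *: "U \<in> borel_measurable M" "integrable M (\<lambda>x. \<bar>U x\<bar> powr p)" "expectation (\<lambda>x. \<bar>U x\<bar> powr p) \<le> B"
    using assms by (auto simp: moment_le_def)
  have "0 \<le> expectation (\<lambda>x. \<bar>U x\<bar> powr p)" by simp
  then show "0 \<le> B" using * by linarith
qed

lemma moment_le_integrable_powr:
  assumes "moment_le M p B U" "0 < s" "s \<le> p"
  shows "integrable M (\<lambda>x. \<bar>U x\<bar> powr s)" "expectation (\<lambda>x. \<bar>U x\<bar> powr s) \<le> 1 + B"
proof -
  note [measurable] = moment_leD(1)[OF assms(1)]
  note [simp] = moment_leD(2)[OF assms(1)]
  show i: "integrable M (\<lambda>x. \<bar>U x\<bar> powr s)"
    by (rule Bochner_Integration.integrable_bound[where f="\<lambda>x. 1 + \<bar>U x\<bar> powr p"])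
       (use assms in \<open>auto intro!: AE_I2 powr_le_one_add_powr add_nonneg_nonneg simp: abs_of_nonneg\<close>)
  have "expectation (\<lambda>x. \<bar>U x\<bar> powr s) \<le> expectation (\<lambda>x. 1 + \<bar>U x\<bar> powr p)"
    using assms i by (intro integral_mono) (auto intro!: powr_le_one_add_powr)
  also have "\<dots> = 1 + expectation (\<lambda>x. \<bar>U x\<bar> powr p)" by (simp add: prob_space)
  also have "\<dots> \<le> 1 + B" using moment_leD(3)[OF assms(1)] by simp
  finally show "expectation (\<lambda>x. \<bar>U x\<bar> powr s) \<le> 1 + B" .
qed

lemma moment_le_integrable:
  assumes "moment_le M p B U" "1 \<le> p"
  shows "integrable M U" "expectation (\<lambda>x. \<bar>U x\<bar>) \<le> 1 + B"
  using moment_le_integrable_powr[OF assms(1), of 1] assms moment_leD(1)[OF assms(1)]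
  by (auto simp: integrable_abs_iff)

lemma moment_le_square:
  assumes "moment_le M p B U" "2 \<le> p"
  shows "integrable M (\<lambda>x. (U x)\<^sup>2)" "expectation (\<lambda>x. (U x)\<^sup>2) \<le> 1 + B"
  using moment_le_integrable_powr[OF assms(1), of 2] assms
  by (auto simp: powr_numeral)

lemma integrable_mult_square:
  fixes U V :: "'a \<Rightarrow> real"
  assumes [measurable]: "U \<in> borel_measurable M" "V \<in> borel_measurable M"
    and "integrable M (\<lambda>x. (U x)\<^sup>2)" "integrable M (\<lambda>x. (V x)\<^sup>2)"
  shows "integrable M (\<lambda>x. U x * V x)"
proof (rule Bochner_Integration.integrable_bound[where f="\<lambda>x. (U x)\<^sup>2 + (V x)\<^sup>2"])
  have "\<bar>a * b\<bar> \<le> \<bar>a\<^sup>2 + b\<^sup>2\<bar>" for a b :: real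
  proof -
    have "2 * \<bar>a\<bar> * \<bar>b\<bar> \<le> a\<^sup>2 + b\<^sup>2" using sum_squares_bound[of "\<bar>a\<bar>" "\<bar>b\<bar>"] by simp
    moreover have "0 \<le> \<bar>a\<bar> * \<bar>b\<bar>" by simp
    ultimately show ?thesis unfolding abs_mult by linarith
  qed
  then show "AE x in M. norm (U x * V x) \<le> norm ((U x)\<^sup>2 + (V x)\<^sup>2)" by auto
qed (use assms in auto)

lemma Cauchy_Schwarz_expectation:
  fixes U V :: "'a \<Rightarrow> real"
  assumes m[measurable]: "U \<in> borel_measurable M" "V \<in> borel_measurable M"
    and i: "integrable M (\<lambda>x. (U x)\<^sup>2)" "integrable M (\<lambda>x. (V x)\<^sup>2)"
  shows "expectation (\<lambda>x. U x * V x) \<le> sqrt (expectation (\<lambda>x. (U x)\<^sup>2)) * sqrt (expectation (\<lambda>x. (V x)\<^sup>2))"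
proof -
  define a b where "a = expectation (\<lambda>x. (U x)\<^sup>2)" and "b = expectation (\<lambda>x. (V x)\<^sup>2)"
  have ab: "0 \<le> a" "0 \<le> b" by (auto simp: a_def b_def)
  have iUV: "integrable M (\<lambda>x. U x * V x)" by (rule integrable_mult_square[OF m i])
  have *: "2 * (s * t) * expectation (\<lambda>x. U x * V x) \<le> s\<^sup>2 * a + t\<^sup>2 * b" for s t
  proof -
    have "0 \<le> expectation (\<lambda>x. (s * U x - t * V x)\<^sup>2)" by simp
    also have "(\<lambda>x. (s * U x - t * V x)\<^sup>2) = (\<lambda>x. s\<^sup>2 * (U x)\<^sup>2 + t\<^sup>2 * (V x)\<^sup>2 - 2 * (s * t) * (U x * V x))"
      by (auto simp: power2_eq_square algebra_simps)
    also have "expectation \<dots> = s\<^sup>2 * a + t\<^sup>2 * b - 2 * (s * t) * expectation (\<lambda>x. U x * V x)"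
      using i iUV by (simp add: a_def b_def)
    finally show ?thesis by simp
  qed
  \<comment> \<open>The optimal weights are the square roots of the two second moments, which may
    vanish. Strictly larger \<open>a'\<close> and \<open>b'\<close> keep them positive; the limit
    below removes the enlargement.\<close>
  have pos: "expectation (\<lambda>x. U x * V x) \<le> sqrt a' * sqrt b'"
    if "a < a'" "b < b'" for a' b'
  proof -
    have p: "0 < a'" "0 < b'" using that ab by auto
    define s t where "s = sqrt b'" and "t = sqrt a'"
    have st: "0 < s" "0 < t" "s\<^sup>2 = b'" "t\<^sup>2 = a'" using p by (auto simp: s_def t_def)
    have "2 * (s * t) * expectation (\<lambda>x. U x * V x) \<le> s\<^sup>2 * a + t\<^sup>2 * b" by (rule *)
    also have "\<dots> \<le> s\<^sup>2 * t\<^sup>2 + t\<^sup>2 * s\<^sup>2" using that st by (intro add_mono mult_left_mono) auto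
    also have "\<dots> = 2 * (s * t) * (s * t)" by (simp add: power2_eq_square)
    finally have "expectation (\<lambda>x. U x * V x) \<le> s * t" using st by simp
    then show ?thesis by (simp add: s_def t_def mult.commute)
  qed
  have "(\<lambda>n. sqrt (a + 1 / Suc n) * sqrt (b + 1 / Suc n)) \<longlonglongrightarrow> sqrt (a + 0) * sqrt (b + 0)"
    by (intro tendsto_intros LIMSEQ_Suc lim_1_over_n)
  moreover have "expectation (\<lambda>x. U x * V x) \<le> sqrt (a + 1 / Suc n) * sqrt (b + 1 / Suc n)" for n
    by (rule pos) auto
  ultimately have "expectation (\<lambda>x. U x * V x) \<le> sqrt (a + 0) * sqrt (b + 0)"
    by (intro LIMSEQ_le_const) auto
  then show ?thesis by (simp add: a_def b_def)
qed

lemma expectation_abs_le_sqrt: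
  assumes [measurable]: "U \<in> borel_measurable M" and "integrable M (\<lambda>x. (U x)\<^sup>2)"
  shows "expectation (\<lambda>x. \<bar>U x\<bar>) \<le> sqrt (expectation (\<lambda>x. (U x)\<^sup>2))"
  using Cauchy_Schwarz_expectation[of "\<lambda>x. \<bar>U x\<bar>" "\<lambda>x. 1"] assms by (simp add: prob_space)

lemma integrable_of_square:
  assumes [measurable]: "U \<in> borel_measurable M" and "integrable M (\<lambda>x. (U x)\<^sup>2)"
  shows "integrable M (U :: 'a \<Rightarrow> real)"
  using integrable_mult_square[of U "\<lambda>x. 1"] assms by simp

text \<open>After expanding both squares this is the Cauchy-Schwarz inequality. It compares standard
  deviations even when one of them is zero.\<close>

lemma L2_reverse_triangle:
  assumes [measurable]: "U \<in> borel_measurable M" "V \<in> borel_measurable M"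
    and i: "integrable M (\<lambda>x. (U x)\<^sup>2)" "integrable M (\<lambda>x. (V x)\<^sup>2)"
  shows "(sqrt (expectation (\<lambda>x. (U x)\<^sup>2)) - sqrt (expectation (\<lambda>x. (V x)\<^sup>2)))\<^sup>2
     \<le> expectation (\<lambda>x. (U x - V x)\<^sup>2)"
proof -
  have "(\<lambda>x. (U x - V x)\<^sup>2) = (\<lambda>x. (U x)\<^sup>2 + (V x)\<^sup>2 - 2 * (U x * V x))"
    by (auto simp: power2_eq_square algebra_simps)
  then have "expectation (\<lambda>x. (U x - V x)\<^sup>2) = expectation (\<lambda>x. (U x)\<^sup>2 + (V x)\<^sup>2 - 2 * (U x * V x))"
    by simp
  also have "\<dots> = expectation (\<lambda>x. (U x)\<^sup>2) + expectation (\<lambda>x. (V x)\<^sup>2) - 2 * expectation (\<lambda>x. U x * V x)"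
    using i integrable_mult_square[of U V] by simp
  finally show ?thesis
    using Cauchy_Schwarz_expectation[of U V] i by (simp add: power2_diff)
qed

text \<open>Young's inequality applied to V/r and U replaces Hoelder's inequality.\<close>
lemma expectation_mult_le_Young:
  assumes [measurable]: "V \<in> borel_measurable M"
    and V: "integrable M (\<lambda>x. \<bar>V x\<bar> powr q)" "expectation (\<lambda>x. \<bar>V x\<bar> powr q) \<le> r powr q" "0 < r"
    and U: "moment_le M p B U" and pq: "1 < p" "1 < q" "1 / p + 1 / q = 1"
  shows "integrable M (\<lambda>x. V x * U x)" "expectation (\<lambda>x. \<bar>V x * U x\<bar>) \<le> r * (1 + B)"
proof -
  note [measurable] = moment_leD(1)[OF U]
  have pw: "\<bar>V x * U x\<bar> \<le> r * (r powr (- q) * \<bar>V x\<bar> powr q + \<bar>U x\<bar> powr p)" for x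
  proof -
    have "\<bar>U x\<bar> * (\<bar>V x\<bar> / r) \<le> \<bar>U x\<bar> powr p / p + (\<bar>V x\<bar> / r) powr q / q"
      using Youngs_inequality[OF pq, of "\<bar>U x\<bar>" "\<bar>V x\<bar> / r"] \<open>0 < r\<close> by simp
    also have "\<dots> \<le> \<bar>U x\<bar> powr p + (\<bar>V x\<bar> / r) powr q"
    proof -
      have d: "z / s \<le> z" if "0 \<le> z" "1 < s" for z s :: real
        using that by (simp add: divide_le_eq mult_le_cancel_left1)
      show ?thesis using pq by (intro add_mono d) auto
    qed
    also have "(\<bar>V x\<bar> / r) powr q = r powr (- q) * \<bar>V x\<bar> powr q"
      using \<open>0 < r\<close> by (simp add: powr_divide powr_minus_divide)
    finally have "\<bar>V x * U x\<bar> / r \<le> \<bar>U x\<bar> powr p + r powr (- q) * \<bar>V x\<bar> powr q"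
      by (simp add: abs_mult mult.commute)
    then show ?thesis using \<open>0 < r\<close> by (simp add: divide_le_eq ac_simps)
  qed
  have iR: "integrable M (\<lambda>x. r * (r powr (- q) * \<bar>V x\<bar> powr q + \<bar>U x\<bar> powr p))"
    using V moment_leD(2)[OF U] by auto
  show i: "integrable M (\<lambda>x. V x * U x)"
    by (rule Bochner_Integration.integrable_bound[OF iR]) (auto intro!: AE_I2 order_trans[OF pw])
  have "expectation (\<lambda>x. \<bar>V x * U x\<bar>) \<le> expectation (\<lambda>x. r * (r powr (- q) * \<bar>V x\<bar> powr q + \<bar>U x\<bar> powr p))"
    using i by (intro integral_mono iR pw) auto
  also have "\<dots> = r * (r powr (- q) * expectation (\<lambda>x. \<bar>V x\<bar> powr q) + expectation (\<lambda>x. \<bar>U x\<bar> powr p))"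
    using V moment_leD(2)[OF U] by simp
  also have "\<dots> \<le> r * (r powr (- q) * r powr q + B)"
    using V moment_leD(3)[OF U] by (intro mult_left_mono add_mono) auto
  also have "\<dots> = r * (1 + B)" using \<open>0 < r\<close> by (simp add: powr_add[symmetric])
  finally show "expectation (\<lambda>x. \<bar>V x * U x\<bar>) \<le> r * (1 + B)" .
qed

lemma covar_diff_left:
  assumes "integrable M U" "integrable M U'" "integrable M (\<lambda>x. U x * V x)" "integrable M (\<lambda>x. U' x * V x)"
  shows "covar M (\<lambda>x. U x - U' x) V = covar M U V - covar M U' V"
  using assms by (simp add: covar_def left_diff_distrib)

lemma covar_commute: "covar M U V = covar M V U"
  by (simp add: covar_def mult.commute)

lemma abs_covar_le:
  assumes "integrable M (\<lambda>x. U x * V x)" "integrable M U" "integrable M V"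
  shows "\<bar>covar M U V\<bar> \<le> expectation (\<lambda>x. \<bar>U x * V x\<bar>) + expectation (\<lambda>x. \<bar>U x\<bar>) * expectation (\<lambda>x. \<bar>V x\<bar>)"
proof -
  have a: "\<bar>expectation F\<bar> \<le> expectation (\<lambda>x. \<bar>F x\<bar>)" for F :: "'a \<Rightarrow> real"
    using integral_norm_bound[of M F] by simp
  have "\<bar>covar M U V\<bar> \<le> \<bar>expectation (\<lambda>x. U x * V x)\<bar> + \<bar>expectation U\<bar> * \<bar>expectation V\<bar>"
    unfolding covar_def by (simp add: abs_mult[symmetric])
  also have "\<dots> \<le> expectation (\<lambda>x. \<bar>U x * V x\<bar>) + expectation (\<lambda>x. \<bar>U x\<bar>) * expectation (\<lambda>x. \<bar>V x\<bar>)"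
    by (intro add_mono mult_mono a) auto
  finally show ?thesis .
qed

lemma covar_le_Young:
  assumes V[measurable]: "V \<in> borel_measurable M"
    "integrable M (\<lambda>x. \<bar>V x\<bar> powr q)" "expectation (\<lambda>x. \<bar>V x\<bar> powr q) \<le> r powr q" "0 < r"
    and U: "moment_le M p B U" and pq: "1 < p" "1 < q" "1 / p + 1 / q = 1"
  shows "\<bar>covar M V U\<bar> \<le> 3 * r * (1 + B)" "integrable M V"
proof -
  \<comment> \<open>The constant 1 in place of \<open>U\<close> gives E|V| \<le> 2 r. The product
    expectation costs r (1 + B) and the product of means at most 2 r (1 + B), whence the factor
    3.\<close>
  have one: "moment_le M p 1 (\<lambda>_. 1)" by (simp add: moment_le_def prob_space)
  note V1 = expectation_mult_le_Young[OF V one pq, simplified]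
  note VU = expectation_mult_le_Young[OF V U pq]
  have iU: "integrable M U" "expectation (\<lambda>x. \<bar>U x\<bar>) \<le> 1 + B"
    using moment_le_integrable[OF U] pq by auto
  show "integrable M V" using V1 by simp
  have "\<bar>covar M V U\<bar> \<le> r * (1 + B) + (r * 2) * (1 + B)"
    using VU(2) V1(2) iU(2) V(4)
    by (intro order_trans[OF abs_covar_le[OF VU(1) V1(1) iU(1)]] add_mono mult_mono) auto
  then show "\<bar>covar M V U\<bar> \<le> 3 * r * (1 + B)" by (simp add: algebra_simps)
qed

text \<open>The term 2 B comes from the expectation of the product and 2 B (1 + B) from the product
  of the expectations. A single mean converges at the faster rate A^(1-p), which is weakened to
  A^(2-p) using A \<ge> 1.\<close>

lemma covar_clip:
  assumes U: "moment_le M p B U" and V: "moment_le M p B V" and p: "2 < p" and A: "1 \<le> A"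
  shows "\<bar>covar M U V - covar M (\<lambda>x. clip A (U x)) (\<lambda>x. clip A (V x))\<bar>
     \<le> (2 * B + 2 * B * (1 + B)) * A powr (2 - p)"
proof -
  let ?c = "\<lambda>U x. clip A (U x)" and ?e = "A powr (2 - p)"
  note [measurable] = moment_leD(1)[OF U] moment_leD(1)[OF V]
  have bd: "\<bar>clip A z\<bar> \<le> A" for z using A by (simp add: abs_clip_le)
  have sq: "integrable M (\<lambda>x. (U x)\<^sup>2)" "integrable M (\<lambda>x. (V x)\<^sup>2)"
    using moment_le_square U V p by auto
  have iUV: "integrable M (\<lambda>x. U x * V x)" by (rule integrable_mult_square) (use sq in auto)
  have icc: "integrable M (\<lambda>x. ?c U x * ?c V x)"
    by (rule integrable_const_bound[of _ "A * A"]) (use A in \<open>auto simp: abs_mult intro!: mult_mono bd\<close>)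
  have ic: "integrable M (?c W)" if [measurable]: "W \<in> borel_measurable M" for W
    by (rule integrable_const_bound[of _ A]) (auto intro!: AE_I2 bd)
  note pU = moment_leD(2,3)[OF U] and pV = moment_leD(2,3)[OF V]
  have B: "0 \<le> B" using moment_leD(4)[OF U] .
  have t1: "\<bar>expectation (\<lambda>x. U x * V x) - expectation (\<lambda>x. ?c U x * ?c V x)\<bar> \<le> 2 * B * ?e"
  proof -
    have "\<bar>expectation (\<lambda>x. U x * V x) - expectation (\<lambda>x. ?c U x * ?c V x)\<bar>
        = \<bar>expectation (\<lambda>x. U x * V x - ?c U x * ?c V x)\<bar>" using iUV icc by simp
    also have "\<dots> \<le> expectation (\<lambda>x. \<bar>U x * V x - ?c U x * ?c V x\<bar>)"
      using integral_norm_bound[of M "\<lambda>x. U x * V x - ?c U x * ?c V x"] by simp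
    also have "\<dots> \<le> expectation (\<lambda>x. (\<bar>U x\<bar> powr p + \<bar>V x\<bar> powr p) * ?e)"
      using pU pV iUV icc A p by (intro integral_mono mult_diff_clip_le) auto
    also have "\<dots> = (expectation (\<lambda>x. \<bar>U x\<bar> powr p) + expectation (\<lambda>x. \<bar>V x\<bar> powr p)) * ?e"
      using pU pV by simp
    also have "\<dots> \<le> (B + B) * ?e" using pU pV by (intro mult_right_mono add_mono) auto
    finally show ?thesis by simp
  qed
  have d: "\<bar>expectation W - expectation (?c W)\<bar> \<le> B * ?e"
    if W: "moment_le M p B W" for W
  proof -
    have iW: "integrable M W" using moment_le_integrable[OF W] p by auto
    have "\<bar>expectation W - expectation (?c W)\<bar> = \<bar>expectation (\<lambda>x. W x - ?c W x)\<bar>"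
      using iW ic[OF moment_leD(1)[OF W]] by simp
    also have "\<dots> \<le> expectation (\<lambda>x. \<bar>W x - ?c W x\<bar>)"
      using integral_norm_bound[of M "\<lambda>x. W x - ?c W x"] by simp
    also have "\<dots> \<le> expectation (\<lambda>x. \<bar>W x\<bar> powr p * A powr (1 - p))"
      using moment_leD(2)[OF W] iW ic[OF moment_leD(1)[OF W]] p A diff_clip_powr_le[of A 1 p]
      by (intro integral_mono) auto
    also have "\<dots> = expectation (\<lambda>x. \<bar>W x\<bar> powr p) * A powr (1 - p)" by simp
    also have "\<dots> \<le> B * ?e" using moment_leD(3)[OF W] A B
      by (intro mult_mono powr_mono) auto
    finally show ?thesis .
  qed
  have cE: "\<bar>expectation (?c U)\<bar> \<le> 1 + B"
  proof -
    have iU: "integrable M U" "expectation (\<lambda>x. \<bar>U x\<bar>) \<le> 1 + B" using moment_le_integrable[OF U] p by auto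
    have "\<bar>expectation (?c U)\<bar> \<le> expectation (\<lambda>x. \<bar>?c U x\<bar>)"
      using integral_norm_bound[of M "?c U"] by simp
    also have "\<dots> \<le> expectation (\<lambda>x. \<bar>U x\<bar>)"
      using iU ic[OF moment_leD(1)[OF U]] A by (intro integral_mono) (auto simp: abs_clip_le_abs)
    finally show ?thesis using iU by simp
  qed
  have EV: "\<bar>expectation V\<bar> \<le> 1 + B"
    using order_trans[OF _ moment_le_integrable(2)[OF V]] integral_norm_bound[of M V] p by simp
  have "\<bar>expectation U * expectation V - expectation (?c U) * expectation (?c V)\<bar>
      = \<bar>(expectation U - expectation (?c U)) * expectation V + expectation (?c U) * (expectation V - expectation (?c V))\<bar>"
    by (simp add: algebra_simps)
  also have "\<dots> \<le> \<bar>expectation U - expectation (?c U)\<bar> * \<bar>expectation V\<bar> + \<bar>expectation (?c U)\<bar> * \<bar>expectation V - expectation (?c V)\<bar>"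
    by (simp add: abs_mult[symmetric])
  also have "\<dots> \<le> (B * ?e) * (1 + B) + (1 + B) * (B * ?e)"
    using d[OF U] d[OF V] cE EV B by (intro add_mono mult_mono) auto
  finally have t2: "\<bar>expectation U * expectation V - expectation (?c U) * expectation (?c V)\<bar> \<le> 2 * B * (1 + B) * ?e"
    by (simp add: algebra_simps)
  show ?thesis unfolding covar_def using t1 t2 by (simp add: algebra_simps abs_le_iff)
qed

text \<open>The two factors are replaced one at a time: first \<open>U1\<close> by \<open>H1\<close>
  against \<open>U2\<close>, then \<open>U2\<close> by \<open>H2\<close> against \<open>H1\<close>,
  so the approximants need the same moment bound as the originals. Each exchange costs 3 r (1 + B),
  and clipping comes last.\<close>

lemma covar_approx:
  assumes U: "moment_le M p B U1" "moment_le M p B U2"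
    and H: "moment_le M p B H1" "moment_le M p B H2"
    and e1: "integrable M (\<lambda>x. \<bar>U1 x - H1 x\<bar> powr q)" "expectation (\<lambda>x. \<bar>U1 x - H1 x\<bar> powr q) \<le> r powr q"
    and e2: "integrable M (\<lambda>x. \<bar>U2 x - H2 x\<bar> powr q)" "expectation (\<lambda>x. \<bar>U2 x - H2 x\<bar> powr q) \<le> r powr q"
    and r: "0 < r" and pq: "2 < p" "1 < q" "1 / p + 1 / q = 1" and A: "1 \<le> A"
  shows "\<bar>covar M U1 U2\<bar> \<le> \<bar>covar M (\<lambda>x. clip A (H1 x)) (\<lambda>x. clip A (H2 x))\<bar>
      + 6 * (1 + B) * r + (2 * B + 2 * B * (1 + B)) * A powr (2 - p)"
proof -
  note [measurable] = moment_leD(1)[OF U(1)] moment_leD(1)[OF U(2)] moment_leD(1)[OF H(1)] moment_leD(1)[OF H(2)]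
  have sq: "integrable M (\<lambda>x. (U1 x)\<^sup>2)" "integrable M (\<lambda>x. (U2 x)\<^sup>2)" "integrable M (\<lambda>x. (H1 x)\<^sup>2)" "integrable M (\<lambda>x. (H2 x)\<^sup>2)"
    using moment_le_square U H pq by auto
  have i: "integrable M U1" "integrable M U2" "integrable M H1" "integrable M H2"
    using moment_le_integrable U H pq by auto
  have im: "integrable M (\<lambda>x. U1 x * U2 x)" "integrable M (\<lambda>x. H1 x * U2 x)"
    "integrable M (\<lambda>x. U2 x * H1 x)" "integrable M (\<lambda>x. H2 x * H1 x)"
    by (rule integrable_mult_square; use sq in auto)+
  have d1: "covar M U1 U2 - covar M H1 U2 = covar M (\<lambda>x. U1 x - H1 x) U2"
    using covar_diff_left[OF i(1,3) im(1,2)] by simp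
  have d2: "covar M U2 H1 - covar M H2 H1 = covar M (\<lambda>x. U2 x - H2 x) H1"
    using covar_diff_left[OF i(2,4) im(3,4)] by simp
  have 1: "\<bar>covar M (\<lambda>x. U1 x - H1 x) U2\<bar> \<le> 3 * r * (1 + B)"
    using covar_le_Young(1)[OF _ e1 r U(2)] pq by auto
  have 2: "\<bar>covar M (\<lambda>x. U2 x - H2 x) H1\<bar> \<le> 3 * r * (1 + B)"
    using covar_le_Young(1)[OF _ e2 r H(1)] pq by auto
  have 3: "\<bar>covar M H1 H2 - covar M (\<lambda>x. clip A (H1 x)) (\<lambda>x. clip A (H2 x))\<bar>
     \<le> (2 * B + 2 * B * (1 + B)) * A powr (2 - p)" by (rule covar_clip[OF H pq(1) A])
  show ?thesis using 1 2 3 d1 d2 covar_commute[of H1 U2] covar_commute[of H1 H2]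
    by (simp add: algebra_simps abs_le_iff) linarith
qed

end

section \<open>Mixing and stationarity\<close>

text \<open>Needed on the whole line for the conditional Jensen inequality, which bounds the moments
  of the window approximants.\<close>

lemma convex_on_abs_powr:
  fixes p :: real assumes p: "1 \<le> p" shows "convex_on UNIV (\<lambda>x. \<bar>x\<bar> powr p)"
proof (rule convex_onI)
  have *: "((1 - t) * a + t * b) powr p \<le> (1 - t) * a powr p + t * b powr p"
    if t: "0 < t" "t < 1" and ab: "0 \<le> a" "0 \<le> b" for t a b :: real
  proof -
    \<comment> \<open>At the boundary point 0 of the half-line convexity reduces to this; it follows
      from s^p \<le> s for 0 < s < 1.\<close>
    have z: "(s * c) powr p \<le> s * c powr p" if "0 < s" "s < 1" "0 \<le> c" for s c :: real
    proof -
      have "s powr p \<le> s powr 1" using p that by (intro powr_mono') auto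
      then show ?thesis using that by (simp add: powr_mult mult_right_mono)
    qed
    consider "a = 0" | "b = 0" | "0 < a" "0 < b" using ab by linarith
    then show ?thesis
    proof cases
      case 1 then show ?thesis using z[of t b] t ab p by simp
    next
      case 2 then show ?thesis using z[of "1 - t" a] t ab p by simp
    next
      case 3
      then show ?thesis using convex_onD[OF powr_convex[OF p], of t a b] t by simp
    qed
  qed
  fix t x y :: real assume t: "0 < t" "t < 1"
  have "\<bar>(1 - t) *\<^sub>R x + t *\<^sub>R y\<bar> \<le> (1 - t) * \<bar>x\<bar> + t * \<bar>y\<bar>"
    using abs_triangle_ineq[of "(1 - t) * x" "t * y"] t by (simp add: abs_mult)
  then have "\<bar>(1 - t) *\<^sub>R x + t *\<^sub>R y\<bar> powr p \<le> ((1 - t) * \<bar>x\<bar> + t * \<bar>y\<bar>) powr p"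
    using p by (intro powr_mono2) auto
  also have "\<dots> \<le> (1 - t) * \<bar>x\<bar> powr p + t * \<bar>y\<bar> powr p" using t by (intro *) auto
  finally show "\<bar>(1 - t) *\<^sub>R x + t *\<^sub>R y\<bar> powr p \<le> (1 - t) * \<bar>x\<bar> powr p + t * \<bar>y\<bar> powr p" .
qed auto

text \<open>Its purpose is to write a conditional expectation given a window of \<open>Y\<close> as
  a functional of the path, which can then be evaluated at any time.\<close>

lemma Doob_Dynkin_real:
  fixes u :: "'a \<Rightarrow> real"
  assumes T: "T \<in> space F \<rightarrow> space N"
    and F: "sets F = {T -` A \<inter> space F | A. A \<in> sets N}"
    and u: "u \<in> borel_measurable F"
  shows "\<exists>h\<in>borel_measurable N. \<forall>x\<in>space F. u x = h (T x)"
proof -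
  have *: "\<exists>h\<in>borel_measurable N. \<forall>x\<in>space F. v x = h (T x)"
    if "v \<in> borel_measurable F" "\<And>x. 0 \<le> v x" for v :: "'a \<Rightarrow> real"
    using that
  proof (induction rule: borel_measurable_induct_real)
    case (set A)
    then have "A \<in> {T -` A \<inter> space F | A. A \<in> sets N}" by (simp only: F)
    then obtain B where B: "A = T -` B \<inter> space F" "B \<in> sets N" by blast
    then show ?case by (intro bexI[of _ "indicator B"]) (auto simp: indicator_def)
  next
    case (mult u c)
    then obtain h where "h\<in>borel_measurable N" "\<forall>x\<in>space F. u x = h (T x)" by blast
    then show ?case by (intro bexI[of _ "\<lambda>y. c * h y"]) auto
  next
    case (add u v)
    then obtain h h' where "h\<in>borel_measurable N" "\<forall>x\<in>space F. u x = h (T x)"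
      "h'\<in>borel_measurable N" "\<forall>x\<in>space F. v x = h' (T x)" by blast
    then show ?case by (intro bexI[of _ "\<lambda>y. h' y + h y"]) auto
  next
    case (seq U)
    then obtain H where H[measurable]: "\<And>i. H i \<in> borel_measurable N"
      and H': "\<And>i x. x \<in> space F \<Longrightarrow> U i x = H i (T x)" by metis
    have "v x = lim (\<lambda>i. H i (T x))" if "x \<in> space F" for x
      using seq.hyps(4)[OF that] H'[OF that] by (simp add: limI)
    \<comment> \<open>Outside the range of \<open>T\<close> the sequence \<open>H i y\<close> may
      diverge. The function \<open>lim\<close> is nevertheless measurable, and only its values at
      the points \<open>T x\<close> matter.\<close>
    then show ?case by (intro bexI[of _ "\<lambda>y. lim (\<lambda>i. H i y)"]) auto
  qed
  have [measurable]: "u \<in> borel_measurable F" by fact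
  obtain h1 where h1: "h1 \<in> borel_measurable N" "\<And>x. x \<in> space F \<Longrightarrow> max 0 (u x) = h1 (T x)"
    using *[of "\<lambda>x. max 0 (u x)"] by auto
  obtain h2 where h2: "h2 \<in> borel_measurable N" "\<And>x. x \<in> space F \<Longrightarrow> max 0 (- u x) = h2 (T x)"
    using *[of "\<lambda>x. max 0 (- u x)"] by auto
  have "u x = h1 (T x) - h2 (T x)" if "x \<in> space F" for x
    using h1(2)[OF that] h2(2)[OF that] by (auto simp: max_def split: if_splits)
  then show ?thesis using h1 h2 by (intro bexI[of _ "\<lambda>y. h1 y - h2 y"]) auto
qed

context prob_space
begin

text \<open>Replacing \<open>u\<close> by the sign of \<open>E(v | F) - E v\<close> can only increase the covariance; doing this on
  both sides reduces the mixing inequality to events.\<close>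
lemma covar_le_sign:
  assumes F: "subalgebra M F"
    and u[measurable]: "u \<in> borel_measurable F" and v[measurable]: "v \<in> borel_measurable M"
    and bu: "\<And>x. \<bar>u x\<bar> \<le> K" and bv: "\<And>x. \<bar>v x\<bar> \<le> L"
  obtains A where "A \<in> sets F" "\<bar>covar M u v\<bar> \<le> K * covar M (\<lambda>x. 2 * indicator A x - 1) v"
proof -
  interpret finite_measure_subalgebra M F
    by (unfold_locales) (fact F)
  note [measurable] = measurable_from_subalg[OF F u]
  define e where "e x = real_cond_exp M F v x - expectation v" for x
  have e[measurable]: "e \<in> borel_measurable F" unfolding e_def by measurable
  note [measurable] = measurable_from_subalg[OF F e]
  define A where "A = {x\<in>space F. 0 \<le> e x}"
  have A[measurable]: "A \<in> sets F" unfolding A_def by measurable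
  have AM[measurable]: "A \<in> sets M" using A F by (auto simp: subalgebra_def)
  have sp: "space F = space M" using F by (simp add: subalgebra_def)
  have iv: "integrable M v" by (rule integrable_const_bound[of _ L]) (use bv in auto)
  have ie: "integrable M e" unfolding e_def using real_cond_exp_int(1)[OF iv] by simp
  \<comment> \<open>For \<open>F\<close>-measurable \<open>w\<close> the conditional expectation may
    replace \<open>v\<close>, so the covariance with \<open>v\<close> is integration against the
    single function \<open>e\<close>.\<close>
  have main: "covar M w v = expectation (\<lambda>x. w x * e x)" "integrable M (\<lambda>x. w x * e x)"
    if w[measurable]: "w \<in> borel_measurable F" and bw: "\<And>x. \<bar>w x\<bar> \<le> C" for w C
  proof -
    note [measurable] = measurable_from_subalg[OF F w]
    have "\<bar>w x * v x\<bar> \<le> C * L" for x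
      unfolding abs_mult using bw[of x] bv[of x] by (intro mult_mono) auto
    then have iwv: "integrable M (\<lambda>x. w x * v x)" by (intro integrable_const_bound[of _ "C * L"]) auto
    have iw: "integrable M w" by (rule integrable_const_bound[of _ C]) (use bw in auto)
    note c = real_cond_exp_intg[OF iwv w v]
    have eq: "w x * e x = w x * real_cond_exp M F v x - expectation v * w x" for x
      by (simp add: e_def algebra_simps)
    show "covar M w v = expectation (\<lambda>x. w x * e x)"
      unfolding eq using c iw by (simp add: covar_def mult.commute)
    show "integrable M (\<lambda>x. w x * e x)" unfolding eq using c iw by simp
  qed
  have "K * \<bar>e x\<bar> = K * ((2 * indicator A x - 1) * e x)" if "x \<in> space M" for x
    using that by (auto simp: A_def sp indicator_def)
  then have Ke: "expectation (\<lambda>x. K * \<bar>e x\<bar>) = K * expectation (\<lambda>x. (2 * indicator A x - 1) * e x)"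
    by (subst integral_mult_right_zero[symmetric]) (intro Bochner_Integration.integral_cong, auto)
  have "\<bar>covar M u v\<bar> = \<bar>expectation (\<lambda>x. u x * e x)\<bar>" using main(1)[OF u bu] by simp
  also have "\<dots> \<le> expectation (\<lambda>x. \<bar>u x * e x\<bar>)"
    using integral_norm_bound[of M "\<lambda>x. u x * e x"] by simp
  also have "\<dots> \<le> expectation (\<lambda>x. K * \<bar>e x\<bar>)"
    using integrable_abs[OF main(2)[OF u bu]] ie bu by (intro integral_mono) (auto simp: abs_mult intro!: mult_right_mono)
  also have "\<dots> = K * covar M (\<lambda>x. 2 * indicator A x - 1) v"
    unfolding Ke by (subst main(1)[of "\<lambda>x. 2 * indicator A x - 1" 1]) (auto simp: indicator_def)
  finally show ?thesis using that A by blast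
qed

text \<open>The factor 4 arises because the sign functions 2 1_A - 1 and 2 1_B - 1 have covariance 4
  (P(A \<inter> B) - P(A) P(B)); the bounds \<open>K\<close> and \<open>L\<close> are split off in
  the two applications of \<open>covar_le_sign\<close>.\<close>

lemma covar_le_mixing:
  assumes F: "subalgebra M F" and G: "subalgebra M G"
    and mix: "\<And>A B. A \<in> sets F \<Longrightarrow> B \<in> sets G \<Longrightarrow> \<bar>prob (A \<inter> B) - prob A * prob B\<bar> \<le> a"
    and u[measurable]: "u \<in> borel_measurable F" and v[measurable]: "v \<in> borel_measurable G"
    and bu: "\<And>x. \<bar>u x\<bar> \<le> K" and bv: "\<And>x. \<bar>v x\<bar> \<le> L"
  shows "\<bar>covar M u v\<bar> \<le> 4 * K * L * a"
proof -
  have K: "0 \<le> K" "0 \<le> L" using bu[of undefined] bv[of undefined] by auto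
  note [measurable] = measurable_from_subalg[OF F u] measurable_from_subalg[OF G v]
  obtain A where A: "A \<in> sets F" "\<bar>covar M u v\<bar> \<le> K * covar M (\<lambda>x. 2 * indicator A x - 1) v"
    using covar_le_sign[OF F u, of v K L] bu bv by auto
  have AM[measurable]: "A \<in> sets M" using A F by (auto simp: subalgebra_def)
  obtain B where B: "B \<in> sets G"
    "\<bar>covar M v (\<lambda>x. 2 * indicator A x - 1)\<bar> \<le> L * covar M (\<lambda>x. 2 * indicator B x - 1) (\<lambda>x. 2 * indicator A x - 1)"
    proof (rule covar_le_sign[OF G v, of "\<lambda>x. 2 * indicator A x - 1" L 1])
    show "\<bar>2 * indicator A x - 1 :: real\<bar> \<le> 1" for x by (auto simp: indicator_def)
  qed (use bv in auto)
  have BM[measurable]: "B \<in> sets M" using B G by (auto simp: subalgebra_def)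
  have "(2 * indicator B x - 1) * (2 * indicator A x - 1 :: real)
     = 4 * indicator (A \<inter> B) x - 2 * indicator A x - 2 * indicator B x + 1" for x
    by (auto simp: indicator_def)
  then have "expectation (\<lambda>x. (2 * indicator B x - 1) * (2 * indicator A x - 1))
     = 4 * prob (A \<inter> B) - 2 * prob A - 2 * prob B + 1"
    by (simp add: prob_space less_top[symmetric])
  then have "covar M (\<lambda>x. 2 * indicator B x - 1) (\<lambda>x. 2 * indicator A x - 1)
     = 4 * (prob (A \<inter> B) - prob A * prob B)"
    by (simp add: covar_def prob_space less_top[symmetric] algebra_simps)
  also have "\<dots> \<le> 4 * a" using mix[OF A(1) B(1)] by (simp add: abs_le_iff)
  finally have *: "L * covar M (\<lambda>x. 2 * indicator B x - 1) (\<lambda>x. 2 * indicator A x - 1) \<le> L * (4 * a)"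
    using K by (intro mult_left_mono)
  have "K * covar M (\<lambda>x. 2 * indicator A x - 1) v \<le> K * (L * (4 * a))"
    using B(2) * K covar_commute[of v "\<lambda>x. 2 * indicator A x - 1"] by (intro mult_left_mono) auto
  with A(2) show ?thesis by (simp add: mult.assoc mult.left_commute)
qed

end

section \<open>Sigma-algebras generated by coordinates, and functionals of finite windows\<close>

lemma space_gen_subalg [simp]: "space (gen_subalg M Y I) = space M"
  unfolding gen_subalg_def by (rule space_measure_of) (auto simp: gen_sets_def)

lemma sets_gen_subalg: "sets (gen_subalg M Y I) = gen_sigma M Y I"
  unfolding gen_subalg_def gen_sigma_def by (rule sets_measure_of) (auto simp: gen_sets_def)

lemma sets_gen_subalg_mono: "I \<subseteq> J \<Longrightarrow> sets (gen_subalg M Y I) \<subseteq> sets (gen_subalg M Y J)"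
  unfolding sets_gen_subalg gen_sigma_def by (rule sigma_sets_mono') (auto simp: gen_sets_def)

lemma measurable_gen_subalg_mono:
  assumes "u \<in> measurable (gen_subalg M Y I) N" "I \<subseteq> J"
  shows "u \<in> measurable (gen_subalg M Y J) N"
  using assms sets_gen_subalg_mono[OF assms(2), of M Y]
  by (auto simp: measurable_def)

lemma subalgebra_gen_subalg:
  assumes "\<And>j. Y j \<in> borel_measurable M" shows "subalgebra M (gen_subalg M Y I)"
proof -
  have "gen_sets M Y I \<subseteq> sets M" using assms by (auto simp: gen_sets_def)
  then show ?thesis unfolding subalgebra_def sets_gen_subalg gen_sigma_def
    by (simp add: sets.sigma_sets_subset)
qed

abbreviation path_space :: "(int \<Rightarrow> real) measure" where
  "path_space \<equiv> PiM UNIV (\<lambda>_. borel)"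

text \<open>Finite windows are encoded by a sub-sigma-algebra on the space of full paths, not by
  functions of 2m+1 variables. All window functionals then have the type of \<open>f\<close>, can be
  passed to \<open>Xproc\<close>, and can be compared across different radii.\<close>

definition window_alg :: "nat \<Rightarrow> (int \<Rightarrow> real) measure" where
  "window_alg m = gen_subalg path_space (\<lambda>j x. x j) {- int m..int m}"

lemma measurable_window_alg_path_space:
  assumes "h \<in> measurable (window_alg m) N" shows "h \<in> measurable path_space N"
proof (rule measurable_from_subalg)
  show "subalgebra path_space (window_alg m)"
    unfolding window_alg_def by (rule subalgebra_gen_subalg) simp
qed fact

lemma measurable_window_alg_mono:
  "h \<in> measurable (window_alg m) N \<Longrightarrow> m \<le> m' \<Longrightarrow> h \<in> measurable (window_alg m') N"
  unfolding window_alg_def by (rule measurable_gen_subalg_mono) auto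

lemma measurable_Xproc_window:
  assumes h: "h \<in> borel_measurable (window_alg m)"
  shows "Xproc h Y i \<in> borel_measurable (gen_subalg M Y {i - int m..i + int m})"
proof -
  have "(\<lambda>\<omega> k. Y (i + k) \<omega>) \<in> measurable (gen_subalg M Y {i - int m..i + int m}) (window_alg m)"
    unfolding window_alg_def
  proof (subst (2) gen_subalg_def, rule measurable_measure_of)
    fix C assume "C \<in> gen_sets path_space (\<lambda>j x. x j) {- int m..int m}"
    then obtain j B where C: "C = (\<lambda>x. x j) -` B \<inter> space path_space" "j \<in> {- int m..int m}" "B \<in> sets borel"
      by (auto simp: gen_sets_def)
    have "(\<lambda>\<omega> k. Y (i + k) \<omega>) -` C \<inter> space M = Y (i + j) -` B \<inter> space M"
      by (auto simp: C space_PiM)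
    also have "\<dots> \<in> gen_sigma M Y {i - int m..i + int m}"
      unfolding gen_sigma_def gen_sets_def using C by (intro sigma_sets.Basic) force
    finally show "(\<lambda>\<omega> k. Y (i + k) \<omega>) -` C \<inter> space (gen_subalg M Y {i - int m..i + int m})
      \<in> sets (gen_subalg M Y {i - int m..i + int m})" by (simp add: sets_gen_subalg)
  qed (auto simp: gen_sets_def space_PiM)
  from measurable_compose[OF this h] show ?thesis by (simp add: Xproc_def[abs_def])
qed

text \<open>The sigma-algebra of the window around \<open>i\<close> is the preimage of
  \<open>window_alg m\<close> under the map from \<omega> to the path seen from \<open>i\<close>:
  for generators this is a shift of indices by \<open>i\<close>, and preimages commute with
  generation. Factorisation through that map yields \<open>h\<close>.\<close>

lemma window_functional_of_measurable:
  fixes u :: "'a \<Rightarrow> real"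
  assumes u: "u \<in> borel_measurable (gen_subalg M Y {i - int m..i + int m})"
  shows "\<exists>h\<in>borel_measurable (window_alg m). \<forall>\<omega>\<in>space M. u \<omega> = Xproc h Y i \<omega>"
proof -
  let ?T = "\<lambda>\<omega> k. Y (i + k) \<omega>" and ?I = "{i - int m..i + int m}"
  have T: "?T \<in> space M \<rightarrow> space path_space" by (auto simp: space_PiM)
  have gen: "gen_sets M Y ?I = {?T -` A \<inter> space M |A. A \<in> gen_sets path_space (\<lambda>j x. x j) {- int m..int m}}"
  proof (intro set_eqI iffI)
    fix C assume "C \<in> gen_sets M Y ?I"
    then obtain j B where C: "C = Y j -` B \<inter> space M" "j \<in> ?I" "B \<in> sets borel" by (auto simp: gen_sets_def)
    have "C = ?T -` ((\<lambda>x. x (j - i)) -` B \<inter> space path_space) \<inter> space M" by (auto simp: C space_PiM)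
    moreover have "(\<lambda>x. x (j - i)) -` B \<inter> space path_space \<in> gen_sets path_space (\<lambda>j x. x j) {- int m..int m}"
      unfolding gen_sets_def using C by (intro CollectI exI[of _ "j - i"] exI[of _ B]) auto
    ultimately show "C \<in> {?T -` A \<inter> space M |A. A \<in> gen_sets path_space (\<lambda>j x. x j) {- int m..int m}}" by blast
  next
    fix C assume "C \<in> {?T -` A \<inter> space M |A. A \<in> gen_sets path_space (\<lambda>j x. x j) {- int m..int m}}"
    then obtain j B where C: "C = ?T -` ((\<lambda>x. x j) -` B \<inter> space path_space) \<inter> space M"
      "j \<in> {- int m..int m}" "B \<in> sets borel" by (auto simp: gen_sets_def)
    have "C = Y (i + j) -` B \<inter> space M" by (auto simp: C space_PiM)
    then show "C \<in> gen_sets M Y ?I" unfolding gen_sets_def using C by (intro CollectI exI[of _ "i + j"] exI[of _ B]) auto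
  qed
  have "\<exists>h\<in>borel_measurable (window_alg m). \<forall>\<omega>\<in>space (gen_subalg M Y ?I). u \<omega> = h (?T \<omega>)"
  proof (rule Doob_Dynkin_real)
    show "?T \<in> space (gen_subalg M Y ?I) \<rightarrow> space (window_alg m)" using T by (simp add: window_alg_def)
    show "sets (gen_subalg M Y ?I) = {?T -` A \<inter> space (gen_subalg M Y ?I) |A. A \<in> sets (window_alg m)}"
      unfolding sets_gen_subalg window_alg_def gen_sigma_def space_gen_subalg
      by (subst sigma_sets_vimage_commute[OF T]) (simp only: gen)
  qed fact
  then show ?thesis by (simp add: Xproc_def)
qed

section \<open>Stationary processes and their mixing coefficients\<close>

locale stationary_process = prob_space M for M :: "'a measure" +
  fixes Y :: "int \<Rightarrow> 'a \<Rightarrow> real"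
  assumes Y_measurable [measurable]: "\<And>j. Y j \<in> borel_measurable M"
    and stationary: "stationary_proc M Y"
begin

lemma measurable_path: "(\<lambda>\<omega> k. Y (i + k) \<omega>) \<in> measurable M path_space"
  by (rule measurable_PiM_single') (auto simp: space_PiM)

lemma measurable_Xproc: "h \<in> borel_measurable path_space \<Longrightarrow> Xproc h Y i \<in> borel_measurable M"
  unfolding Xproc_def[abs_def] by (rule measurable_compose[OF measurable_path])

lemma distr_path: "distr M path_space (\<lambda>\<omega> k. Y (i + k) \<omega>) = distr M path_space (\<lambda>\<omega> k. Y k \<omega>)"
  using stationary unfolding stationary_proc_def by (simp add: add.commute[of i])

lemma
  assumes [measurable]: "h \<in> borel_measurable path_space"
  shows integrable_Xproc_shift: "integrable M (Xproc h Y i) \<longleftrightarrow> integrable M (Xproc h Y j)"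
    and expectation_Xproc_shift: "expectation (Xproc h Y i) = expectation (Xproc h Y j)"
proof -
  note [measurable] = measurable_path
  have "integrable M (Xproc h Y i) \<longleftrightarrow> integrable (distr M path_space (\<lambda>\<omega> k. Y k \<omega>)) h" for i
    unfolding distr_path[of i, symmetric] Xproc_def[abs_def] by (subst integrable_distr_eq) auto
  then show "integrable M (Xproc h Y i) \<longleftrightarrow> integrable M (Xproc h Y j)" by blast
  have "expectation (Xproc h Y i) = integral\<^sup>L (distr M path_space (\<lambda>\<omega> k. Y k \<omega>)) h" for i
    unfolding distr_path[of i, symmetric] Xproc_def[abs_def] by (subst integral_distr) auto
  then show "expectation (Xproc h Y i) = expectation (Xproc h Y j)" by simp
qed

lemma moment_le_Xproc_shift:
  assumes h[measurable]: "h \<in> borel_measurable path_space" and "moment_le M p B (Xproc h Y i)"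
  shows "moment_le M p B (Xproc h Y j)"
  using assms integrable_Xproc_shift[of "\<lambda>x. \<bar>h x\<bar> powr p" i j]
     expectation_Xproc_shift[of "\<lambda>x. \<bar>h x\<bar> powr p" i j] measurable_Xproc[OF h]
  unfolding moment_le_def Xproc_def[abs_def] by auto

lemma measurable_shift: "(\<lambda>x k. x (i + k)) \<in> measurable path_space path_space"
  by (rule measurable_PiM_single') (auto simp: space_PiM)

text \<open>The product at two times is one functional of a shifted path, so the one-time shift
  invariance applies to it.\<close>

lemma expectation_Xproc_mult_shift:
  assumes [measurable]: "h \<in> borel_measurable path_space" "g \<in> borel_measurable path_space"
  shows "expectation (\<lambda>\<omega>. Xproc h Y (i + s) \<omega> * Xproc g Y (j + s) \<omega>)
     = expectation (\<lambda>\<omega>. Xproc h Y i \<omega> * Xproc g Y j \<omega>)"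
proof -
  have "(\<lambda>x. h (\<lambda>k. x (i + k)) * g (\<lambda>k. x (j + k))) \<in> borel_measurable path_space"
    by (intro borel_measurable_times measurable_compose[OF measurable_shift] assms)
  from expectation_Xproc_shift[OF this, of s 0] show ?thesis
    unfolding Xproc_def by (simp add: ac_simps)
qed

lemma abs_mixing_le_one:
  "\<bar>prob A' - prob A * prob B\<bar> \<le> 1"
proof -
  have "0 \<le> prob A * prob B" "prob A * prob B \<le> 1" by (auto simp: mult_le_one)
  then show ?thesis using prob_le_1[of A'] measure_nonneg[of M A'] unfolding abs_le_iff by linarith
qed

text \<open>A real supremum bounds its members only if the set is bounded above; the trivial bound 1
  provides this.\<close>

lemma alpha_mix_upper:
  assumes "1 \<le> n" "A \<in> sets (gen_subalg M Y {..n})" "B \<in> sets (gen_subalg M Y {n + int k..})"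
  shows "\<bar>prob (A \<inter> B) - prob A * prob B\<bar> \<le> alpha_mix M Y k"
  unfolding alpha_mix_def
proof (rule cSup_upper)
  show "bdd_above {\<bar>prob (A \<inter> B) - prob A * prob B\<bar> |n A B.
     1 \<le> n \<and> A \<in> gen_sigma M Y {..n} \<and> B \<in> gen_sigma M Y {n + int k..}}"
    by (rule bdd_aboveI[of _ 1]) (use abs_mixing_le_one in blast)
qed (use assms in \<open>auto simp: sets_gen_subalg\<close>)

lemma alpha_mix_bounds: "0 \<le> alpha_mix M Y k" "alpha_mix M Y k \<le> 1"
proof -
  show "0 \<le> alpha_mix M Y k" using alpha_mix_upper[of 1 "{}" "{}" k] by simp
  have "{} \<in> gen_sigma M Y I" for I unfolding gen_sigma_def by (rule sigma_sets.Empty)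
  then show "alpha_mix M Y k \<le> 1" unfolding alpha_mix_def
    by (intro cSup_least) (auto intro!: abs_mixing_le_one exI[of _ "1::int"])
qed

text \<open>The requirement 1 \<le> \<open>n\<close> comes from the supremum in
  \<open>alpha_mix\<close>; it is the source of the positivity conditions on times in the
  applications below.\<close>

lemma covar_le_alpha_mix:
  assumes "1 \<le> n" "u \<in> borel_measurable (gen_subalg M Y {..n})" "v \<in> borel_measurable (gen_subalg M Y {n + int k..})"
    and "\<And>x. \<bar>u x\<bar> \<le> K" "\<And>x. \<bar>v x\<bar> \<le> L"
  shows "\<bar>covar M u v\<bar> \<le> 4 * K * L * alpha_mix M Y k"
  using assms by (intro covar_le_mixing[OF subalgebra_gen_subalg subalgebra_gen_subalg])
    (auto intro: alpha_mix_upper[OF assms(1)])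

text \<open>The functional \<open>g\<close> represents the conditional expectation of X_1 given the
  window, so its error in the q-th mean is the \<psi>-coefficient once \<open>q\<close> is
  specialised. By the conditional Jensen inequality it keeps the moment bound \<open>B\<close> of
  X_1, uniformly in \<open>m\<close>.\<close>

lemma window_approximation:
  assumes f[measurable]: "f \<in> borel_measurable path_space" and p: "1 < q" "q \<le> p"
    and X: "moment_le M p B (Xproc f Y 1)"
  shows "\<exists>g\<in>borel_measurable (window_alg m). moment_le M p B (Xproc g Y 1)
     \<and> integrable M (\<lambda>\<omega>. \<bar>Xproc f Y 1 \<omega> - Xproc g Y 1 \<omega>\<bar> powr q)
     \<and> expectation (\<lambda>\<omega>. \<bar>Xproc f Y 1 \<omega> - Xproc g Y 1 \<omega>\<bar> powr q)
        = expectation (\<lambda>\<omega>. \<bar>Xproc f Y 1 \<omega> - real_cond_exp M (gen_subalg M Y {1 - int m..1 + int m}) (Xproc f Y 1) \<omega>\<bar> powr q)"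
proof -
  let ?F = "gen_subalg M Y {1 - int m..1 + int m}" and ?X = "Xproc f Y 1"
  interpret finite_measure_subalgebra M ?F
    by unfold_locales (rule subalgebra_gen_subalg, simp)
  note [measurable] = measurable_Xproc[OF f]
  have iX: "integrable M ?X" using moment_le_integrable[OF X] p by simp
  note pX = moment_leD(2,3)[OF X]
  have "real_cond_exp M ?F ?X \<in> borel_measurable ?F" by simp
  from window_functional_of_measurable[OF this] obtain g where
    g: "g \<in> borel_measurable (window_alg m)" "\<And>\<omega>. \<omega> \<in> space M \<Longrightarrow> real_cond_exp M ?F ?X \<omega> = Xproc g Y 1 \<omega>"
    by blast
  have [measurable]: "g \<in> borel_measurable path_space" by (rule measurable_window_alg_path_space) fact
  have gM[measurable]: "Xproc g Y 1 \<in> borel_measurable M" by (rule measurable_Xproc) fact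
  have "AE x in M. \<bar>real_cond_exp M ?F ?X x\<bar> powr p \<le> real_cond_exp M ?F (\<lambda>x. \<bar>?X x\<bar> powr p) x"
    by (rule real_cond_exp_jensens_inequality(2)[where I=UNIV])
       (use iX pX p in \<open>auto intro!: convex_on_abs_powr\<close>)
  then have ae: "AE x in M. \<bar>Xproc g Y 1 x\<bar> powr p \<le> real_cond_exp M ?F (\<lambda>x. \<bar>?X x\<bar> powr p) x"
    using AE_space by eventually_elim (simp add: g)
  note c = real_cond_exp_int[OF pX(1)]
  have ig: "integrable M (\<lambda>x. \<bar>Xproc g Y 1 x\<bar> powr p)"
    by (rule Bochner_Integration.integrable_bound[OF c(1)]) (use ae in \<open>auto\<close>)
  have "expectation (\<lambda>x. \<bar>Xproc g Y 1 x\<bar> powr p) \<le> expectation (\<lambda>x. \<bar>?X x\<bar> powr p)"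
    unfolding c(2)[symmetric] by (rule integral_mono_AE[OF ig c(1) ae])
  then have mg: "moment_le M p B (Xproc g Y 1)" unfolding moment_le_def using ig pX by auto
  have iq: "integrable M (\<lambda>\<omega>. \<bar>?X \<omega> - Xproc g Y 1 \<omega>\<bar> powr q)"
  proof (rule Bochner_Integration.integrable_bound)
    show "integrable M (\<lambda>\<omega>. 2 powr q * (\<bar>?X \<omega>\<bar> powr q + \<bar>Xproc g Y 1 \<omega>\<bar> powr q))"
      using moment_le_integrable_powr(1)[OF X, of q] moment_le_integrable_powr(1)[OF mg, of q] p by auto
    show "AE \<omega> in M. norm (\<bar>?X \<omega> - Xproc g Y 1 \<omega>\<bar> powr q) \<le> norm (2 powr q * (\<bar>?X \<omega>\<bar> powr q + \<bar>Xproc g Y 1 \<omega>\<bar> powr q))"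
      using abs_add_powr_le[of q "?X _" "- Xproc g Y 1 _"] p by (auto simp: abs_mult)
  qed auto
  have "expectation (\<lambda>\<omega>. \<bar>?X \<omega> - Xproc g Y 1 \<omega>\<bar> powr q) = expectation (\<lambda>\<omega>. \<bar>?X \<omega> - real_cond_exp M ?F ?X \<omega>\<bar> powr q)"
    by (intro Bochner_Integration.integral_cong) (auto simp: g)
  with g mg iq show ?thesis by blast
qed

end

section \<open>Autocovariances\<close>

lemma Cesaro_limit:
  fixes s :: "nat \<Rightarrow> real"
  assumes "s \<longlonglongrightarrow> L" shows "(\<lambda>n. (\<Sum>t<n. s t) / real n) \<longlonglongrightarrow> L"
proof (rule LIMSEQ_I)
  fix e :: real assume e: "0 < e"
  obtain N where N: "\<And>n. n \<ge> N \<Longrightarrow> \<bar>s n - L\<bar> < e / 2"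
    using LIMSEQ_D[OF assms, of "e / 2"] e by auto
  define D where "D = (\<Sum>t<N. \<bar>s t - L\<bar>)"
  obtain N' where N': "2 * D / e < real N'" using reals_Archimedean2 by blast
  show "\<exists>no. \<forall>n\<ge>no. norm ((\<Sum>t<n. s t) / real n - L) < e"
  proof (intro exI allI impI)
    fix n assume n: "n \<ge> max (Suc N) N'"
    then have n0: "0 < real n" by auto
    have "(\<Sum>t<n. s t) / real n - L = (\<Sum>t<n. s t - L) / real n"
      using n0 by (simp add: sum_subtractf field_simps)
    then have "norm ((\<Sum>t<n. s t) / real n - L) = \<bar>\<Sum>t<n. s t - L\<bar> / real n" by simp
    also have "\<dots> \<le> (\<Sum>t<n. \<bar>s t - L\<bar>) / real n" by (intro divide_right_mono sum_abs) auto
    also have "(\<Sum>t<n. \<bar>s t - L\<bar>) = D + (\<Sum>t\<in>{N..<n}. \<bar>s t - L\<bar>)"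
      unfolding D_def using n by (subst sum.atLeastLessThan_concat[symmetric, of 0 N n, unfolded atLeast0LessThan]) auto
    also have "(D + (\<Sum>t\<in>{N..<n}. \<bar>s t - L\<bar>)) / real n \<le> (D + (\<Sum>t\<in>{N..<n}. e / 2)) / real n"
      using N by (intro divide_right_mono add_left_mono sum_mono) (auto simp: less_imp_le)
    also have "\<dots> \<le> (D + real n * (e / 2)) / real n"
      using n e by (intro divide_right_mono add_left_mono) (auto simp: mult_right_mono of_nat_diff)
    also have "\<dots> = D / real n + e / 2" using n0 by (simp add: add_divide_distrib)
    also have "D / real n < e / 2"
    proof -
      have "2 * D / e < real n" using N' n by (simp add: max_def split: if_splits)
      then show ?thesis using e n0 by (simp add: field_simps)
    qed
    finally show "norm ((\<Sum>t<n. s t) / real n - L) < e" by simp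
  qed
qed

text \<open>Each value of \<open>a\<close> occurs \<open>d\<close> times. It is used with
  \<open>d\<close> = 3, since lag k is treated with window radius k div 3.\<close>

lemma summable_div_nat:
  fixes a :: "nat \<Rightarrow> real"
  assumes a: "summable a" "\<And>n. 0 \<le> a n" and d: "0 < d" shows "summable (\<lambda>k. a (k div d))"
proof (rule summableI_nonneg_bounded)
  fix n
  have "(\<Sum>k<n. a (k div d)) \<le> (\<Sum>k<n * d. a (k div d))"
    using d a by (intro sum_mono2) auto
  also have "\<dots> = (\<Sum>m<n. \<Sum>k\<in>{m * d..<m * d + d}. a (k div d))" by (simp add: sum.nat_group)
  also have "\<dots> = (\<Sum>m<n. \<Sum>k\<in>{m * d..<m * d + d}. a m)"
  proof (intro sum.cong refl)
    fix m k assume "k \<in> {m * d..<m * d + d}"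
    then have "k div d = m" by (intro div_nat_eqI) (auto simp: mult.commute)
    then show "a (k div d) = a m" by simp
  qed
  also have "\<dots> = d * (\<Sum>m<n. a m)" by (simp add: sum_distrib_left)
  also have "\<dots> \<le> d * suminf a" using a by (intro mult_left_mono sum_le_suminf) auto
  finally show "(\<Sum>k<n. a (k div d)) \<le> d * suminf a" .
qed (use a in auto)

text \<open>Otherwise \<open>a m\<close> \<ge> e/m for all large \<open>m\<close>, and the harmonic
  series would converge. Without monotonicity of \<open>a\<close> the product is small only for some
  arbitrarily large \<open>m\<close>, which is enough for choosing a window radius.\<close>

lemma summable_imp_index_mult_small:
  fixes a :: "nat \<Rightarrow> real"
  assumes a: "summable a" and e: "0 < e" shows "\<exists>m\<ge>N. 0 < m \<and> real m * a m < e"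
proof (rule ccontr)
  assume no: "\<not> ?thesis"
  have *: "e \<le> real m * a m" if "m \<ge> Suc N" for m
  proof -
    have "N \<le> m" "0 < m" using that by auto
    then show ?thesis using no by (meson not_less)
  qed
  have "inverse (real m) \<le> a m / e" if "m \<ge> Suc N" for m
    using *[OF that] that e by (simp add: field_simps)
  then have "norm (inverse (real m)) \<le> a m / e" if "m \<ge> Suc N" for m using that by simp
  then have "summable (\<lambda>m. inverse (real m))"
    by (rule summable_comparison_test'[OF summable_divide[OF a]])
  then show False using not_summable_harmonic[where 'a=real] by simp
qed

context stationary_process
begin

definition acov :: "((int \<Rightarrow> real) \<Rightarrow> real) \<Rightarrow> nat \<Rightarrow> real" where
  "acov h k = covar M (Xproc h Y 1) (Xproc h Y (1 + int k))"

definition centered :: "((int \<Rightarrow> real) \<Rightarrow> real) \<Rightarrow> (int \<Rightarrow> real) \<Rightarrow> real" where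
  "centered h = (\<lambda>x. h x - expectation (Xproc h Y 1))"

lemma covar_Xproc:
  assumes h: "h \<in> borel_measurable path_space"
  shows "covar M (Xproc h Y i) (Xproc h Y j) = acov h (nat \<bar>i - j\<bar>)"
proof -
  have *: "covar M (Xproc h Y i) (Xproc h Y (i + int k)) = acov h k" for i k
  proof -
    have "expectation (\<lambda>\<omega>. Xproc h Y i \<omega> * Xproc h Y (i + int k) \<omega>)
      = expectation (\<lambda>\<omega>. Xproc h Y 1 \<omega> * Xproc h Y (1 + int k) \<omega>)"
      using expectation_Xproc_mult_shift[OF h h, of 1 "i - 1" "1 + int k"] by (simp add: add.commute)
    then show ?thesis unfolding acov_def covar_def
      using expectation_Xproc_shift[OF h, of i 1] expectation_Xproc_shift[OF h, of "i + int k" "1 + int k"] by simp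
  qed
  show ?thesis
  proof (cases "i \<le> j")
    case True then show ?thesis using *[of i "nat (j - i)"] by (simp add: abs_if)
  next
    case False then show ?thesis using *[of j "nat (i - j)"] by (simp add: abs_if covar_commute)
  qed
qed

lemma Xproc_centered: "Xproc (centered h) Y i \<omega> = Xproc h Y i \<omega> - expectation (Xproc h Y 1)"
  by (simp add: Xproc_def centered_def)

lemma measurable_centered: "h \<in> borel_measurable N \<Longrightarrow> centered h \<in> borel_measurable N"
  unfolding centered_def by (rule borel_measurable_diff) auto

lemma integrable_Xproc_square:
  assumes h: "h \<in> borel_measurable path_space" and s: "integrable M (\<lambda>\<omega>. (Xproc h Y 1 \<omega>)\<^sup>2)"
  shows "integrable M (\<lambda>\<omega>. (Xproc h Y i \<omega>)\<^sup>2)" "integrable M (Xproc h Y i)"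
    "integrable M (\<lambda>\<omega>. Xproc h Y i \<omega> * Xproc h Y j \<omega>)"
proof -
  show *: "integrable M (\<lambda>\<omega>. (Xproc h Y i \<omega>)\<^sup>2)" for i
    using integrable_Xproc_shift[of "\<lambda>x. (h x)\<^sup>2" i 1] h s by (simp add: Xproc_def[abs_def])
  show "integrable M (Xproc h Y i)" by (rule integrable_of_square[OF measurable_Xproc[OF h] *])
  show "integrable M (\<lambda>\<omega>. Xproc h Y i \<omega> * Xproc h Y j \<omega>)"
    by (rule integrable_mult_square[OF measurable_Xproc[OF h] measurable_Xproc[OF h] * *])
qed

lemma centered_square:
  assumes h: "h \<in> borel_measurable path_space" and s: "integrable M (\<lambda>\<omega>. (Xproc h Y 1 \<omega>)\<^sup>2)"
  shows "integrable M (\<lambda>\<omega>. (Xproc (centered h) Y 1 \<omega>)\<^sup>2)"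
    "expectation (Xproc (centered h) Y i) = 0" "acov (centered h) k = acov h k"
proof -
  note i = integrable_Xproc_square[OF h s]
  show "integrable M (\<lambda>\<omega>. (Xproc (centered h) Y 1 \<omega>)\<^sup>2)"
    unfolding Xproc_centered power2_diff using i by simp
  show "expectation (Xproc (centered h) Y i) = 0"
    using i expectation_Xproc_shift[OF h, of i 1] by (simp add: Xproc_centered[abs_def] prob_space)
  define m where "m = expectation (Xproc h Y 1)"
  have eq: "(a - m) * (b - m) = a * b - m * a - m * b + m * m" for a b :: real by (simp add: algebra_simps)
  show "acov (centered h) k = acov h k"
    unfolding acov_def covar_def Xproc_centered m_def[symmetric] eq
    using i expectation_Xproc_shift[OF h, of "1 + int k" 1]
    by (simp add: prob_space m_def[symmetric] Xproc_centered[abs_def])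
qed

lemma second_moment_sum:
  assumes h: "h \<in> borel_measurable path_space" and s: "integrable M (\<lambda>\<omega>. (Xproc h Y 1 \<omega>)\<^sup>2)"
    and z: "expectation (Xproc h Y 1) = 0" and G: "finite G"
  shows "integrable M (\<lambda>\<omega>. (\<Sum>i\<in>G. Xproc h Y i \<omega>)\<^sup>2)"
    "expectation (\<lambda>\<omega>. (\<Sum>i\<in>G. Xproc h Y i \<omega>)\<^sup>2) = (\<Sum>i\<in>G. \<Sum>j\<in>G. acov h (nat \<bar>i - j\<bar>))"
proof -
  note i = integrable_Xproc_square[OF h s]
  have eq: "(\<Sum>i\<in>G. Xproc h Y i \<omega>)\<^sup>2 = (\<Sum>i\<in>G. \<Sum>j\<in>G. Xproc h Y i \<omega> * Xproc h Y j \<omega>)" for \<omega>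
    by (simp add: power2_eq_square sum_product)
  show "integrable M (\<lambda>\<omega>. (\<Sum>i\<in>G. Xproc h Y i \<omega>)\<^sup>2)" unfolding eq using i by auto
  have "expectation (\<lambda>\<omega>. Xproc h Y i \<omega> * Xproc h Y j \<omega>) = acov h (nat \<bar>i - j\<bar>)" for i j
    unfolding covar_Xproc[OF h, symmetric] covar_def
    using z expectation_Xproc_shift[OF h, of _ 1] by simp
  then show "expectation (\<lambda>\<omega>. (\<Sum>i\<in>G. Xproc h Y i \<omega>)\<^sup>2) = (\<Sum>i\<in>G. \<Sum>j\<in>G. acov h (nat \<bar>i - j\<bar>))"
    unfolding eq using i by simp
qed

text \<open>Seen from an index i, the indices of \<open>G\<close> up to i realise each lag at most
  once, and so do those above i; each row therefore contributes at most twice the sum. Arbitrary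
  finite \<open>G\<close> are allowed because the indices left out by the block decomposition do not
  form an interval.\<close>

lemma second_moment_sum_le:
  assumes h: "h \<in> borel_measurable path_space" and s: "integrable M (\<lambda>\<omega>. (Xproc h Y 1 \<omega>)\<^sup>2)"
    and z: "expectation (Xproc h Y 1) = 0" and G: "finite G" and c: "summable (\<lambda>k. \<bar>acov h k\<bar>)"
  shows "expectation (\<lambda>\<omega>. (\<Sum>i\<in>G. Xproc h Y i \<omega>)\<^sup>2) \<le> real (card G) * (2 * (\<Sum>k. \<bar>acov h k\<bar>))"
proof -
  define D where "D = (\<Sum>k. \<bar>acov h k\<bar>)"
  have half: "(\<Sum>j\<in>H. \<bar>acov h (nat \<bar>i - j\<bar>)\<bar>) \<le> D"
    if "finite H" "inj_on (\<lambda>j. nat \<bar>i - j\<bar>) H" for H i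
  proof -
    have "(\<Sum>j\<in>H. \<bar>acov h (nat \<bar>i - j\<bar>)\<bar>) = (\<Sum>k\<in>(\<lambda>j. nat \<bar>i - j\<bar>) ` H. \<bar>acov h k\<bar>)"
      using that by (simp add: sum.reindex)
    also have "\<dots> \<le> D" unfolding D_def using that by (intro sum_le_suminf c) auto
    finally show ?thesis .
  qed
  have row: "(\<Sum>j\<in>G. \<bar>acov h (nat \<bar>i - j\<bar>)\<bar>) \<le> 2 * D" for i
  proof -
    have "(\<Sum>j\<in>G. \<bar>acov h (nat \<bar>i - j\<bar>)\<bar>) = (\<Sum>j\<in>G \<inter> {..i}. \<bar>acov h (nat \<bar>i - j\<bar>)\<bar>) + (\<Sum>j\<in>G \<inter> {i<..}. \<bar>acov h (nat \<bar>i - j\<bar>)\<bar>)"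
      using G by (subst sum.union_disjoint[symmetric]) (auto intro!: sum.cong)
    also have "\<dots> \<le> D + D" using G by (intro add_mono half) (auto intro!: inj_onI)
    finally show ?thesis by simp
  qed
  have "expectation (\<lambda>\<omega>. (\<Sum>i\<in>G. Xproc h Y i \<omega>)\<^sup>2) = (\<Sum>i\<in>G. \<Sum>j\<in>G. acov h (nat \<bar>i - j\<bar>))"
    by (rule second_moment_sum[OF h s z G])
  also have "\<dots> \<le> (\<Sum>i\<in>G. \<Sum>j\<in>G. \<bar>acov h (nat \<bar>i - j\<bar>)\<bar>)" by (intro sum_mono) auto
  also have "\<dots> \<le> (\<Sum>i\<in>G. 2 * D)" by (intro sum_mono row)
  finally show ?thesis by (simp add: D_def)
qed

text \<open>Adding the index t+1 to the first t adds one diagonal entry and two equal off-diagonal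
  rows. The second moment is thus a sum of partial sums of the covariance series, and dividing by n
  gives Cesaro means.\<close>

lemma second_moment_sum_limit:
  assumes h: "h \<in> borel_measurable path_space" and s: "integrable M (\<lambda>\<omega>. (Xproc h Y 1 \<omega>)\<^sup>2)"
    and z: "expectation (Xproc h Y 1) = 0" and c: "summable (\<lambda>k. \<bar>acov h k\<bar>)"
  shows "(\<lambda>n. expectation (\<lambda>\<omega>. (\<Sum>i=1..int n. Xproc h Y i \<omega>)\<^sup>2) / real n)
     \<longlonglongrightarrow> acov h 0 + 2 * (\<Sum>k. acov h (Suc k))"
proof -
  have "(\<Sum>i=1..int n. \<Sum>j=1..int n. acov h (nat \<bar>i - j\<bar>)) = (\<Sum>t<n. acov h 0 + 2 * (\<Sum>k<t. acov h (Suc k)))" for n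
  proof (induction n)
    case (Suc n)
    let ?a = "\<lambda>i j. acov h (nat \<bar>i - j\<bar>)"
    have I: "{1..int (Suc n)} = insert (int n + 1) {1..int n}" by auto
    have row: "(\<Sum>j=1..int n. ?a (int n + 1) j) = (\<Sum>k<n. acov h (Suc k))"
      by (rule sum.reindex_bij_witness[of _ "\<lambda>k. int n - int k" "\<lambda>j. nat (int n - j)"])
         (auto simp: nat_diff_distrib' Suc_nat_eq_nat_zadd1 intro!: arg_cong[where f="acov h"])
    have "(\<Sum>i=1..int (Suc n). \<Sum>j=1..int (Suc n). ?a i j)
       = (\<Sum>i=1..int n. \<Sum>j=1..int n. ?a i j) + acov h 0 + (\<Sum>j=1..int n. ?a (int n + 1) j) + (\<Sum>i=1..int n. ?a i (int n + 1))"
      unfolding I by (simp add: sum.distrib algebra_simps)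
    also have "(\<Sum>i=1..int n. ?a i (int n + 1)) = (\<Sum>j=1..int n. ?a (int n + 1) j)"
      by (intro sum.cong) (auto simp: abs_minus_commute)
    finally show ?case unfolding row Suc.IH by simp
  qed simp
  then have eq: "expectation (\<lambda>\<omega>. (\<Sum>i=1..int n. Xproc h Y i \<omega>)\<^sup>2) = (\<Sum>t<n. acov h 0 + 2 * (\<Sum>k<t. acov h (Suc k)))" for n
    using second_moment_sum[OF h s z] by simp
  have "summable (\<lambda>k. acov h (Suc k))" using summable_rabs_cancel[OF c] by (simp only: summable_Suc_iff)
  then have "(\<lambda>t. acov h 0 + 2 * (\<Sum>k<t. acov h (Suc k))) \<longlonglongrightarrow> acov h 0 + 2 * (\<Sum>k. acov h (Suc k))"
    by (intro tendsto_intros summable_LIMSEQ)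
  then show ?thesis unfolding eq by (rule Cesaro_limit)
qed

end

text \<open>\<open>\<rho>\<close> dominates the L^q-norm of the approximation error and also 1/j^2,
  so that one summable sequence measures all error terms. The condition 4 / (p - 2) + 2 \<le>
  \<open>\<mu>\<close> serves truncation, and 8 \<le> \<open>\<mu>\<close> serves the bounded window
  functionals.\<close>

locale mixing_functional = stationary_process +
  fixes f :: "(int \<Rightarrow> real) \<Rightarrow> real" and p q B C \<mu> :: real and \<rho> :: "nat \<Rightarrow> real"
    and g :: "nat \<Rightarrow> (int \<Rightarrow> real) \<Rightarrow> real"
  assumes f_measurable: "f \<in> borel_measurable path_space"
    and conjugate: "2 < p" "1 < q" "1 / p + 1 / q = 1"
    and f_moment: "moment_le M p B (Xproc f Y 1)"
    and mixing_rate: "\<And>k. 1 \<le> k \<Longrightarrow> alpha_mix M Y k \<le> C * real k powr (- \<mu>)"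
    and C_nonneg: "0 \<le> C" and \<mu>_large: "4 / (p - 2) + 2 \<le> \<mu>" "8 \<le> \<mu>"
    and g_measurable: "\<And>j. g j \<in> borel_measurable (window_alg j)"
    and g_moment: "\<And>j. moment_le M p B (Xproc (g j) Y 1)"
    and g_error: "\<And>j. integrable M (\<lambda>\<omega>. \<bar>Xproc f Y 1 \<omega> - Xproc (g j) Y 1 \<omega>\<bar> powr q)"
      "\<And>j. 1 \<le> j \<Longrightarrow> expectation (\<lambda>\<omega>. \<bar>Xproc f Y 1 \<omega> - Xproc (g j) Y 1 \<omega>\<bar> powr q) \<le> \<rho> j powr q"
    and \<rho>_ge: "\<And>j. 1 / (real j)\<^sup>2 \<le> \<rho> j"
    and \<rho>_summable: "summable \<rho>"
begin

lemma \<rho>_nonneg: "0 \<le> \<rho> j" by (rule order_trans[OF _ \<rho>_ge]) simp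

lemma \<rho>_pos: "1 \<le> j \<Longrightarrow> 0 < \<rho> j" by (rule less_le_trans[OF _ \<rho>_ge]) simp

text \<open>A conjugate of an exponent above 2 lies below 2. Hence q - p is negative, and clipping
  errors in L^q vanish as the clipping level grows.\<close>

lemma q_less_p: "q < 2"
proof -
  have "1 / p < 1 / 2" using conjugate by (intro divide_strict_left_mono) auto
  then have "1 / 2 < 1 / q" using conjugate by linarith
  then show ?thesis using conjugate by (simp add: field_simps)
qed

text \<open>Truncation at level \<open>j\<close> to the power \<open>2 / (p - 2)\<close> makes the truncation error and the mixing error
  both \<open>O(1 / j\<^sup>2)\<close>, which the assumption on \<open>\<rho>\<close> absorbs.\<close>
lemma acov_le:
  assumes h: "h \<in> borel_measurable path_space" and hm: "moment_le M p D (Xproc h Y 1)"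
    and w: "w \<in> borel_measurable (window_alg j)" and wm: "moment_le M p D (Xproc w Y 1)"
    and e: "integrable M (\<lambda>\<omega>. \<bar>Xproc h Y 1 \<omega> - Xproc w Y 1 \<omega>\<bar> powr q)"
      "expectation (\<lambda>\<omega>. \<bar>Xproc h Y 1 \<omega> - Xproc w Y 1 \<omega>\<bar> powr q) \<le> \<rho> j powr q"
    and j: "1 \<le> j" "3 * j \<le> k"
  shows "\<bar>acov h k\<bar> \<le> (4 * C + 6 * (1 + D) + (2 * D + 2 * D * (1 + D))) * \<rho> j"
proof -
  define A where "A = real j powr (2 / (p - 2))"
  have A1: "1 \<le> A" unfolding A_def using j conjugate by (intro ge_one_powr_ge_zero) auto
  have A2: "A powr (2 - p) = 1 / (real j)\<^sup>2"
  proof -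
    have "2 / (p - 2) * (2 - p) = - 2" using conjugate by (simp add: field_simps)
    then have "A powr (2 - p) = real j powr (- 2)" unfolding A_def powr_powr by simp
    then show ?thesis using j by (simp add: powr_minus_divide powr_numeral)
  qed
  have wp: "w \<in> borel_measurable path_space" by (rule measurable_window_alg_path_space) fact
  let ?X = "Xproc h Y" and ?W = "Xproc w Y"
  note hm' = moment_le_Xproc_shift[OF h hm] and wm' = moment_le_Xproc_shift[OF wp wm]
  have [measurable]: "(\<lambda>x. \<bar>h x - w x\<bar> powr q) \<in> borel_measurable path_space" using h wp by measurable
  have e': "integrable M (\<lambda>\<omega>. \<bar>?X i \<omega> - ?W i \<omega>\<bar> powr q)"
     "expectation (\<lambda>\<omega>. \<bar>?X i \<omega> - ?W i \<omega>\<bar> powr q) \<le> \<rho> j powr q" for i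
    using integrable_Xproc_shift[of "\<lambda>x. \<bar>h x - w x\<bar> powr q" i 1] e
      expectation_Xproc_shift[of "\<lambda>x. \<bar>h x - w x\<bar> powr q" i 1]
    by (simp_all add: Xproc_def[abs_def])
  have "\<bar>acov h k\<bar> \<le> \<bar>covar M (\<lambda>\<omega>. clip A (?W 1 \<omega>)) (\<lambda>\<omega>. clip A (?W (1 + int k) \<omega>))\<bar>
      + 6 * (1 + D) * \<rho> j + (2 * D + 2 * D * (1 + D)) * A powr (2 - p)"
    unfolding acov_def
    by (rule covar_approx[OF hm' hm' wm' wm' e' e' \<rho>_pos[OF j(1)] conjugate A1])
  also have "\<bar>covar M (\<lambda>\<omega>. clip A (?W 1 \<omega>)) (\<lambda>\<omega>. clip A (?W (1 + int k) \<omega>))\<bar> \<le> 4 * C * \<rho> j"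
  proof -
    \<comment> \<open>The windows of radius j around the times 1 and 1 + k leave a gap of k - 2 j,
      which is at least j because k \<ge> 3 j.\<close>
    have k: "(1 + int j) + int (k - 2 * j) = 1 + int k - int j" using j by auto
    have "\<bar>covar M (\<lambda>\<omega>. clip A (?W 1 \<omega>)) (\<lambda>\<omega>. clip A (?W (1 + int k) \<omega>))\<bar> \<le> 4 * A * A * alpha_mix M Y (k - 2 * j)"
    proof (rule covar_le_alpha_mix[of "1 + int j"])
      show "(\<lambda>\<omega>. clip A (?W 1 \<omega>)) \<in> borel_measurable (gen_subalg M Y {..1 + int j})"
        by (rule measurable_compose[OF measurable_gen_subalg_mono[OF measurable_Xproc_window[OF w]] borel_measurable_clip]) auto
      show "(\<lambda>\<omega>. clip A (?W (1 + int k) \<omega>)) \<in> borel_measurable (gen_subalg M Y {(1 + int j) + int (k - 2 * j)..})"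
        unfolding k
        by (rule measurable_compose[OF measurable_gen_subalg_mono[OF measurable_Xproc_window[OF w]] borel_measurable_clip]) auto
    qed (use A1 abs_clip_le in auto)
    also have "\<dots> \<le> 4 * A * A * (C * real j powr (- \<mu>))"
    proof -
      have "alpha_mix M Y (k - 2 * j) \<le> C * real (k - 2 * j) powr (- \<mu>)" using j by (intro mixing_rate) auto
      also have "\<dots> \<le> C * real j powr (- \<mu>)"
        using j C_nonneg \<mu>_large by (intro mult_left_mono powr_mono2') auto
      finally show ?thesis using A1 by (intro mult_left_mono) auto
    qed
    also have "A * A * real j powr (- \<mu>) = real j powr (4 / (p - 2) - \<mu>)"
      unfolding A_def by (simp add: powr_add[symmetric])
    then have "4 * A * A * (C * real j powr (- \<mu>)) = 4 * C * real j powr (4 / (p - 2) - \<mu>)"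
      by (simp add: mult.assoc mult.left_commute)
    also have "\<dots> \<le> 4 * C * real j powr (- 2)"
      using j C_nonneg \<mu>_large by (intro mult_left_mono powr_mono) auto
    also have "\<dots> = 4 * C * (1 / (real j)\<^sup>2)" using j by (simp add: powr_minus_divide powr_numeral)
    also have "\<dots> \<le> 4 * C * \<rho> j" using C_nonneg \<rho>_ge[of j] by (intro mult_left_mono) auto
    finally show ?thesis .
  qed
  also have "(2 * D + 2 * D * (1 + D)) * A powr (2 - p) \<le> (2 * D + 2 * D * (1 + D)) * \<rho> j"
    unfolding A2 using \<rho>_ge[of j] moment_leD(4)[OF hm] by (intro mult_left_mono) auto
  finally show ?thesis by (simp add: algebra_simps)
qed

lemma f_square: "integrable M (\<lambda>\<omega>. (Xproc f Y 1 \<omega>)\<^sup>2)"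
  using moment_le_square[OF f_moment] conjugate by simp

lemma summable_acov_of_le:
  assumes "\<And>k. N \<le> k \<Longrightarrow> \<bar>acov h k\<bar> \<le> K * \<rho> (k div 3)" shows "summable (\<lambda>k. \<bar>acov h k\<bar>)"
  by (rule summable_comparison_test'[of "\<lambda>k. K * \<rho> (k div 3)" N])
     (use assms \<rho>_nonneg in \<open>auto intro!: summable_mult summable_div_nat[OF \<rho>_summable]\<close>)

lemma summable_acov_f: "summable (\<lambda>k. \<bar>acov f k\<bar>)"
proof (rule summable_acov_of_le)
  fix k :: nat assume "3 \<le> k"
  then show "\<bar>acov f k\<bar> \<le> (4 * C + 6 * (1 + B) + (2 * B + 2 * B * (1 + B))) * \<rho> (k div 3)"
    by (intro acov_le[OF f_measurable f_moment g_measurable g_moment g_error]) auto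
qed

text \<open>The choices are made in the order \<open>N\<close>, \<open>m\<close>, \<open>K\<close>.
  The constant \<open>L\<close> involves only \<open>C\<close>, \<open>B\<close> and
  \<open>p\<close>, so the tail of the far lags can be fixed by \<open>N\<close> before the window
  is known; \<open>m\<close> then makes the 3 m near lags small, and \<open>K\<close> adapts the
  clipping level to \<open>m\<close>.\<close>

lemma bounded_window_approximation:
  assumes eps: "0 < \<epsilon>"
  obtains h m K where "h \<in> borel_measurable (window_alg m)" "\<And>x. \<bar>h x\<bar> \<le> K"
    "integrable M (\<lambda>\<omega>. (Xproc (\<lambda>x. f x - h x) Y 1 \<omega>)\<^sup>2)"
    "summable (\<lambda>k. \<bar>acov (\<lambda>x. f x - h x) k\<bar>)" "(\<Sum>k. \<bar>acov (\<lambda>x. f x - h x) k\<bar>) \<le> \<epsilon>"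
proof -
  \<comment> \<open>A difference of two functionals with p-th moment at most \<open>B\<close> has
    p-th moment at most \<open>D\<close>, by \<open>abs_add_powr_le\<close>; clipping does not
    increase the moment.\<close>
  define D where "D = 2 powr p * (B + B)"
  have B0: "0 \<le> B" using moment_leD(4)[OF f_moment] .
  have D0: "0 \<le> D" using B0 by (simp add: D_def)
  define L where "L = 4 * C + 6 * (1 + D) + (2 * D + 2 * D * (1 + D))"
  have L: "0 < L" unfolding L_def using D0 C_nonneg by (intro add_nonneg_pos add_pos_nonneg) auto
  define b where "b k = \<rho> (k div 3)" for k
  have sb: "summable b" unfolding b_def by (rule summable_div_nat[OF \<rho>_summable \<rho>_nonneg]) auto
  obtain N where N: "\<And>n. n \<ge> N \<Longrightarrow> norm (\<Sum>i. b (i + n)) < \<epsilon> / (2 * L)"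
    using suminf_exist_split[OF _ sb, of "\<epsilon> / (2 * L)"] eps L by auto
  \<comment> \<open>Each of the 3 m near lags will cost 6 (1 + D) \<rho>_m, in total 18 (1 + D) m
    \<rho>_m, for which half of \<epsilon> is reserved. The other half goes to the far lags.\<close>
  obtain m where m: "N \<le> m" "0 < m" "real m * \<rho> m < \<epsilon> / (2 * (18 * (1 + D)))"
    using summable_imp_index_mult_small[OF \<rho>_summable, of "\<epsilon> / (2 * (18 * (1 + D)))" N] eps D0 by auto
  have rm: "0 < \<rho> m" using m by (intro \<rho>_pos) auto
  \<comment> \<open>\<open>B * K powr (q - p)\<close> bounds the clipping error of
    \<open>g m\<close> in the q-th mean; making it less than \<rho>_m^q puts that error on a par
    with the approximation error.\<close>
  have "((\<lambda>K. B * K powr (q - p)) \<longlongrightarrow> B * 0) at_top"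
    using q_less_p conjugate by (intro tendsto_mult tendsto_const tendsto_neg_powr filterlim_ident) auto
  then have "eventually (\<lambda>K. B * K powr (q - p) < \<rho> m powr q) at_top"
    using rm by (intro order_tendstoD(2)) auto
  then have "eventually (\<lambda>K. B * K powr (q - p) < \<rho> m powr q \<and> 0 < K) at_top"
    using eventually_gt_at_top[of 0] by eventually_elim auto
  then obtain K where K: "B * K powr (q - p) < \<rho> m powr q" "0 < K"
    using eventually_happens'[OF trivial_limit_at_top_linorder] by blast
  define h where "h x = clip K (g m x)" for x
  have hw: "h \<in> borel_measurable (window_alg m)"
    unfolding h_def by (rule measurable_compose[OF g_measurable borel_measurable_clip])
  have hp: "h \<in> borel_measurable path_space" by (rule measurable_window_alg_path_space[OF hw])
  have gp: "g j \<in> borel_measurable path_space" for j by (rule measurable_window_alg_path_space[OF g_measurable])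
  note [measurable] = hp gp f_measurable measurable_Xproc[OF f_measurable] measurable_Xproc[OF hp] measurable_Xproc[OF gp]
  have Xh: "Xproc h Y i \<omega> = clip K (Xproc (g m) Y i \<omega>)" for i \<omega> by (simp add: Xproc_def h_def)
  let ?W = "\<lambda>x. f x - h x"
  have XW: "Xproc (\<lambda>x. u x - h x) Y i \<omega> = Xproc u Y i \<omega> - Xproc h Y i \<omega>" for u i \<omega> by (simp add: Xproc_def)
  have Wp: "?W \<in> borel_measurable path_space" by measurable
  have mom: "moment_le M p D (Xproc (\<lambda>x. u x - h x) Y 1)"
    if u: "u \<in> borel_measurable path_space" "moment_le M p B (Xproc u Y 1)" for u
  proof -
    note [measurable] = measurable_Xproc[OF u(1)]
    have pw: "\<bar>Xproc u Y 1 \<omega> - Xproc h Y 1 \<omega>\<bar> powr p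
      \<le> 2 powr p * (\<bar>Xproc u Y 1 \<omega>\<bar> powr p + \<bar>Xproc (g m) Y 1 \<omega>\<bar> powr p)" for \<omega>
    proof -
      have "\<bar>Xproc h Y 1 \<omega>\<bar> powr p \<le> \<bar>Xproc (g m) Y 1 \<omega>\<bar> powr p"
        unfolding Xh using K conjugate by (intro powr_mono2 abs_clip_le_abs) auto
      then show ?thesis
        using abs_add_powr_le[of p "Xproc u Y 1 \<omega>" "- Xproc h Y 1 \<omega>"] conjugate
        by (auto intro: order_trans mult_left_mono add_mono)
    qed
    have iR: "integrable M (\<lambda>\<omega>. 2 powr p * (\<bar>Xproc u Y 1 \<omega>\<bar> powr p + \<bar>Xproc (g m) Y 1 \<omega>\<bar> powr p))"
      using moment_leD(2)[OF u(2)] moment_leD(2)[OF g_moment] by auto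
    have iL: "integrable M (\<lambda>\<omega>. \<bar>Xproc u Y 1 \<omega> - Xproc h Y 1 \<omega>\<bar> powr p)"
      by (rule Bochner_Integration.integrable_bound[OF iR]) (auto intro!: order_trans[OF pw])
    have "expectation (\<lambda>\<omega>. \<bar>Xproc u Y 1 \<omega> - Xproc h Y 1 \<omega>\<bar> powr p)
      \<le> expectation (\<lambda>\<omega>. 2 powr p * (\<bar>Xproc u Y 1 \<omega>\<bar> powr p + \<bar>Xproc (g m) Y 1 \<omega>\<bar> powr p))"
      by (rule integral_mono[OF iL iR pw])
    also have "\<dots> = 2 powr p * (expectation (\<lambda>\<omega>. \<bar>Xproc u Y 1 \<omega>\<bar> powr p) + expectation (\<lambda>\<omega>. \<bar>Xproc (g m) Y 1 \<omega>\<bar> powr p))"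
      using moment_leD(2)[OF u(2)] moment_leD(2)[OF g_moment] by simp
    also have "\<dots> \<le> D" unfolding D_def
      using moment_leD(3)[OF u(2)] moment_leD(3)[OF g_moment] by (intro mult_left_mono add_mono) auto
    finally show ?thesis unfolding moment_le_def XW using iL by (auto simp: XW[abs_def])
  qed
  note momW = mom[OF f_measurable f_moment]
  \<comment> \<open>The residual f - h is approximated by \<open>g (k div 3)\<close> minus the same
    \<open>h\<close>: since m \<le> k div 3, \<open>h\<close> is measurable for the larger window,
    and it cancels from the error.\<close>
  have far: "\<bar>acov ?W k\<bar> \<le> L * b k" if k: "3 * m \<le> k" for k
    unfolding L_def b_def
  proof (rule acov_le[OF Wp momW, of "\<lambda>x. g (k div 3) x - h x"])
    have j: "m \<le> k div 3" using k by auto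
    show "(\<lambda>x. g (k div 3) x - h x) \<in> borel_measurable (window_alg (k div 3))"
      using g_measurable measurable_window_alg_mono[OF hw j] by measurable
    show "moment_le M p D (Xproc (\<lambda>x. g (k div 3) x - h x) Y 1)" by (rule mom[OF gp g_moment])
    show "1 \<le> k div 3" using j m by auto
    then show "expectation (\<lambda>\<omega>. \<bar>Xproc ?W Y 1 \<omega> - Xproc (\<lambda>x. g (k div 3) x - h x) Y 1 \<omega>\<bar> powr q) \<le> \<rho> (k div 3) powr q"
      using g_error(2) by (simp add: XW)
    show "integrable M (\<lambda>\<omega>. \<bar>Xproc ?W Y 1 \<omega> - Xproc (\<lambda>x. g (k div 3) x - h x) Y 1 \<omega>\<bar> powr q)"
      using g_error(1) by (simp add: XW)
  qed auto
  \<comment> \<open>Here f - h is the sum of f - g_m and g_m - h, both of L^q-norm at most \<rho>_m.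
    Each part contributes at most 3 (1 + D) \<rho>_m to the covariance.\<close>
  have near: "\<bar>acov ?W k\<bar> \<le> 6 * (1 + D) * \<rho> m" for k
  proof -
    let ?V = "\<lambda>\<omega>. Xproc f Y 1 \<omega> - Xproc (g m) Y 1 \<omega>" and ?R = "\<lambda>\<omega>. Xproc (g m) Y 1 \<omega> - Xproc h Y 1 \<omega>"
    let ?U = "Xproc ?W Y (1 + int k)"
    note U = moment_le_Xproc_shift[OF Wp momW, of "1 + int k"]
    have m1: "1 \<le> m" using m by simp
    have p1: "1 < p" using conjugate by simp
    have iR: "integrable M (\<lambda>\<omega>. \<bar>?R \<omega>\<bar> powr q)"
    proof (rule Bochner_Integration.integrable_bound)
      show "integrable M (\<lambda>\<omega>. \<bar>Xproc (g m) Y 1 \<omega>\<bar> powr p * K powr (q - p))"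
        using moment_leD(2)[OF g_moment] by simp
    qed (use K conjugate q_less_p in \<open>auto simp: Xh intro!: diff_clip_powr_le\<close>)
    have "expectation (\<lambda>\<omega>. \<bar>?R \<omega>\<bar> powr q) \<le> expectation (\<lambda>\<omega>. \<bar>Xproc (g m) Y 1 \<omega>\<bar> powr p * K powr (q - p))"
      using moment_leD(2)[OF g_moment] K conjugate q_less_p
      by (intro integral_mono iR) (auto simp: Xh intro!: diff_clip_powr_le)
    also have "\<dots> = expectation (\<lambda>\<omega>. \<bar>Xproc (g m) Y 1 \<omega>\<bar> powr p) * K powr (q - p)" by simp
    also have "\<dots> \<le> B * K powr (q - p)" using moment_leD(3)[OF g_moment] by (intro mult_right_mono) auto
    also have "\<dots> \<le> \<rho> m powr q" using K by simp
    finally have eR: "expectation (\<lambda>\<omega>. \<bar>?R \<omega>\<bar> powr q) \<le> \<rho> m powr q" .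
    have "?V \<in> borel_measurable M" "?R \<in> borel_measurable M" by measurable
    note V = covar_le_Young[OF this(1) g_error(1) g_error(2)[OF m1] rm U p1 conjugate(2,3)]
      and R = covar_le_Young[OF this(2) iR eR rm U p1 conjugate(2,3)]
    note YV = expectation_mult_le_Young(1)[OF \<open>?V \<in> _\<close> g_error(1) g_error(2)[OF m1] rm U p1 conjugate(2,3)]
      and YR = expectation_mult_le_Young(1)[OF \<open>?R \<in> _\<close> iR eR rm U p1 conjugate(2,3)]
    have eq: "Xproc ?W Y 1 \<omega> = ?V \<omega> + ?R \<omega>" for \<omega> by (simp add: XW)
    have "acov ?W k = covar M ?V ?U + covar M ?R ?U"
      unfolding acov_def covar_def eq distrib_right
      using YV YR V(2) R(2) by (subst (1 2) Bochner_Integration.integral_add) (auto simp: algebra_simps)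
    then show ?thesis using V(1) R(1) by (simp add: algebra_simps abs_le_iff)
  qed
  have sW: "summable (\<lambda>k. \<bar>acov ?W k\<bar>)"
    by (rule summable_acov_of_le[where K=L and N="3 * m"]) (use far in \<open>auto simp: b_def\<close>)
  have "(\<Sum>k. \<bar>acov ?W k\<bar>) = (\<Sum>i. \<bar>acov ?W (i + 3 * m)\<bar>) + (\<Sum>i<3 * m. \<bar>acov ?W i\<bar>)"
    by (rule suminf_split_initial_segment[OF sW])
  also have "\<dots> \<le> (\<Sum>i. L * b (i + 3 * m)) + (\<Sum>i<3 * m. 6 * (1 + D) * \<rho> m)"
    using summable_ignore_initial_segment[OF sb, of "3 * m"] summable_ignore_initial_segment[OF sW, of "3 * m"]
    by (intro add_mono suminf_le sum_mono near far summable_mult) auto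
  also have "(\<Sum>i. L * b (i + 3 * m)) = L * (\<Sum>i. b (i + 3 * m))"
    by (intro suminf_mult summable_ignore_initial_segment[OF sb])
  also have "\<dots> \<le> L * (\<epsilon> / (2 * L))" using N[of "3 * m"] m L by (intro mult_left_mono) auto
  also have "\<dots> = \<epsilon> / 2" using L by simp
  also have "(\<Sum>i<3 * m. 6 * (1 + D) * \<rho> m) = 18 * (1 + D) * (real m * \<rho> m)" by simp
  also have "\<dots> \<le> 18 * (1 + D) * (\<epsilon> / (2 * (18 * (1 + D))))" using m D0 by (intro mult_left_mono) auto
  also have "\<dots> = \<epsilon> / 2"
  proof -
    have "18 * E * (\<epsilon> / (2 * (18 * E))) = \<epsilon> / 2" if "0 < E" for E :: real using that by simp
    from this[of "1 + D"] show ?thesis using D0 by simp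
  qed
  finally have "(\<Sum>k. \<bar>acov ?W k\<bar>) \<le> \<epsilon>" by simp
  moreover have "integrable M (\<lambda>\<omega>. (Xproc ?W Y 1 \<omega>)\<^sup>2)"
    using moment_le_square[OF momW] conjugate by simp
  moreover have "\<bar>h x\<bar> \<le> K" for x unfolding h_def using K by (simp add: abs_clip_le)
  ultimately show thesis using that[OF hw, of K] sW by blast
qed

end

section \<open>The central limit theorem for bounded window functionals\<close>

text \<open>Being valid for all y \<ge> 0, it applies to blocks of any variance. The upper estimate
  uses exp(-y) \<le> 1/(1+y) and (1 - y + y^2)(1 + y) = 1 + y^3.\<close>

lemma abs_one_minus_exp_le:
  fixes y :: real assumes "0 \<le> y" shows "\<bar>(1 - y) - exp (- y)\<bar> \<le> y\<^sup>2"
proof -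
  have "1 - y \<le> exp (- y)" using exp_ge_add_one_self[of "- y"] by simp
  moreover have "exp (- y) \<le> 1 - y + y\<^sup>2"
  proof -
    have "exp (- y) \<le> 1 / (1 + y)"
      unfolding exp_minus inverse_eq_divide using assms exp_ge_add_one_self[of y] by (intro divide_left_mono) auto
    also have "\<dots> \<le> 1 - y + y\<^sup>2"
    proof -
      have "(1 - y + y\<^sup>2) * (1 + y) = 1 + y ^ 3" by (simp add: power2_eq_square power3_eq_cube algebra_simps)
      moreover have "0 \<le> y ^ 3" using assms by simp
      ultimately show ?thesis using assms by (simp add: divide_le_eq)
    qed
    finally show ?thesis .
  qed
  ultimately show ?thesis by simp
qed

lemma norm_iexp_diff_le: "norm (iexp a - iexp b) \<le> \<bar>a - b\<bar>"
proof -
  have "iexp a - iexp b = iexp b * (iexp (a - b) - 1)"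
    by (simp add: algebra_simps exp_diff[symmetric] exp_add[symmetric])
  then have "norm (iexp a - iexp b) = norm (iexp (a - b) - 1)" by (simp add: norm_mult)
  also have "\<dots> \<le> \<bar>a - b\<bar>" using iexp_approx1[of "a - b" 0] by simp
  finally show ?thesis .
qed

context prob_space
begin

lemma integrable_iexp_rv:
  assumes [measurable]: "U \<in> borel_measurable M" shows "integrable M (\<lambda>x. iexp (U x))"
  by (rule integrable_const_bound[of _ 1]) auto

text \<open>Splitting into real and imaginary parts makes the covariance bounds and the shift
  invariance, both stated for real functions, available for characteristic functions.\<close>

lemma expectation_iexp:
  assumes [measurable]: "U \<in> borel_measurable M"
  shows "expectation (\<lambda>x. iexp (U x)) = Complex (expectation (\<lambda>x. cos (U x))) (expectation (\<lambda>x. sin (U x)))"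
proof (rule complex_eqI)
  have [simp]: "Re (iexp r) = cos r" "Im (iexp r) = sin r" for r by (simp_all add: Re_exp Im_exp)
  show "Re (expectation (\<lambda>x. iexp (U x))) = Re (Complex (expectation (\<lambda>x. cos (U x))) (expectation (\<lambda>x. sin (U x))))"
    by (subst integral_Re[symmetric]) (auto intro: integrable_iexp_rv)
  show "Im (expectation (\<lambda>x. iexp (U x))) = Im (Complex (expectation (\<lambda>x. cos (U x))) (expectation (\<lambda>x. sin (U x))))"
    by (subst integral_Im[symmetric]) (auto intro: integrable_iexp_rv)
qed

lemma norm_expectation_iexp_le: "norm (expectation (\<lambda>x. iexp (U x))) \<le> 1"
  using integral_norm_bound[of M "\<lambda>x. iexp (U x)"] by (simp add: prob_space)

text \<open>By the addition theorems the defect of factorisation has real and imaginary parts made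
  of two real covariances each.\<close>

lemma iexp_factor_le:
  assumes [measurable]: "U \<in> borel_measurable M" "V \<in> borel_measurable M"
    and cov: "\<bar>covar M (\<lambda>x. cos (U x)) (\<lambda>x. cos (V x))\<bar> \<le> a" "\<bar>covar M (\<lambda>x. sin (U x)) (\<lambda>x. sin (V x))\<bar> \<le> a"
      "\<bar>covar M (\<lambda>x. sin (U x)) (\<lambda>x. cos (V x))\<bar> \<le> a" "\<bar>covar M (\<lambda>x. cos (U x)) (\<lambda>x. sin (V x))\<bar> \<le> a"
  shows "norm (expectation (\<lambda>x. iexp (U x + V x)) - expectation (\<lambda>x. iexp (U x)) * expectation (\<lambda>x. iexp (V x))) \<le> 4 * a"
proof -
  have b: "\<bar>cos r * cos s\<bar> \<le> 1" "\<bar>sin r * sin s\<bar> \<le> 1" "\<bar>sin r * cos s\<bar> \<le> 1" "\<bar>cos r * sin s\<bar> \<le> 1" for r s :: real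
    by (auto simp: abs_mult intro!: mult_le_one)
  have i: "integrable M (\<lambda>x. cos (U x) * cos (V x))" "integrable M (\<lambda>x. sin (U x) * sin (V x))"
    "integrable M (\<lambda>x. sin (U x) * cos (V x))" "integrable M (\<lambda>x. cos (U x) * sin (V x))"
    by (rule integrable_const_bound[of _ 1]; use b in force)+
  let ?z = "expectation (\<lambda>x. iexp (U x + V x)) - expectation (\<lambda>x. iexp (U x)) * expectation (\<lambda>x. iexp (V x))"
  have "?z = Complex (covar M (\<lambda>x. cos (U x)) (\<lambda>x. cos (V x)) - covar M (\<lambda>x. sin (U x)) (\<lambda>x. sin (V x)))
     (covar M (\<lambda>x. sin (U x)) (\<lambda>x. cos (V x)) + covar M (\<lambda>x. cos (U x)) (\<lambda>x. sin (V x)))"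
    using i by (subst (1 2 3) expectation_iexp) (auto simp: complex_eq_iff cos_add sin_add covar_def algebra_simps)
  then have "norm ?z \<le> \<bar>covar M (\<lambda>x. cos (U x)) (\<lambda>x. cos (V x)) - covar M (\<lambda>x. sin (U x)) (\<lambda>x. sin (V x))\<bar>
     + \<bar>covar M (\<lambda>x. sin (U x)) (\<lambda>x. cos (V x)) + covar M (\<lambda>x. cos (U x)) (\<lambda>x. sin (V x))\<bar>"
    using cmod_le[of ?z] by simp
  then show ?thesis using cov by linarith
qed

text \<open>Bounded second moments make the absolute values uniformly integrable: replacing |Z| by
  min(|Z|, A) costs at most c/A, and the truncated function is bounded and continuous.\<close>

lemma weak_conv_imp_abs_moment_conv:
  fixes Z :: "nat \<Rightarrow> 'a \<Rightarrow> real"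
  assumes Z[measurable]: "\<And>n. Z n \<in> borel_measurable M" and Zi: "\<And>n. integrable M (\<lambda>x. (Z n x)\<^sup>2)"
    and Zb: "\<And>n. expectation (\<lambda>x. (Z n x)\<^sup>2) \<le> c"
    and N: "real_distribution N" and Ni: "integrable N (\<lambda>x. x\<^sup>2)"
    and conv: "weak_conv_m (\<lambda>n. distr M borel (Z n)) N"
  shows "(\<lambda>n. expectation (\<lambda>x. \<bar>Z n x\<bar>)) \<longlonglongrightarrow> (\<integral>x. \<bar>x\<bar> \<partial>N)"
proof -
  interpret N: real_distribution N by fact
  define d where "d = (\<integral>x. x\<^sup>2 \<partial>N)"
  \<comment> \<open>Stated for an arbitrary probability space because it is applied both to
    \<open>M\<close> and to the limit law \<open>N\<close>.\<close>
  have tail: "\<bar>(\<integral>x. \<bar>T x\<bar> \<partial>P) - (\<integral>x. min \<bar>T x\<bar> A \<partial>P)\<bar> \<le> e / A"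
    if P: "prob_space P" and T[measurable]: "T \<in> borel_measurable P" and Ti: "integrable P (\<lambda>x. (T x)\<^sup>2)"
      and e: "(\<integral>x. (T x)\<^sup>2 \<partial>P) \<le> e" and A: "0 < A" for P :: "'b measure" and T :: "'b \<Rightarrow> real" and e A
  proof -
    interpret P: prob_space P by fact
    have iT: "integrable P T" by (rule P.integrable_of_square[OF T Ti])
    have im: "integrable P (\<lambda>x. min \<bar>T x\<bar> A)" by (rule P.integrable_const_bound[of _ A]) (use A in auto)
    have pw: "\<bar>T x\<bar> - min \<bar>T x\<bar> A \<le> (T x)\<^sup>2 / A" for x
    proof (cases "\<bar>T x\<bar> \<le> A")
      case True then show ?thesis using A by simp
    next
      case False
      then have "A * \<bar>T x\<bar> \<le> \<bar>T x\<bar> * \<bar>T x\<bar>" by (intro mult_right_mono) auto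
      then have "\<bar>T x\<bar> \<le> (T x)\<^sup>2 / A" using A by (simp add: field_simps power2_eq_square)
      then show ?thesis using A by (simp add: min_def split: if_splits)
    qed
    have "\<bar>(\<integral>x. \<bar>T x\<bar> \<partial>P) - (\<integral>x. min \<bar>T x\<bar> A \<partial>P)\<bar> = \<bar>\<integral>x. \<bar>T x\<bar> - min \<bar>T x\<bar> A \<partial>P\<bar>" using iT im by simp
    also have "\<dots> = (\<integral>x. \<bar>T x\<bar> - min \<bar>T x\<bar> A \<partial>P)" by (intro abs_of_nonneg integral_nonneg_AE) auto
    also have "\<dots> \<le> (\<integral>x. (T x)\<^sup>2 / A \<partial>P)" using iT im Ti by (intro integral_mono pw) auto
    also have "\<dots> = (\<integral>x. (T x)\<^sup>2 \<partial>P) / A" by simp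
    also have "\<dots> \<le> e / A" using e A by (intro divide_right_mono) auto
    finally show ?thesis .
  qed
  have rd: "real_distribution (distr M borel (Z n))" for n by (rule real_distribution_distr) simp
  have c: "0 \<le> c" by (rule order_trans[OF _ Zb[of 0]]) simp
  have d: "0 \<le> d" by (simp add: d_def)
  show ?thesis
  proof (rule LIMSEQ_I)
    fix r :: real assume r: "0 < r"
    \<comment> \<open>Chosen so that the truncation errors c/A and d/A together stay below r/2; the
      summand 1 keeps \<open>A\<close> positive when \<open>c\<close> and \<open>d\<close>
      vanish.\<close>
    define A where "A = (2 * (c + d) + 1) / r"
    have A: "0 < A" using c d r by (simp add: A_def)
    have "(\<lambda>n. \<integral>x. min \<bar>x\<bar> A \<partial>distr M borel (Z n)) \<longlonglongrightarrow> (\<integral>x. min \<bar>x\<bar> A \<partial>N)"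
      using A by (intro weak_conv_imp_integral_bdd_continuous_conv[OF rd N conv, where B=A] continuous_intros) auto
    then have "(\<lambda>n. expectation (\<lambda>x. min \<bar>Z n x\<bar> A)) \<longlonglongrightarrow> (\<integral>x. min \<bar>x\<bar> A \<partial>N)"
      by (subst (asm) integral_distr) auto
    then obtain n0 where n0: "\<And>n. n \<ge> n0 \<Longrightarrow> \<bar>expectation (\<lambda>x. min \<bar>Z n x\<bar> A) - (\<integral>x. min \<bar>x\<bar> A \<partial>N)\<bar> < r / 2"
      using LIMSEQ_D[of "\<lambda>n. expectation (\<lambda>x. min \<bar>Z n x\<bar> A)" _ "r / 2"] r unfolding real_norm_def by (metis half_gt_zero)
    have "norm (expectation (\<lambda>x. \<bar>Z n x\<bar>) - (\<integral>x. \<bar>x\<bar> \<partial>N)) < r" if "n \<ge> n0" for n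
    proof -
      have "\<bar>(\<integral>x. \<bar>x\<bar> \<partial>N) - (\<integral>x. min \<bar>x\<bar> A \<partial>N)\<bar> \<le> d / A"
        by (rule tail) (use N.prob_space_axioms Ni A d_def in auto)
      moreover have "\<bar>expectation (\<lambda>x. \<bar>Z n x\<bar>) - expectation (\<lambda>x. min \<bar>Z n x\<bar> A)\<bar> \<le> c / A"
        by (rule tail) (use prob_space_axioms Zi Zb A in auto)
      moreover have "c / A + d / A < r / 2"
        using c d r unfolding A_def add_divide_distrib[symmetric] by (simp add: field_simps)
      ultimately show ?thesis using n0[OF that] unfolding real_norm_def by linarith
    qed
    then show "\<exists>no. \<forall>n\<ge>no. norm (expectation (\<lambda>x. \<bar>Z n x\<bar>) - (\<integral>x. \<bar>x\<bar> \<partial>N)) < r" by blast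
  qed
qed

end

lemma std_normal_abs_moment: "(\<integral>x. \<bar>x\<bar> \<partial>std_normal_distribution) = sqrt (2 / pi)"
  using integral_std_normal_moment_abs_odd[of 0]
  by (subst integral_density) (auto simp: normal_density_nonneg)

section \<open>Bounded centred functionals of a finite window\<close>

locale bounded_window_process = stationary_process +
  fixes h :: "(int \<Rightarrow> real) \<Rightarrow> real" and m :: nat and K C :: real
  assumes h_window: "h \<in> borel_measurable (window_alg m)"
    and h_bound: "\<And>x. \<bar>h x\<bar> \<le> K"
    and h_mean: "expectation (Xproc h Y 1) = 0"
    and h_acov: "summable (\<lambda>k. \<bar>acov h k\<bar>)"
    and mixing: "\<And>k. 1 \<le> k \<Longrightarrow> alpha_mix M Y k \<le> C * real k powr (- 8)"
    and C_nonneg: "0 \<le> C"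
begin

abbreviation X :: "int \<Rightarrow> 'a \<Rightarrow> real" where "X \<equiv> Xproc h Y"

definition long_run_var :: real where "long_run_var = acov h 0 + 2 * (\<Sum>k. acov h (Suc k))"

text \<open>By \<open>second_moment_sum_le\<close> this bounds the second moment of the sum over any
  finite index set, relative to the size of the set.\<close>

definition var_bound :: real where "var_bound = 2 * (\<Sum>k. \<bar>acov h k\<bar>)"

definition sum_var :: "nat \<Rightarrow> real" where "sum_var p = expectation (\<lambda>\<omega>. (\<Sum>i=1..int p. X i \<omega>)\<^sup>2)"

lemma h_measurable: "h \<in> borel_measurable path_space"
  by (rule measurable_window_alg_path_space[OF h_window])

lemma X_measurable [measurable]: "X i \<in> borel_measurable M"
  by (rule measurable_Xproc[OF h_measurable])

lemma abs_X_le: "\<bar>X i \<omega>\<bar> \<le> K" by (simp add: Xproc_def h_bound)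

lemma K_nonneg: "0 \<le> K" using h_bound[of undefined] by simp

lemma X_square: "integrable M (\<lambda>\<omega>. (X 1 \<omega>)\<^sup>2)"
  by (rule integrable_const_bound[of _ "K\<^sup>2"]) (use abs_X_le power_mono[OF abs_X_le, of _ _ 2] in auto)

lemma var_bound_nonneg: "0 \<le> var_bound" unfolding var_bound_def by (simp add: suminf_nonneg h_acov)

lemma abs_sum_X_le: "\<bar>\<Sum>i\<in>G. X i \<omega>\<bar> \<le> real (card G) * K"
  by (rule order_trans[OF sum_abs]) (use sum_bounded_above[of G "\<lambda>i. \<bar>X i \<omega>\<bar>" K] abs_X_le in auto)

lemma sum_X_square:
  assumes "finite G"
  shows "integrable M (\<lambda>\<omega>. (\<Sum>i\<in>G. X i \<omega>)\<^sup>2)" "expectation (\<lambda>\<omega>. (\<Sum>i\<in>G. X i \<omega>)\<^sup>2) \<le> real (card G) * var_bound"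
  using second_moment_sum(1)[OF h_measurable X_square h_mean assms]
    second_moment_sum_le[OF h_measurable X_square h_mean assms h_acov] by (auto simp: var_bound_def)

lemma sum_var_bounds: "0 \<le> sum_var p" "sum_var p \<le> real p * var_bound"
  using sum_X_square(2)[of "{1..int p}"] by (auto simp: sum_var_def)

lemma sum_var_limit: "(\<lambda>n. sum_var n / real n) \<longlonglongrightarrow> long_run_var"
  unfolding sum_var_def long_run_var_def by (rule second_moment_sum_limit[OF h_measurable X_square h_mean h_acov])

lemma long_run_var_nonneg: "0 \<le> long_run_var"
  by (rule LIMSEQ_le_const[OF sum_var_limit]) (auto simp: sum_var_bounds)

text \<open>A function of a block sum is again a functional of the path, evaluated at the time that
  precedes the block.\<close>

lemma expectation_sum_shift:
  fixes \<phi> :: "real \<Rightarrow> real"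
  assumes [measurable]: "\<phi> \<in> borel_measurable borel"
  shows "expectation (\<lambda>\<omega>. \<phi> (\<Sum>i=a+1..a+int p. X i \<omega>)) = expectation (\<lambda>\<omega>. \<phi> (\<Sum>i=1..int p. X i \<omega>))"
proof -
  define H where "H x = \<phi> (\<Sum>i=1..int p. h (\<lambda>k. x (i + k)))" for x
  have [measurable]: "(\<lambda>x. h (\<lambda>k. x (i + k))) \<in> borel_measurable path_space" for i
    by (rule measurable_compose[OF measurable_shift h_measurable])
  have H: "H \<in> borel_measurable path_space" unfolding H_def by measurable
  have XH: "Xproc H Y a \<omega> = \<phi> (\<Sum>i=a+1..a+int p. X i \<omega>)" for a \<omega>
  proof -
    have "(\<Sum>i=1..int p. X (a + i) \<omega>) = (\<Sum>i=a+1..a+int p. X i \<omega>)"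
      by (rule sum.reindex_bij_witness[of _ "\<lambda>i. i - a" "\<lambda>i. i + a"]) (auto simp: add.commute)
    then show ?thesis by (simp add: Xproc_def H_def add.assoc)
  qed
  show ?thesis using expectation_Xproc_shift[OF H, of a 0] unfolding XH by simp
qed

lemma sum_X_past:
  assumes "A \<subseteq> {..a}" shows "(\<lambda>\<omega>. \<Sum>i\<in>A. X i \<omega>) \<in> borel_measurable (gen_subalg M Y {..a + int m})"
  by (intro borel_measurable_sum measurable_gen_subalg_mono[OF measurable_Xproc_window[OF h_window]])
     (use assms in auto)

lemma sum_X_future:
  assumes "A \<subseteq> {b..}" shows "(\<lambda>\<omega>. \<Sum>i\<in>A. X i \<omega>) \<in> borel_measurable (gen_subalg M Y {b - int m..})"
  by (intro borel_measurable_sum measurable_gen_subalg_mono[OF measurable_Xproc_window[OF h_window]])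
     (use assms in force)+

text \<open>Cosines and sines are bounded by 1, so each of the four covariances is at most four
  times the mixing coefficient; with the factor 4 of \<open>iexp_factor_le\<close> this gives
  16.\<close>

lemma iexp_sum_factor:
  assumes A: "A \<subseteq> {..a}" and B: "B \<subseteq> {b..}" and n: "1 \<le> a + int m" and k: "a + int m + int k \<le> b - int m"
  shows "norm (expectation (\<lambda>\<omega>. iexp (u * (\<Sum>i\<in>A. X i \<omega>) + u * (\<Sum>i\<in>B. X i \<omega>)))
     - expectation (\<lambda>\<omega>. iexp (u * (\<Sum>i\<in>A. X i \<omega>))) * expectation (\<lambda>\<omega>. iexp (u * (\<Sum>i\<in>B. X i \<omega>))))
     \<le> 16 * alpha_mix M Y k"
proof -
  have mA: "(\<lambda>\<omega>. \<phi> (u * (\<Sum>i\<in>A. X i \<omega>))) \<in> borel_measurable (gen_subalg M Y {..a + int m})"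
    if "\<phi> \<in> borel_measurable borel" for \<phi> :: "real \<Rightarrow> real"
    by (rule measurable_compose[OF _ that]) (use sum_X_past[OF A] in measurable)
  have mB: "(\<lambda>\<omega>. \<phi> (u * (\<Sum>i\<in>B. X i \<omega>))) \<in> borel_measurable (gen_subalg M Y {a + int m + int k..})"
    if "\<phi> \<in> borel_measurable borel" for \<phi> :: "real \<Rightarrow> real"
    by (rule measurable_compose[OF _ that])
      (use measurable_gen_subalg_mono[OF sum_X_future[OF B], of "{a + int m + int k..}"] k in \<open>auto intro!: borel_measurable_times\<close>)
  have c: "\<bar>covar M (\<lambda>\<omega>. \<phi> (u * (\<Sum>i\<in>A. X i \<omega>))) (\<lambda>\<omega>. \<psi> (u * (\<Sum>i\<in>B. X i \<omega>)))\<bar> \<le> 4 * 1 * 1 * alpha_mix M Y k"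
    if "\<phi> \<in> borel_measurable borel" "\<psi> \<in> borel_measurable borel" "\<And>x. \<bar>\<phi> x\<bar> \<le> 1" "\<And>x. \<bar>\<psi> x\<bar> \<le> 1" for \<phi> \<psi> :: "real \<Rightarrow> real"
    using that by (intro covar_le_alpha_mix[OF n mA mB]) auto
  have eq: "16 * alpha_mix M Y k = 4 * (4 * 1 * 1 * alpha_mix M Y k)" by simp
  have m: "(cos :: real \<Rightarrow> real) \<in> borel_measurable borel" "(sin :: real \<Rightarrow> real) \<in> borel_measurable borel"
    by (auto intro!: borel_measurable_continuous_onI continuous_intros)
  note b = abs_cos_le_one abs_sin_le_one
  show ?thesis unfolding eq
    by (rule iexp_factor_le[OF _ _ c[OF m(1) m(1) b(1) b(1)] c[OF m(2) m(2) b(2) b(2)]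
          c[OF m(2) m(1) b(2) b(1)] c[OF m(1) m(2) b(1) b(2)]]; measurable)
qed

text \<open>The large blocks of Bernstein's method: every period of length p + g keeps its first p
  indices and omits the last g, which separate consecutive blocks.\<close>

definition block_set :: "nat \<Rightarrow> nat \<Rightarrow> nat \<Rightarrow> int set" where
  "block_set p g k = (\<Union>j<k. {int (j * (p + g)) + 1..int (j * (p + g)) + int p})"

lemma block_set_subset: "block_set p g k \<subseteq> {1..int (k * (p + g)) - int g}"
proof -
  have *: "int (j * (p + g)) + int p \<le> int (k * (p + g)) - int g" if "j < k" for j
  proof -
    have "Suc j * (p + g) \<le> k * (p + g)" using that by (intro mult_right_mono) auto
    then have "int (Suc j * (p + g)) \<le> int (k * (p + g))" by (simp only: of_nat_le_iff)
    then show ?thesis by simp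
  qed
  show ?thesis
  proof
    fix i assume "i \<in> block_set p g k"
    then obtain j where j: "j < k" "int (j * (p + g)) + 1 \<le> i" "i \<le> int (j * (p + g)) + int p"
      unfolding block_set_def by auto
    have "0 \<le> int (j * (p + g))" by simp
    then show "i \<in> {1..int (k * (p + g)) - int g}" using *[OF j(1)] j by (simp only: atLeastAtMost_iff) linarith
  qed
qed

lemma block_set_Suc:
  "block_set p g (Suc k) = block_set p g k \<union> {int (k * (p + g)) + 1..int (k * (p + g)) + int p}"
  "block_set p g k \<inter> {int (k * (p + g)) + 1..int (k * (p + g)) + int p} = {}"
  using block_set_subset[of p g k] by (auto simp: block_set_def lessThan_Suc)

lemma finite_block_set: "finite (block_set p g k)" by (simp add: block_set_def)

lemma card_block_set: "card (block_set p g k) = k * p"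
proof (induction k)
  case (Suc k)
  show ?case unfolding block_set_Suc(1)
    by (subst card_Un_disjoint) (use Suc block_set_Suc(2)[of p g k] finite_block_set in auto)
qed (simp add: block_set_def)

text \<open>The blocks are split off one at a time from the right. All factors have norm at most 1,
  so the mixing errors only add up. A gap g between blocks shrinks to g - 2 m because each window
  reaches m beyond its block.\<close>

lemma iexp_block_sum:
  assumes g: "2 * m \<le> g" "1 \<le> p"
  shows "norm (expectation (\<lambda>\<omega>. iexp (u * (\<Sum>i\<in>block_set p g k. X i \<omega>)))
     - expectation (\<lambda>\<omega>. iexp (u * (\<Sum>i=1..int p. X i \<omega>))) ^ k) \<le> real k * (16 * alpha_mix M Y (g - 2 * m))"
proof (induction k)
  case 0 then show ?case by (simp add: block_set_def prob_space)
next
  case (Suc k)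
  let ?B = "{int (k * (p + g)) + 1..int (k * (p + g)) + int p}" and ?a = "16 * alpha_mix M Y (g - 2 * m)"
  let ?E = "\<lambda>A. expectation (\<lambda>\<omega>. iexp (u * (\<Sum>i\<in>A. X i \<omega>)))"
  have E: "?E A = Complex (expectation (\<lambda>\<omega>. cos (u * (\<Sum>i\<in>A. X i \<omega>)))) (expectation (\<lambda>\<omega>. sin (u * (\<Sum>i\<in>A. X i \<omega>))))" for A
    by (rule expectation_iexp) measurable
  have "(\<lambda>x. cos (u * x)) \<in> borel_measurable borel" "(\<lambda>x. sin (u * x)) \<in> borel_measurable borel" by measurable
  note this[THEN expectation_sum_shift, of "int (k * (p + g))" p]
  then have shift: "?E ?B = ?E {1..int p}" unfolding E by (simp only:)
  have split: "?E (block_set p g (Suc k)) = expectation (\<lambda>\<omega>. iexp (u * (\<Sum>i\<in>block_set p g k. X i \<omega>) + u * (\<Sum>i\<in>?B. X i \<omega>)))"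
    unfolding block_set_Suc(1)
    by (subst sum.union_disjoint) (use block_set_Suc(2)[of p g k] finite_block_set in \<open>auto simp: distrib_left\<close>)
  have step: "norm (?E (block_set p g (Suc k)) - ?E (block_set p g k) * ?E {1..int p}) \<le> ?a"
  \<comment> \<open>There is nothing to separate for the first block, and the mixing bound would be
    inapplicable there, because the end of the past would not be a positive time.\<close>
  proof (cases "k = 0")
    case True
    then show ?thesis by (simp add: block_set_def prob_space alpha_mix_bounds lessThan_Suc)
  next
    case False
    then have "p + g \<le> k * (p + g)" by simp
    then have lb: "int p + int g \<le> int (k * (p + g))" by (simp only: of_nat_add[symmetric] of_nat_le_iff)
    show ?thesis unfolding split shift[symmetric]
    proof (rule iexp_sum_factor[of _ "int (k * (p + g)) - int g" _ "int (k * (p + g)) + 1"])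
      show "1 \<le> int (k * (p + g)) - int g + int m" using lb g by linarith
      show "int (k * (p + g)) - int g + int m + int (g - 2 * m) \<le> int (k * (p + g)) + 1 - int m" using g by linarith
      show "block_set p g k \<subseteq> {..int (k * (p + g)) - int g}" using block_set_subset[of p g k] by fastforce
    qed auto
  qed
  have dec: "?E (block_set p g (Suc k)) - ?E {1..int p} ^ Suc k
     = (?E (block_set p g (Suc k)) - ?E (block_set p g k) * ?E {1..int p})
       + (?E (block_set p g k) - ?E {1..int p} ^ k) * ?E {1..int p}" by (simp add: algebra_simps)
  have eq: "real (Suc k) * ?a = ?a + real k * ?a * 1" by (simp add: algebra_simps)
  show ?case unfolding dec eq
    by (intro norm_triangle_le add_mono step order_trans[OF norm_mult_ineq] mult_mono Suc.IH norm_expectation_iexp_le)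
       (auto simp: alpha_mix_bounds)
qed

text \<open>A Taylor step to 1 - u^2 Var/2 is followed by the comparison with the exponential. In
  the remainder |S|^3 is bounded by p K S^2, so the variance bound replaces a third moment.\<close>

lemma iexp_block_approx:
  "norm (expectation (\<lambda>\<omega>. iexp (u * (\<Sum>i=1..int p. X i \<omega>))) - of_real (exp (- (u\<^sup>2 * sum_var p / 2))))
     \<le> \<bar>u\<bar> ^ 3 * K * (real p)\<^sup>2 * var_bound / 6 + u ^ 4 * var_bound\<^sup>2 * (real p)\<^sup>2 / 4"
proof -
  let ?S = "\<lambda>\<omega>. \<Sum>i=1..int p. X i \<omega>"
  have Si: "integrable M (\<lambda>\<omega>. (?S \<omega>)\<^sup>2)" by (rule sum_X_square) simp
  have Si1: "integrable M ?S" by (rule integrable_of_square[OF _ Si]) measurable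
  have iX: "integrable M (X i)" for i using integrable_Xproc_square(2)[OF h_measurable X_square] .
  have E0: "expectation ?S = 0"
    using iX h_mean expectation_Xproc_shift[OF h_measurable, of _ 1] by simp
  have y: "0 \<le> u\<^sup>2 * sum_var p / 2" using sum_var_bounds by simp
  have S3: "\<bar>u\<bar> * \<bar>?S \<omega>\<bar> ^ 3 \<le> \<bar>u\<bar> * (real p * K) * (?S \<omega>)\<^sup>2" for \<omega>
  proof -
    have "\<bar>?S \<omega>\<bar> ^ 3 = \<bar>?S \<omega>\<bar> * (?S \<omega>)\<^sup>2" by (simp add: power3_eq_cube power2_eq_square abs_mult_self_eq mult.assoc)
    also have "\<dots> \<le> (real p * K) * (?S \<omega>)\<^sup>2" using abs_sum_X_le[where G="{1..int p}" and \<omega>=\<omega>] by (intro mult_right_mono) auto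
    finally show ?thesis by (simp add: mult_left_mono mult.assoc)
  qed
  have ch: "char (distr M borel ?S) u = expectation (\<lambda>\<omega>. iexp (u * ?S \<omega>))"
    unfolding char_def by (rule integral_distr; measurable)
  have var: "variance ?S = sum_var p" unfolding E0 by (simp add: sum_var_def)
  have "?S \<in> borel_measurable M" by measurable
  from char_approx3'[OF this Si1 Si E0 var refl, of u]
  have "norm (expectation (\<lambda>\<omega>. iexp (u * ?S \<omega>)) - of_real (1 - u\<^sup>2 * sum_var p / 2))
     \<le> (u\<^sup>2 / 6) * expectation (\<lambda>\<omega>. min (6 * (?S \<omega>)\<^sup>2) (\<bar>u\<bar> * \<bar>?S \<omega>\<bar> ^ 3))"
    unfolding ch .
  also have "expectation (\<lambda>\<omega>. min (6 * (?S \<omega>)\<^sup>2) (\<bar>u\<bar> * \<bar>?S \<omega>\<bar> ^ 3)) \<le> expectation (\<lambda>\<omega>. \<bar>u\<bar> * (real p * K) * (?S \<omega>)\<^sup>2)"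
  proof (rule integral_mono)
    show "integrable M (\<lambda>\<omega>. min (6 * (?S \<omega>)\<^sup>2) (\<bar>u\<bar> * \<bar>?S \<omega>\<bar> ^ 3))"
      by (rule Bochner_Integration.integrable_bound[of _ "\<lambda>\<omega>. 6 * (?S \<omega>)\<^sup>2"]) (use Si in auto)
  qed (use Si S3 in \<open>auto simp: min_le_iff_disj\<close>)
  also have "\<dots> = \<bar>u\<bar> * (real p * K) * sum_var p" by (simp add: sum_var_def)
  also have "\<dots> \<le> \<bar>u\<bar> * (real p * K) * (real p * var_bound)" using sum_var_bounds K_nonneg by (intro mult_left_mono) auto
  also have "(u\<^sup>2 / 6) * (\<bar>u\<bar> * (real p * K) * (real p * var_bound)) = \<bar>u\<bar> ^ 3 * K * (real p)\<^sup>2 * var_bound / 6"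
    by (simp add: power3_eq_cube power2_eq_square abs_mult_self_eq)
  finally have 1: "norm (expectation (\<lambda>\<omega>. iexp (u * ?S \<omega>)) - of_real (1 - u\<^sup>2 * sum_var p / 2))
     \<le> \<bar>u\<bar> ^ 3 * K * (real p)\<^sup>2 * var_bound / 6" by (simp add: mult_left_mono)
  have "norm (complex_of_real (1 - u\<^sup>2 * sum_var p / 2) - of_real (exp (- (u\<^sup>2 * sum_var p / 2)))) \<le> (u\<^sup>2 * sum_var p / 2)\<^sup>2"
    using abs_one_minus_exp_le[OF y] by (simp only: of_real_diff[symmetric] norm_of_real)
  also have "\<dots> \<le> (u\<^sup>2 * (real p * var_bound) / 2)\<^sup>2"
    using sum_var_bounds y by (intro power_mono divide_right_mono mult_left_mono) auto
  also have "\<dots> = u ^ 4 * var_bound\<^sup>2 * (real p)\<^sup>2 / 4" by (simp add: power_mult_distrib power_divide power_mult[symmetric])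
  finally show ?thesis by (rule norm_diff_triangle_le[OF 1])
qed

text \<open>The three summands of the bound are the cost of discarding the n - k p indices outside
  the large blocks, of factorising over the blocks, and of replacing each factor by an exponential.
  The first uses the variance bound for the discarded set.\<close>

lemma iexp_sum_approx:
  assumes g: "2 * m \<le> g" "1 \<le> p" and n: "k * (p + g) \<le> n"
  shows "norm (expectation (\<lambda>\<omega>. iexp (u * (\<Sum>i=1..int n. X i \<omega>))) - of_real (exp (- (real k * (u\<^sup>2 * sum_var p / 2)))))
     \<le> \<bar>u\<bar> * sqrt (var_bound * real (n - k * p)) + real k * (16 * alpha_mix M Y (g - 2 * m))
       + real k * (\<bar>u\<bar> ^ 3 * K * (real p)\<^sup>2 * var_bound / 6 + u ^ 4 * var_bound\<^sup>2 * (real p)\<^sup>2 / 4)"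
proof -
  let ?E = "\<lambda>A. expectation (\<lambda>\<omega>. iexp (u * (\<Sum>i\<in>A. X i \<omega>)))" and ?b = "block_set p g k"
  let ?G = "{1..int n} - ?b"
  have sub: "?b \<subseteq> {1..int n}"
  proof -
    have "int (k * (p + g)) \<le> int n" using n by (simp only: of_nat_le_iff)
    then show ?thesis using block_set_subset[of p g k] by force
  qed
  have cG: "card ?G = n - k * p" using sub finite_block_set by (simp add: card_Diff_subset card_block_set)
  have diff: "(\<Sum>i=1..int n. X i \<omega>) - (\<Sum>i\<in>?b. X i \<omega>) = (\<Sum>i\<in>?G. X i \<omega>)" for \<omega>
    using sub by (simp add: sum_diff)
  have sqG: "integrable M (\<lambda>\<omega>. (\<Sum>i\<in>?G. X i \<omega>)\<^sup>2)" "expectation (\<lambda>\<omega>. (\<Sum>i\<in>?G. X i \<omega>)\<^sup>2) \<le> var_bound * real (n - k * p)"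
    using sum_X_square[of ?G] by (auto simp: cG mult.commute)
  have 1: "norm (?E {1..int n} - ?E ?b) \<le> \<bar>u\<bar> * sqrt (var_bound * real (n - k * p))"
  proof -
    have "?E {1..int n} - ?E ?b = expectation (\<lambda>\<omega>. iexp (u * (\<Sum>i=1..int n. X i \<omega>)) - iexp (u * (\<Sum>i\<in>?b. X i \<omega>)))"
      by (rule Bochner_Integration.integral_diff[symmetric, OF integrable_iexp_rv integrable_iexp_rv]; measurable)
    also have "norm \<dots> \<le> expectation (\<lambda>\<omega>. norm (iexp (u * (\<Sum>i=1..int n. X i \<omega>)) - iexp (u * (\<Sum>i\<in>?b. X i \<omega>))))"
      by (rule integral_norm_bound)
    also have "\<dots> \<le> expectation (\<lambda>\<omega>. \<bar>u\<bar> * \<bar>\<Sum>i\<in>?G. X i \<omega>\<bar>)"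
    proof (rule integral_mono)
      show "integrable M (\<lambda>\<omega>. norm (iexp (u * (\<Sum>i=1..int n. X i \<omega>)) - iexp (u * (\<Sum>i\<in>?b. X i \<omega>))))"
        by (intro integrable_norm Bochner_Integration.integrable_diff integrable_iexp_rv; measurable)
      show "integrable M (\<lambda>\<omega>. \<bar>u\<bar> * \<bar>\<Sum>i\<in>?G. X i \<omega>\<bar>)"
        using integrable_of_square[OF _ sqG(1)] by auto
      show "norm (iexp (u * (\<Sum>i=1..int n. X i \<omega>)) - iexp (u * (\<Sum>i\<in>?b. X i \<omega>))) \<le> \<bar>u\<bar> * \<bar>\<Sum>i\<in>?G. X i \<omega>\<bar>" for \<omega>
        using norm_iexp_diff_le[of "u * (\<Sum>i=1..int n. X i \<omega>)" "u * (\<Sum>i\<in>?b. X i \<omega>)"]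
        by (simp only: diff[symmetric] right_diff_distrib[symmetric] abs_mult)
    qed
    also have "\<dots> = \<bar>u\<bar> * expectation (\<lambda>\<omega>. \<bar>\<Sum>i\<in>?G. X i \<omega>\<bar>)" by simp
    also have "\<dots> \<le> \<bar>u\<bar> * sqrt (var_bound * real (n - k * p))"
      using expectation_abs_le_sqrt[OF _ sqG(1)] sqG(2)
      by (intro mult_left_mono) (auto intro: order_trans real_sqrt_le_mono)
    finally show ?thesis .
  qed
  have "norm (?E {1..int p} ^ k - of_real (exp (- (u\<^sup>2 * sum_var p / 2))) ^ k)
     \<le> real k * norm (?E {1..int p} - of_real (exp (- (u\<^sup>2 * sum_var p / 2))))"
    using sum_var_bounds by (intro norm_power_diff norm_expectation_iexp_le) auto
  also have "\<dots> \<le> real k * (\<bar>u\<bar> ^ 3 * K * (real p)\<^sup>2 * var_bound / 6 + u ^ 4 * var_bound\<^sup>2 * (real p)\<^sup>2 / 4)"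
    by (intro mult_left_mono iexp_block_approx) auto
  also have "complex_of_real (exp (- (u\<^sup>2 * sum_var p / 2))) ^ k = of_real (exp (- (real k * (u\<^sup>2 * sum_var p / 2))))"
    by (simp only: of_real_power[symmetric] exp_of_nat_mult[symmetric] mult_minus_right)
  finally have 3: "norm (?E {1..int p} ^ k - of_real (exp (- (real k * (u\<^sup>2 * sum_var p / 2)))))
     \<le> real k * (\<bar>u\<bar> ^ 3 * K * (real p)\<^sup>2 * var_bound / 6 + u ^ 4 * var_bound\<^sup>2 * (real p)\<^sup>2 / 4)" .
  show ?thesis
    by (rule norm_diff_triangle_le[OF norm_diff_triangle_le[OF 1 iexp_block_sum[OF g]] 3])
qed

end

text \<open>With \<open>r\<close> the integer part of the sixth root of \<open>n\<close>, the blocks have length \<open>r\<^sup>2\<close> and the gaps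
  length \<open>r\<close>; the mixing rate 8 beats the number of blocks, which is of order \<open>r\<^sup>4\<close>.\<close>
definition sixth_root :: "nat \<Rightarrow> nat" where "sixth_root n = nat \<lfloor>real n powr (1 / 6)\<rfloor>"

lemma sixth_root_bounds:
  shows "real (sixth_root n) ^ 6 \<le> real n" "real n < (real (sixth_root n) + 1) ^ 6"
proof -
  define x where "x = real n powr (1 / 6)"
  have x: "0 \<le> x" by (simp add: x_def)
  have x6: "x ^ 6 = real n"
    by (cases "n = 0") (simp_all add: x_def powr_realpow[symmetric] powr_powr)
  have r: "real (sixth_root n) \<le> x" "x < real (sixth_root n) + 1"
    using x unfolding sixth_root_def x_def[symmetric] by (auto simp: of_nat_nat)
  show "real (sixth_root n) ^ 6 \<le> real n" unfolding x6[symmetric] using r by (intro power_mono) auto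
  show "real n < (real (sixth_root n) + 1) ^ 6" unfolding x6[symmetric] using r x by (intro power_strict_mono) auto
qed

lemma filterlim_sixth_root: "filterlim (\<lambda>n. real (sixth_root n)) at_top sequentially"
proof -
  have "filterlim (\<lambda>n. real n powr (1 / 6) - 1) at_top sequentially" by real_asymp
  then show ?thesis
  proof (rule filterlim_at_top_mono)
    show "eventually (\<lambda>n. real n powr (1 / 6) - 1 \<le> real (sixth_root n)) sequentially"
      unfolding sixth_root_def by (intro always_eventually allI) (auto simp: of_nat_nat)
  qed
qed

section \<open>Rates for the block decomposition and convergence of characteristic functions\<close>

context bounded_window_process
begin

text \<open>With n of order R^6 there are about R^4 blocks of length R^2. The omitted share is
  O(1/R), the mixing errors sum to O(R^-4), and the Taylor errors are O(R^2/n^(1/2)) and O(R^2/n);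
  all are weakened to multiples of 1/R, the first under a square root.\<close>

lemma iexp_sum_rate:
  fixes t :: real and n :: nat
  defines "r \<equiv> sixth_root n"
  defines "R \<equiv> real r" and "p \<equiv> r\<^sup>2" and "k \<equiv> n div (r\<^sup>2 + r)"
  assumes r: "4 * m + 2 \<le> r"
  shows "norm (expectation (\<lambda>\<omega>. iexp (t / sqrt n * (\<Sum>i=1..int n. X i \<omega>)))
       - of_real (exp (- (t\<^sup>2 / 2 * (real (k * p) / real n * (sum_var p / real p))))))
     \<le> \<bar>t\<bar> * sqrt (3 * var_bound / R) + 262144 * C / R + \<bar>t\<bar> ^ 3 * K * var_bound / (6 * R) + t ^ 4 * var_bound\<^sup>2 / (4 * R)"
    and "1 - 3 / R \<le> real (k * p) / real n" "real (k * p) / real n \<le> 1"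
proof -
  have R2: "2 \<le> R" using r by (simp add: R_def algebra_simps)
  have R1: "1 \<le> R" "0 < R" using R2 by auto
  have p: "real p = R\<^sup>2" "1 \<le> p" using R1 r by (auto simp: p_def R_def)
  have n6: "R ^ 6 \<le> real n" "real n < (R + 1) ^ 6"
    unfolding R_def r_def by (rule sixth_root_bounds)+
  have Rpow: "R ^ a \<le> R ^ b" if "a \<le> b" for a b using R1 that by (intro power_increasing) auto
  have n0: "0 < real n" using n6 R1 by (meson less_le_trans zero_less_power)
  have n64: "real n \<le> 64 * R ^ 6"
  proof -
    have "(R + 1) ^ 6 \<le> (2 * R) ^ 6" using R1 by (intro power_mono) auto
    then show ?thesis using n6 by (simp add: power_mult_distrib)
  qed
  have pr: "p + r = r\<^sup>2 + r" by (simp add: p_def)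
  have kn: "k * (p + r) \<le> n" unfolding pr k_def by (rule div_times_less_eq_dividend)
  then have "real (k * (p + r)) \<le> real n" by (simp only: of_nat_le_iff)
  then have kn': "real k * (R\<^sup>2 + R) \<le> real n" by (simp add: p R_def)
  have nk': "real n \<le> (real k + 1) * (R\<^sup>2 + R)"
  proof -
    have "n < (k + 1) * (r\<^sup>2 + r)" unfolding k_def
      using dividend_less_div_times[of "r\<^sup>2 + r" n] r by (simp add: algebra_simps)
    then have "real n < real ((k + 1) * (r\<^sup>2 + r))" by (simp only: of_nat_less_iff)
    also have "\<dots> = (real k + 1) * (R\<^sup>2 + R)" by (simp add: R_def algebra_simps)
    finally show ?thesis by simp
  qed
  have kp: "real k * R\<^sup>2 \<le> real n"
    using kn' R1 by (intro order_trans[OF mult_left_mono kn']) auto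
  have kple: "k * p \<le> n" using kn by (metis add_leD1 add_mult_distrib2)
  \<comment> \<open>The gaps omit at most k R \<le> n/R indices and the incomplete last period at
    most R^2 + R \<le> 2 n/R, hence the 3.\<close>
  have gapR: "real n - real k * R\<^sup>2 \<le> 3 * real n / R"
  proof -
    have "real n - real k * R\<^sup>2 \<le> real k * R + (R\<^sup>2 + R)" using nk' by (simp add: algebra_simps)
    moreover have "real k * R \<le> real n / R"
      using kp R1 by (simp add: field_simps power2_eq_square)
    moreover have "R\<^sup>2 + R \<le> 2 * real n / R"
    proof -
      have "(R\<^sup>2 + R) * R \<le> 2 * R ^ 3"
        using Rpow[of 2 3] by (simp add: power2_eq_square power3_eq_cube algebra_simps)
      also have "\<dots> \<le> 2 * real n" using n6 Rpow[of 3 6] by simp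
      finally show ?thesis using R1 by (simp add: field_simps)
    qed
    moreover have "real n / R + 2 * real n / R = 3 * real n / R" by (simp add: add_divide_distrib[symmetric])
    ultimately show ?thesis by linarith
  qed
  show "real (k * p) / real n \<le> 1" using kp n0 by (simp add: p)
  show "1 - 3 / R \<le> real (k * p) / real n"
  proof -
    have "1 - real k * R\<^sup>2 / real n = (real n - real k * R\<^sup>2) / real n" using n0 by (simp add: diff_divide_distrib)
    also have "\<dots> \<le> (3 * real n / R) / real n" using n0 by (intro divide_right_mono gapR) auto
    also have "\<dots> = 3 / R" using n0 by simp
    finally show ?thesis by (simp add: p)
  qed
  define u where "u = t / sqrt n"
  have u2: "u\<^sup>2 = t\<^sup>2 / real n" by (simp add: u_def power_divide)
  have au: "\<bar>u\<bar> = \<bar>t\<bar> / sqrt n" by (simp add: u_def)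
  have sq: "R ^ 3 \<le> sqrt n"
    using n6 by (intro real_le_rsqrt) (simp add: power_mult[symmetric])
  have T1: "\<bar>u\<bar> * sqrt (var_bound * real (n - k * p)) \<le> \<bar>t\<bar> * sqrt (3 * var_bound / R)"
  proof -
    have e: "real (n - k * p) = real n - real k * R\<^sup>2" using kple by (simp add: of_nat_diff p)
    have "\<bar>u\<bar> * sqrt (var_bound * (real n - real k * R\<^sup>2)) = \<bar>t\<bar> * sqrt (var_bound * (real n - real k * R\<^sup>2) / real n)"
      by (simp add: au real_sqrt_divide)
    also have "\<bar>t\<bar> * sqrt (var_bound * (real n - real k * R\<^sup>2) / real n) \<le> \<bar>t\<bar> * sqrt (var_bound * (3 * real n / R) / real n)"
      using n0 var_bound_nonneg by (intro mult_left_mono real_sqrt_le_mono divide_right_mono gapR) auto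
    also have "var_bound * (3 * real n / R) / real n = 3 * var_bound / R" using n0 by simp
    finally show ?thesis unfolding e .
  qed
  \<comment> \<open>Since R - 2 m \<ge> R/2, the mixing coefficient is at most 256 C/R^8; k \<le> 64
    R^4 follows from n \<le> 64 R^6, and 262144 = 64 * 16 * 256.\<close>
  have T2: "real k * (16 * alpha_mix M Y (r - 2 * m)) \<le> 262144 * C / R"
  proof -
    have "alpha_mix M Y (r - 2 * m) \<le> C * real (r - 2 * m) powr (- 8)" using r by (intro mixing) auto
    also have "\<dots> \<le> C * (R / 2) powr (- 8)"
    proof -
      have "R / 2 \<le> real (r - 2 * m)" using r by (simp add: R_def of_nat_diff)
      then show ?thesis using C_nonneg R1 by (intro mult_left_mono powr_mono2') auto
    qed
    also have "(R / 2) powr (- 8) = 256 / R ^ 8" using R1 by (simp add: powr_minus_divide powr_numeral power_divide)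
    finally have al: "alpha_mix M Y (r - 2 * m) \<le> C * (256 / R ^ 8)" .
    have "R ^ 6 = R ^ 4 * R\<^sup>2" by (simp add: power_add[symmetric])
    then have "real k * R\<^sup>2 \<le> 64 * R ^ 4 * R\<^sup>2" using kp n64 by (simp only: mult.assoc)
    then have k4: "real k \<le> 64 * R ^ 4" by (rule mult_right_le_imp_le) (use R1 in auto)
    have "real k * (16 * alpha_mix M Y (r - 2 * m)) \<le> (64 * R ^ 4) * (16 * (C * (256 / R ^ 8)))"
      using k4 al C_nonneg R1 alpha_mix_bounds by (intro mult_mono) auto
    also have "\<dots> = 262144 * C / R ^ 4"
    proof -
      have *: "(64 * a) * (16 * (C * (256 / (a * a)))) = 262144 * C / a" if "0 < a" for a :: real using that by simp
      have "R ^ 8 = R ^ 4 * R ^ 4" by (simp add: power_add[symmetric])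
      then show ?thesis using *[of "R ^ 4"] R1 by (simp only: zero_less_power)
    qed
    also have "\<dots> \<le> 262144 * C / R" using C_nonneg R1 Rpow[of 1 4] by (intro divide_left_mono) auto
    finally show ?thesis .
  qed
  have kp2: "real k * (real p)\<^sup>2 \<le> real n * R\<^sup>2"
    using mult_right_mono[OF kp, of "R\<^sup>2"] by (simp add: p power2_eq_square mult.assoc)
  have T3: "real k * (\<bar>u\<bar> ^ 3 * K * (real p)\<^sup>2 * var_bound / 6) \<le> \<bar>t\<bar> ^ 3 * K * var_bound / (6 * R)"
  proof -
    have s3: "sqrt n ^ 3 = real n * sqrt n" using n0 by (simp add: power3_eq_cube)
    have "real k * (\<bar>u\<bar> ^ 3 * K * (real p)\<^sup>2 * var_bound / 6) = (\<bar>t\<bar> ^ 3 * K * var_bound / 6) * (real k * (real p)\<^sup>2 / sqrt n ^ 3)"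
      by (simp add: au power_divide ac_simps)
    also have "\<dots> \<le> (\<bar>t\<bar> ^ 3 * K * var_bound / 6) * (1 / R)"
    proof (rule mult_left_mono)
      have "real k * (real p)\<^sup>2 / sqrt n ^ 3 \<le> real n * R\<^sup>2 / (real n * sqrt n)"
        unfolding s3 using kp2 n0 by (intro divide_right_mono) auto
      also have "\<dots> = R\<^sup>2 / sqrt n" using n0 by simp
      also have "\<dots> \<le> R\<^sup>2 / R ^ 3" using sq R1 n0 by (intro divide_left_mono) auto
      also have "\<dots> = 1 / R" using R1 by (simp add: power2_eq_square power3_eq_cube)
      finally show "real k * (real p)\<^sup>2 / sqrt n ^ 3 \<le> 1 / R" .
    qed (use K_nonneg var_bound_nonneg in auto)
    finally show ?thesis by simp
  qed
  have T4: "real k * (u ^ 4 * var_bound\<^sup>2 * (real p)\<^sup>2 / 4) \<le> t ^ 4 * var_bound\<^sup>2 / (4 * R)"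
  proof -
    have u4: "u ^ 4 = t ^ 4 / (real n)\<^sup>2"
      using arg_cong[OF u2, of "\<lambda>z. z\<^sup>2"] by (simp add: power_divide power_mult[symmetric])
    have "real k * (u ^ 4 * var_bound\<^sup>2 * (real p)\<^sup>2 / 4) = (t ^ 4 * var_bound\<^sup>2 / 4) * (real k * (real p)\<^sup>2 / (real n)\<^sup>2)"
      by (simp add: u4 ac_simps)
    also have "\<dots> \<le> (t ^ 4 * var_bound\<^sup>2 / 4) * (1 / R)"
    proof (rule mult_left_mono)
      have "real k * (real p)\<^sup>2 / (real n)\<^sup>2 \<le> real n * R\<^sup>2 / (real n)\<^sup>2"
        using kp2 n0 by (intro divide_right_mono) auto
      also have "\<dots> = R\<^sup>2 / real n" using n0 by (simp add: power2_eq_square)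
      also have "\<dots> \<le> R\<^sup>2 / R ^ 3" using n6 Rpow[of 3 6] R1 n0 by (intro divide_left_mono) auto
      also have "\<dots> = 1 / R" using R1 by (simp add: power2_eq_square power3_eq_cube)
      finally show "real k * (real p)\<^sup>2 / (real n)\<^sup>2 \<le> 1 / R" .
    qed auto
    finally show ?thesis by simp
  qed
  have ex: "real k * (u\<^sup>2 * sum_var p / 2) = t\<^sup>2 / 2 * (real (k * p) / real n * (sum_var p / real p))"
    using p R1 by (simp add: u2 ac_simps)
  have "norm (expectation (\<lambda>\<omega>. iexp (u * (\<Sum>i=1..int n. X i \<omega>))) - of_real (exp (- (real k * (u\<^sup>2 * sum_var p / 2)))))
     \<le> \<bar>u\<bar> * sqrt (var_bound * real (n - k * p)) + real k * (16 * alpha_mix M Y (r - 2 * m))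
       + real k * (\<bar>u\<bar> ^ 3 * K * (real p)\<^sup>2 * var_bound / 6 + u ^ 4 * var_bound\<^sup>2 * (real p)\<^sup>2 / 4)"
    using r by (intro iexp_sum_approx p kn) auto
  also have "\<dots> \<le> \<bar>t\<bar> * sqrt (3 * var_bound / R) + 262144 * C / R + \<bar>t\<bar> ^ 3 * K * var_bound / (6 * R) + t ^ 4 * var_bound\<^sup>2 / (4 * R)"
    using T1 T2 T3 T4 unfolding distrib_left by linarith
  finally show "norm (expectation (\<lambda>\<omega>. iexp (t / sqrt n * (\<Sum>i=1..int n. X i \<omega>)))
       - of_real (exp (- (t\<^sup>2 / 2 * (real (k * p) / real n * (sum_var p / real p))))))
     \<le> \<bar>t\<bar> * sqrt (3 * var_bound / R) + 262144 * C / R + \<bar>t\<bar> ^ 3 * K * var_bound / (6 * R) + t ^ 4 * var_bound\<^sup>2 / (4 * R)"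
    unfolding ex unfolding u_def .
qed

text \<open>In the exponent the share of retained indices tends to 1, and the variance per index of
  one block tends to \<open>long_run_var\<close> because the block length r^2 tends to
  infinity.\<close>

lemma iexp_sum_limit:
  "(\<lambda>n. expectation (\<lambda>\<omega>. iexp (t / sqrt n * (\<Sum>i=1..int n. X i \<omega>)))) \<longlonglongrightarrow> of_real (exp (- (t\<^sup>2 / 2 * long_run_var)))"
proof -
  let ?r = sixth_root
  let ?w = "\<lambda>n. real (n div ((?r n)\<^sup>2 + ?r n) * (?r n)\<^sup>2) / real n"
  let ?v = "\<lambda>n. sum_var ((?r n)\<^sup>2) / real ((?r n)\<^sup>2)"
  have rlim: "filterlim ?r at_top sequentially"
    using filterlim_sixth_root by (simp add: filterlim_sequentially_iff_filterlim_real)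
  have ev: "eventually (\<lambda>n. 4 * m + 2 \<le> ?r n) sequentially"
    using rlim by (auto simp: filterlim_at_top)
  have inv: "(\<lambda>n. c / real (?r n)) \<longlonglongrightarrow> 0" for c
    by (rule real_tendsto_divide_at_top[OF tendsto_const filterlim_sixth_root])
  have w: "?w \<longlonglongrightarrow> 1"
  proof (rule tendsto_sandwich)
    show "(\<lambda>n. 1 - 3 / real (?r n)) \<longlonglongrightarrow> 1" using tendsto_diff[OF tendsto_const inv] by fastforce
    show "eventually (\<lambda>n. 1 - 3 / real (?r n) \<le> ?w n) sequentially"
      using ev by eventually_elim (rule iexp_sum_rate(2))
    show "eventually (\<lambda>n. ?w n \<le> 1) sequentially"
      using ev by eventually_elim (rule iexp_sum_rate(3))
  qed simp
  have "filterlim (\<lambda>n. (?r n)\<^sup>2) at_top sequentially"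
    by (rule filterlim_at_top_mono[OF rlim]) (auto intro!: always_eventually simp: power2_eq_square)
  then have v: "?v \<longlonglongrightarrow> long_run_var" by (rule filterlim_compose[OF sum_var_limit])
  have main: "(\<lambda>n. complex_of_real (exp (- (t\<^sup>2 / 2 * (?w n * ?v n))))) \<longlonglongrightarrow> of_real (exp (- (t\<^sup>2 / 2 * (1 * long_run_var))))"
    by (intro tendsto_intros w v)
  have inv': "(\<lambda>n. c / (d * real (?r n))) \<longlonglongrightarrow> 0" for c d
    using inv[of "c / d"] by simp
  have bd: "(\<lambda>n. \<bar>t\<bar> * sqrt (3 * var_bound / real (?r n)) + 262144 * C / real (?r n) + \<bar>t\<bar> ^ 3 * K * var_bound / (6 * real (?r n)) + t ^ 4 * var_bound\<^sup>2 / (4 * real (?r n)))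
     \<longlonglongrightarrow> \<bar>t\<bar> * sqrt 0 + 0 + 0 + 0"
    by (intro tendsto_add tendsto_mult tendsto_const tendsto_real_sqrt inv inv')
  have "(\<lambda>n. expectation (\<lambda>\<omega>. iexp (t / sqrt n * (\<Sum>i=1..int n. X i \<omega>)))
     - complex_of_real (exp (- (t\<^sup>2 / 2 * (?w n * ?v n))))) \<longlonglongrightarrow> 0"
  proof (rule tendsto_0_le)
    show "(\<lambda>n. \<bar>t\<bar> * sqrt (3 * var_bound / real (?r n)) + 262144 * C / real (?r n) + \<bar>t\<bar> ^ 3 * K * var_bound / (6 * real (?r n)) + t ^ 4 * var_bound\<^sup>2 / (4 * real (?r n))) \<longlonglongrightarrow> 0"
      using bd by simp
    show "eventually (\<lambda>n. norm (expectation (\<lambda>\<omega>. iexp (t / sqrt n * (\<Sum>i=1..int n. X i \<omega>)))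
     - complex_of_real (exp (- (t\<^sup>2 / 2 * (?w n * ?v n))))) \<le> norm (\<bar>t\<bar> * sqrt (3 * var_bound / real (?r n)) + 262144 * C / real (?r n) + \<bar>t\<bar> ^ 3 * K * var_bound / (6 * real (?r n)) + t ^ 4 * var_bound\<^sup>2 / (4 * real (?r n))) * 1) sequentially"
      using ev
    proof eventually_elim
      case (elim n)
      show ?case using order_trans[OF iexp_sum_rate(1)[OF elim] abs_ge_self] by (simp only: real_norm_def mult_1_right)
    qed
  qed
  from tendsto_add[OF this main] show ?thesis by simp
qed

text \<open>For positive variance the normalised sums converge to the standard normal law, whose
  first absolute moment is sqrt(2/pi). If the variance vanishes, the first absolute moment is
  dominated by the root of the second, which tends to 0.\<close>

lemma abs_sum_limit:
  "(\<lambda>n. expectation (\<lambda>\<omega>. \<bar>\<Sum>i=1..int n. X i \<omega>\<bar>) / sqrt n) \<longlonglongrightarrow> sqrt long_run_var * sqrt (2 / pi)"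
proof (cases "long_run_var = 0")
  case True
  let ?S = "\<lambda>n \<omega>. \<Sum>i=1..int n. X i \<omega>"
  have lim: "(\<lambda>n. sqrt (sum_var n / n)) \<longlonglongrightarrow> sqrt long_run_var * sqrt (2 / pi)"
    using tendsto_real_sqrt[OF sum_var_limit] True by simp
  have b: "expectation (\<lambda>\<omega>. \<bar>?S n \<omega>\<bar>) / sqrt n \<le> sqrt (sum_var n / n)" for n
  proof -
    have "expectation (\<lambda>\<omega>. \<bar>?S n \<omega>\<bar>) \<le> sqrt (sum_var n)"
      unfolding sum_var_def by (rule expectation_abs_le_sqrt) (auto intro: sum_X_square)
    then show ?thesis by (simp add: real_sqrt_divide divide_right_mono)
  qed
  have "(\<lambda>n. expectation (\<lambda>\<omega>. \<bar>?S n \<omega>\<bar>) / sqrt n) \<longlonglongrightarrow> 0"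
  proof (rule tendsto_sandwich[OF _ _ tendsto_const])
    show "(\<lambda>n. sqrt (sum_var n / n)) \<longlonglongrightarrow> 0" using lim True by simp
    show "eventually (\<lambda>n. expectation (\<lambda>\<omega>. \<bar>?S n \<omega>\<bar>) / sqrt n \<le> sqrt (sum_var n / n)) sequentially" using b by simp
  qed auto
  then show ?thesis using True by simp
next
  case False
  then have s: "0 < long_run_var" using long_run_var_nonneg by simp
  define s where "s = sqrt long_run_var"
  have s0: "0 < s" using s by (simp add: s_def)
  have s2: "s\<^sup>2 = long_run_var" using s by (simp add: s_def)
  define Z where "Z n \<omega> = (\<Sum>i=1..int n. X i \<omega>) / (s * sqrt n)" for n :: nat and \<omega>
  have Zm[measurable]: "Z n \<in> borel_measurable M" for n unfolding Z_def by measurable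
  have Z2: "(Z n \<omega>)\<^sup>2 = (\<Sum>i=1..int n. X i \<omega>)\<^sup>2 / (s\<^sup>2 * n)" for n \<omega>
    by (simp add: Z_def power_divide power_mult_distrib)
  have Zi: "integrable M (\<lambda>\<omega>. (Z n \<omega>)\<^sup>2)" for n unfolding Z2 using sum_X_square(1)[of "{1..int n}"] by simp
  have Zb: "expectation (\<lambda>\<omega>. (Z n \<omega>)\<^sup>2) \<le> var_bound / s\<^sup>2" for n
  proof -
    have "expectation (\<lambda>\<omega>. (Z n \<omega>)\<^sup>2) = sum_var n / (s\<^sup>2 * n)" unfolding Z2 by (simp add: sum_var_def)
    also have "\<dots> \<le> (n * var_bound) / (s\<^sup>2 * n)" using sum_var_bounds by (intro divide_right_mono) auto
    also have "\<dots> \<le> var_bound / s\<^sup>2" using var_bound_nonneg s0 by (cases "n = 0") auto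
    finally show ?thesis .
  qed
  have ch: "char (distr M borel (Z n)) t = expectation (\<lambda>\<omega>. iexp ((t / s) / sqrt n * (\<Sum>i=1..int n. X i \<omega>)))" for n t
    unfolding char_def by (subst integral_distr) (auto simp: Z_def field_simps)
  have conv: "weak_conv_m (\<lambda>n. distr M borel (Z n)) std_normal_distribution"
  proof (rule levy_continuity)
    show "real_distribution (distr M borel (Z n))" for n by (rule real_distribution_distr) simp
    show "real_distribution std_normal_distribution" by (rule real_dist_normal_dist)
    show "(\<lambda>n. char (distr M borel (Z n)) t) \<longlonglongrightarrow> char std_normal_distribution t" for t
    proof -
      have "- ((t / s)\<^sup>2 / 2 * long_run_var) = - (t\<^sup>2) / 2" using s0 by (simp add: s2[symmetric] power_divide)
      then show ?thesis using iexp_sum_limit[of "t / s"] unfolding ch char_std_normal_distribution by simp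
    qed
  qed
  have "(\<lambda>n. expectation (\<lambda>\<omega>. \<bar>Z n \<omega>\<bar>)) \<longlonglongrightarrow> sqrt (2 / pi)"
    unfolding std_normal_abs_moment[symmetric]
    by (rule weak_conv_imp_abs_moment_conv[OF Zm Zi Zb real_dist_normal_dist _ conv])
       (rule integrable_std_normal_distribution_moment)
  then have "(\<lambda>n. s * expectation (\<lambda>\<omega>. \<bar>Z n \<omega>\<bar>)) \<longlonglongrightarrow> s * sqrt (2 / pi)" by (intro tendsto_intros)
  also have "(\<lambda>n. s * expectation (\<lambda>\<omega>. \<bar>Z n \<omega>\<bar>)) = (\<lambda>n. expectation (\<lambda>\<omega>. \<bar>\<Sum>i=1..int n. X i \<omega>\<bar>) / sqrt n)"
    using s0 by (auto simp: Z_def abs_mult)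
  finally show ?thesis by (simp add: s_def)
qed

end

section \<open>Averages of absolute block sums\<close>

lemma card_near_le_3:
  fixes i :: nat shows "card {j\<in>A. j \<le> i + 1 \<and> i \<le> j + 1} \<le> 3"
proof -
  have "{j\<in>A. j \<le> i + 1 \<and> i \<le> j + 1} \<subseteq> {i - 1, i, i + 1}" by auto
  then have "card {j\<in>A. j \<le> i + 1 \<and> i \<le> j + 1} \<le> card {i - 1, i, i + 1}" by (intro card_mono) auto
  also have "\<dots> \<le> 3" by (rule order_trans[OF card_insert_le_m1]) (auto intro: card_insert_le_m1 simp: card_insert_if)
  finally show ?thesis .
qed

context bounded_window_process
begin

definition block :: "nat \<Rightarrow> nat \<Rightarrow> 'a \<Rightarrow> real" where
  "block l i \<omega> = \<bar>\<Sum>j=int ((i - 1) * l) + 1..int ((i - 1) * l) + int l. X j \<omega>\<bar> / sqrt l"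

lemma block_measurable [measurable]: "block l i \<in> borel_measurable M"
  unfolding block_def by measurable

lemma block_square:
  assumes "0 < l"
  shows "integrable M (\<lambda>\<omega>. (block l i \<omega>)\<^sup>2)" "expectation (\<lambda>\<omega>. (block l i \<omega>)\<^sup>2) \<le> var_bound"
proof -
  let ?G = "{int ((i - 1) * l) + 1..int ((i - 1) * l) + int l}"
  have eq: "(block l i \<omega>)\<^sup>2 = (\<Sum>j\<in>?G. X j \<omega>)\<^sup>2 / l" for \<omega>
    using assms by (simp add: block_def power_divide)
  have s: "integrable M (\<lambda>\<omega>. (\<Sum>j\<in>?G. X j \<omega>)\<^sup>2)" "expectation (\<lambda>\<omega>. (\<Sum>j\<in>?G. X j \<omega>)\<^sup>2) \<le> real (card ?G) * var_bound"
    by (rule sum_X_square; simp)+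
  show "integrable M (\<lambda>\<omega>. (block l i \<omega>)\<^sup>2)" unfolding eq using s(1) by (rule integrable_divide)
  have "expectation (\<lambda>\<omega>. (block l i \<omega>)\<^sup>2) = expectation (\<lambda>\<omega>. (\<Sum>j\<in>?G. X j \<omega>)\<^sup>2) / l" unfolding eq by (rule integral_divide_zero)
  also have "\<dots> \<le> (real l * var_bound) / l" using s(2) by (intro divide_right_mono) auto
  finally show "expectation (\<lambda>\<omega>. (block l i \<omega>)\<^sup>2) \<le> var_bound" using assms by simp
qed

lemma expectation_block: "expectation (block l i) = expectation (\<lambda>\<omega>. \<bar>\<Sum>i=1..int l. X i \<omega>\<bar>) / sqrt l"
proof -
  have "(\<lambda>x. \<bar>x\<bar> / sqrt l) \<in> borel_measurable borel" by measurable
  from expectation_sum_shift[OF this, of "int ((i - 1) * l)" l] show ?thesis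
    unfolding block_def by simp
qed

lemma covar_block_near:
  assumes l: "0 < l" shows "\<bar>covar M (block l i) (block l j)\<bar> \<le> 2 * var_bound"
proof -
  have s: "integrable M (\<lambda>\<omega>. (block l i \<omega>)\<^sup>2)" "expectation (\<lambda>\<omega>. (block l i \<omega>)\<^sup>2) \<le> var_bound" for i
    using block_square[OF l] by auto
  have i: "integrable M (block l i)" for i by (rule integrable_of_square[OF _ s(1)]) simp
  have pos: "0 \<le> block l i \<omega>" for i \<omega> by (simp add: block_def)
  have E: "expectation (block l i) \<le> sqrt var_bound" for i
    using expectation_abs_le_sqrt[OF _ s(1), of i] s(2)[of i] by (simp add: pos) (meson order_trans real_sqrt_le_mono)
  have E0: "0 \<le> expectation (block l i)" for i by (simp add: pos)
  have P: "expectation (\<lambda>\<omega>. block l i \<omega> * block l j \<omega>) \<le> sqrt var_bound * sqrt var_bound"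
  proof (rule order_trans[OF Cauchy_Schwarz_expectation])
    show "sqrt (expectation (\<lambda>\<omega>. (block l i \<omega>)\<^sup>2)) * sqrt (expectation (\<lambda>\<omega>. (block l j \<omega>)\<^sup>2)) \<le> sqrt var_bound * sqrt var_bound"
      by (intro mult_mono real_sqrt_le_mono s) (simp_all add: var_bound_nonneg)
  qed (auto intro: s)
  have "expectation (block l i) * expectation (block l j) \<le> sqrt var_bound * sqrt var_bound"
    by (intro mult_mono E E0) (simp add: var_bound_nonneg)
  moreover have "\<bar>covar M (block l i) (block l j)\<bar>
     \<le> expectation (\<lambda>\<omega>. block l i \<omega> * block l j \<omega>) + expectation (block l i) * expectation (block l j)"
    using abs_covar_le[OF integrable_mult_square[OF _ _ s(1) s(1)] i i, of i j] by (simp add: pos abs_mult)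
  ultimately show ?thesis using P var_bound_nonneg by simp
qed

text \<open>Between nonadjacent blocks lies at least one full block, so a gap of at least
  \<open>l\<close>, of which the windows consume 2 m.\<close>

lemma covar_block_far:
  assumes l: "4 * m + 2 \<le> l" and ij: "1 \<le> i" "i + 1 < j"
  shows "\<bar>covar M (block l i) (block l j)\<bar> \<le> 1024 * K\<^sup>2 * C / l"
proof -
  have l0: "0 < real l" using l by simp
  have bd: "\<bar>block l i \<omega>\<bar> \<le> K * sqrt l" for i \<omega>
  proof -
    have "\<bar>block l i \<omega>\<bar> \<le> real l * K / sqrt l"
      unfolding block_def using abs_sum_X_le[where G="{int ((i - 1) * l) + 1..int ((i - 1) * l) + int l}" and \<omega>=\<omega>]
      by (simp add: divide_right_mono)
    then show ?thesis using l0 by (simp add: real_div_sqrt mult.commute[of "real l"] times_divide_eq_right[symmetric] del: times_divide_eq_right)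
  qed
  have il: "int ((i - 1) * l) + int l = int (i * l)"
    using ij(1) by (cases i) (auto simp: algebra_simps)
  have "(i + 1) * l \<le> (j - 1) * l" using ij by (intro mult_right_mono) auto
  then have jl: "int (i * l) + int l \<le> int ((j - 1) * l)" by (simp only: of_nat_add[symmetric] of_nat_le_iff) simp
  have li: "int l \<le> int (i * l)" using ij by (simp only: of_nat_le_iff) simp
  have "\<bar>covar M (block l i) (block l j)\<bar> \<le> 4 * (K * sqrt l) * (K * sqrt l) * alpha_mix M Y (l - 2 * m)"
  proof (rule covar_le_alpha_mix[of "int (i * l) + int m"])
    show "1 \<le> int (i * l) + int m" using li l by linarith
    have "(\<lambda>\<omega>. \<Sum>j=int ((i - 1) * l) + 1..int ((i - 1) * l) + int l. X j \<omega>) \<in> borel_measurable (gen_subalg M Y {..int (i * l) + int m})"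
      unfolding il by (rule sum_X_past) auto
    then show "block l i \<in> borel_measurable (gen_subalg M Y {..int (i * l) + int m})"
      unfolding block_def[abs_def] by measurable
    have "(\<lambda>\<omega>. \<Sum>i=int ((j - 1) * l) + 1..int ((j - 1) * l) + int l. X i \<omega>)
       \<in> borel_measurable (gen_subalg M Y {int (i * l) + int m + int (l - 2 * m)..})"
    proof (rule measurable_gen_subalg_mono[OF sum_X_future[of _ "int ((j - 1) * l) + 1"]])
      have "int (l - 2 * m) = int l - 2 * int m" using l by simp
      then show "{int ((j - 1) * l) + 1 - int m..} \<subseteq> {int (i * l) + int m + int (l - 2 * m)..}" using jl by (simp only: atLeast_subset_iff)
    qed auto
    then show "block l j \<in> borel_measurable (gen_subalg M Y {int (i * l) + int m + int (l - 2 * m)..})"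
      unfolding block_def[abs_def] by measurable
  qed (rule bd)+
  also have "4 * (K * sqrt l) * (K * sqrt l) = 4 * K\<^sup>2 * l" by (simp add: power2_eq_square)
  also have "4 * K\<^sup>2 * l * alpha_mix M Y (l - 2 * m) \<le> 4 * K\<^sup>2 * l * (C * (256 / real l ^ 8))"
  proof (rule mult_left_mono)
    \<comment> \<open>From l - 2 m \<ge> l/2 the coefficient is at most 2^8 C/l^8; the factor 4 K^2
      l leaves 1024 K^2 C/l^7, of which only the decay 1/l is kept.\<close>
    have "alpha_mix M Y (l - 2 * m) \<le> C * real (l - 2 * m) powr (- 8)" using l by (intro mixing) auto
    also have "\<dots> \<le> C * (real l / 2) powr (- 8)"
    proof -
      have "real l / 2 \<le> real (l - 2 * m)" using l by (simp add: of_nat_diff)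
      then show ?thesis using C_nonneg l0 by (intro mult_left_mono powr_mono2') auto
    qed
    also have "(real l / 2) powr (- 8) = 256 / real l ^ 8" using l0 by (simp add: powr_minus_divide powr_numeral power_divide)
    finally show "alpha_mix M Y (l - 2 * m) \<le> C * (256 / real l ^ 8)" .
  qed simp
  also have "4 * K\<^sup>2 * l * (C * (256 / real l ^ 8)) = 1024 * K\<^sup>2 * C / real l ^ 7"
  proof -
    have *: "4 * K\<^sup>2 * a * (C * (256 / (a * b))) = 1024 * K\<^sup>2 * C / b" if "0 < a" for a b :: real using that by simp
    have "real l ^ 8 = real l * real l ^ 7" by (simp flip: power_Suc)
    then show ?thesis using *[OF l0, of "real l ^ 7"] by (simp only:)
  qed
  also have "\<dots> \<le> 1024 * K\<^sup>2 * C / real l"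
    using l l0 C_nonneg power_increasing[of 1 7 "real l"] by (intro divide_left_mono) auto
  finally show ?thesis .
qed

definition block_mean :: "nat \<Rightarrow> nat \<Rightarrow> 'a \<Rightarrow> real" where
  "block_mean l k \<omega> = (\<Sum>i=1..k. block l i \<omega>) / k"

text \<open>The second moment about \<open>s\<close> is variance plus squared bias. In the double
  sum each block has at most three neighbours including itself, with covariances at most 2
  \<open>var_bound\<close>, and the remaining covariances are O(1/l) uniformly; division by k^2
  gives the bound.\<close>

lemma block_mean_variance:
  fixes c :: real
  assumes l: "4 * m + 2 \<le> l" and k: "0 < k"
  defines "c \<equiv> expectation (\<lambda>\<omega>. \<bar>\<Sum>i=1..int l. X i \<omega>\<bar>) / sqrt l"
  shows "integrable M (\<lambda>\<omega>. (block_mean l k \<omega> - s)\<^sup>2)"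
    "expectation (\<lambda>\<omega>. (block_mean l k \<omega> - s)\<^sup>2) \<le> 6 * var_bound / k + 1024 * K\<^sup>2 * C / l + (c - s)\<^sup>2"
proof -
  have l0: "0 < l" using l by simp
  have k0: "0 < real k" using k by simp
  have ib2: "integrable M (\<lambda>\<omega>. block l i \<omega> * block l j \<omega>)" for i j
    by (rule integrable_mult_square[OF block_measurable block_measurable block_square(1)[OF l0] block_square(1)[OF l0]])
  have ib: "integrable M (block l i)" for i by (rule integrable_of_square[OF block_measurable block_square(1)[OF l0]])
  have Eb: "expectation (block l i) = c" for i unfolding c_def by (rule expectation_block)
  let ?b = "\<lambda>i \<omega>. block l i \<omega> - s"
  have bb: "?b i \<omega> * ?b j \<omega> = block l i \<omega> * block l j \<omega> - s * block l i \<omega> - s * block l j \<omega> + s * s" for i j \<omega>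
    by (simp add: algebra_simps)
  have ibb: "integrable M (\<lambda>\<omega>. ?b i \<omega> * ?b j \<omega>)" for i j unfolding bb using ib ib2 by simp
  have Ebb: "expectation (\<lambda>\<omega>. ?b i \<omega> * ?b j \<omega>) = covar M (block l i) (block l j) + (c - s)\<^sup>2" for i j
  proof -
    have "expectation (\<lambda>\<omega>. ?b i \<omega> * ?b j \<omega>) = expectation (\<lambda>\<omega>. block l i \<omega> * block l j \<omega>) - s * c - s * c + s * s"
      unfolding bb using ib ib2 by (simp add: prob_space Eb)
    also have "\<dots> = covar M (block l i) (block l j) + (c - s)\<^sup>2"
      unfolding covar_def Eb by (simp add: power2_eq_square algebra_simps)
    finally show ?thesis .
  qed
  have eq: "(block_mean l k \<omega> - s)\<^sup>2 = (\<Sum>i=1..k. \<Sum>j=1..k. ?b i \<omega> * ?b j \<omega>) / (real k)\<^sup>2" for \<omega>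
  proof -
    have "block_mean l k \<omega> - s = (\<Sum>i=1..k. ?b i \<omega>) / k"
      using k0 by (simp add: block_mean_def sum_subtractf diff_divide_distrib)
    then show ?thesis by (simp add: power_divide power2_eq_square sum_product)
  qed
  show "integrable M (\<lambda>\<omega>. (block_mean l k \<omega> - s)\<^sup>2)" unfolding eq using ibb by auto
  let ?e = "1024 * K\<^sup>2 * C / l"
  have e0: "0 \<le> ?e" using C_nonneg by simp
  have row: "(\<Sum>j=1..k. covar M (block l i) (block l j)) \<le> 6 * var_bound + real k * ?e" if i: "i \<in> {1..k}" for i
  proof -
    let ?N = "{j\<in>{1..k}. j \<le> i + 1 \<and> i \<le> j + 1}"
    have pt: "covar M (block l i) (block l j) \<le> (if j \<in> ?N then 2 * var_bound else 0) + ?e" if j: "j \<in> {1..k}" for j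
    proof (cases "j \<in> ?N")
      case True
      then show ?thesis using covar_block_near[OF l0, of i j] e0 by simp
    next
      case False
      then consider "i + 1 < j" | "j + 1 < i" using j by force
      then have "\<bar>covar M (block l i) (block l j)\<bar> \<le> ?e"
      proof cases
        case 1 then show ?thesis using i by (intro covar_block_far[OF l]) auto
      next
        case 2
        then have "\<bar>covar M (block l j) (block l i)\<bar> \<le> ?e" using j by (intro covar_block_far[OF l]) auto
        then show ?thesis by (simp add: covar_commute)
      qed
      then show ?thesis unfolding if_not_P[OF False] by simp
    qed
    have "(\<Sum>j=1..k. covar M (block l i) (block l j)) \<le> (\<Sum>j=1..k. (if j \<in> ?N then 2 * var_bound else 0) + ?e)"
      by (intro sum_mono pt)
    also have "\<dots> = (\<Sum>j=1..k. if j \<in> ?N then 2 * var_bound else 0) + real k * ?e" by (simp add: sum.distrib)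
    also have "(\<Sum>j=1..k. if j \<in> ?N then 2 * var_bound else 0) = (\<Sum>j\<in>?N. 2 * var_bound)"
      by (rule sum.mono_neutral_cong_right) auto
    also have "\<dots> = real (card ?N) * (2 * var_bound)" by simp
    also have "\<dots> \<le> 3 * (2 * var_bound)"
      using card_near_le_3[of "{1..k}" i] var_bound_nonneg by (intro mult_right_mono) auto
    finally show ?thesis by simp
  qed
  have E: "expectation (\<lambda>\<omega>. (block_mean l k \<omega> - s)\<^sup>2) = (\<Sum>i=1..k. \<Sum>j=1..k. covar M (block l i) (block l j) + (c - s)\<^sup>2) / (real k)\<^sup>2"
    unfolding eq using ibb by (simp add: Ebb)
  have "(\<Sum>i=1..k. \<Sum>j=1..k. covar M (block l i) (block l j) + (c - s)\<^sup>2)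
     = (\<Sum>i=1..k. (\<Sum>j=1..k. covar M (block l i) (block l j)) + real k * (c - s)\<^sup>2)" by (simp add: sum.distrib)
  also have "\<dots> \<le> (\<Sum>i=1..k. (6 * var_bound + real k * ?e) + real k * (c - s)\<^sup>2)" by (intro sum_mono add_mono row) auto
  also have "\<dots> = real k * ((6 * var_bound + real k * ?e) + real k * (c - s)\<^sup>2)" by simp
  finally have "expectation (\<lambda>\<omega>. (block_mean l k \<omega> - s)\<^sup>2) \<le> (real k * ((6 * var_bound + real k * ?e) + real k * (c - s)\<^sup>2)) / (real k)\<^sup>2"
    unfolding E by (rule divide_right_mono) simp
  also have "\<dots> = 6 * var_bound / k + ?e + (c - s)\<^sup>2" using k0 by (simp add: add_divide_distrib power2_eq_square)
  finally show "expectation (\<lambda>\<omega>. (block_mean l k \<omega> - s)\<^sup>2) \<le> 6 * var_bound / k + ?e + (c - s)\<^sup>2" .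
qed

lemma block_mean_limit:
  fixes l k :: "nat \<Rightarrow> nat"
  assumes l: "filterlim l at_top sequentially" and k: "filterlim k at_top sequentially"
  shows "(\<lambda>n. expectation (\<lambda>\<omega>. (block_mean (l n) (k n) \<omega> - sqrt long_run_var * sqrt (2 / pi))\<^sup>2)) \<longlonglongrightarrow> 0"
proof -
  let ?s = "sqrt long_run_var * sqrt (2 / pi)"
  let ?c = "\<lambda>l. expectation (\<lambda>\<omega>. \<bar>\<Sum>i=1..int l. X i \<omega>\<bar>) / sqrt l"
  have lr: "filterlim (\<lambda>n. real (l n)) at_top sequentially" and kr: "filterlim (\<lambda>n. real (k n)) at_top sequentially"
    using l k by (simp_all add: filterlim_sequentially_iff_filterlim_real)
  have cl: "(\<lambda>n. ?c (l n)) \<longlonglongrightarrow> ?s" by (rule filterlim_compose[OF abs_sum_limit l])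
  have "(\<lambda>n. 6 * var_bound / k n + 1024 * K\<^sup>2 * C / l n + (?c (l n) - ?s)\<^sup>2) \<longlonglongrightarrow> 0 + 0 + (?s - ?s)\<^sup>2"
    by (intro tendsto_add tendsto_power tendsto_diff cl tendsto_const real_tendsto_divide_at_top[OF tendsto_const lr]
        real_tendsto_divide_at_top[OF tendsto_const kr])
  then have lim: "(\<lambda>n. 6 * var_bound / k n + 1024 * K\<^sup>2 * C / l n + (?c (l n) - ?s)\<^sup>2) \<longlonglongrightarrow> 0" by simp
  have "eventually (\<lambda>n. 4 * m + 2 \<le> l n) sequentially" "eventually (\<lambda>n. 1 \<le> k n) sequentially"
    using l k by (auto simp: filterlim_at_top)
  then have "eventually (\<lambda>n. expectation (\<lambda>\<omega>. (block_mean (l n) (k n) \<omega> - ?s)\<^sup>2)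
     \<le> 6 * var_bound / k n + 1024 * K\<^sup>2 * C / l n + (?c (l n) - ?s)\<^sup>2) sequentially"
    by eventually_elim (rule block_mean_variance(2), auto)
  then show ?thesis by (intro tendsto_sandwich[OF _ _ tendsto_const lim]) auto
qed

end

section \<open>The estimator\<close>

lemma sum_nat_eq_sum_int:
  fixes F :: "int \<Rightarrow> 'b::comm_monoid_add"
  shows "(\<Sum>j=a+1..b. F (int j)) = (\<Sum>j=int a + 1..int b. F j)"
  by (rule sum.reindex_bij_witness[of _ nat int]) auto

lemma power2_mean_le:
  fixes a :: "nat \<Rightarrow> real"
  assumes "0 < k" shows "((\<Sum>i=1..k. a i) / k)\<^sup>2 \<le> (\<Sum>i=1..k. (a i)\<^sup>2) / k"
proof -
  have "(\<Sum>i=1..k. a i)\<^sup>2 \<le> (\<Sum>i=1..k. (a i)\<^sup>2) * real k"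
    using Cauchy_Schwarz_ineq_sum[of a "\<lambda>_. 1" "{1..k}"] by simp
  then have "(\<Sum>i=1..k. a i)\<^sup>2 / (real k)\<^sup>2 \<le> (\<Sum>i=1..k. (a i)\<^sup>2) * real k / (real k)\<^sup>2"
    by (rule divide_right_mono) simp
  then show ?thesis using assms by (simp add: power_divide power2_eq_square)
qed

lemma power2_add_le: "(a + b)\<^sup>2 \<le> 2 * a\<^sup>2 + 2 * (b :: real)\<^sup>2"
  using sum_squares_bound[of a b] by (simp add: power2_sum)

lemma power2_add3_le: "(a + b + c)\<^sup>2 \<le> 3 * a\<^sup>2 + 3 * b\<^sup>2 + 3 * (c :: real)\<^sup>2"
  using sum_squares_bound[of a b] sum_squares_bound[of a c] sum_squares_bound[of b c]
  by (simp add: power2_eq_square algebra_simps)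

lemma Bhat_add_const:
  assumes "0 < n"
  shows "Bhat (\<lambda>i \<omega>. U i \<omega> + c) l n = Bhat U l n"
proof
  fix \<omega>
  have "(\<Sum>j=(i - 1) * l + 1..i * l. U (int j) \<omega> + c) = (\<Sum>j=(i - 1) * l + 1..i * l. U (int j) \<omega>) + real l * c"
    if "i \<in> {1..n div l}" for i
  proof -
    have "i * l - (i - 1) * l = l" using that by (simp add: diff_mult_distrib[symmetric])
    then have "card {(i - 1) * l + 1..i * l} = l" by simp
    then show ?thesis by (simp add: sum.distrib)
  qed
  moreover have "(1 / real n) * (\<Sum>j=1..n. U (int j) \<omega> + c) = (1 / real n) * (\<Sum>j=1..n. U (int j) \<omega>) + c"
    using assms by (simp add: sum.distrib distrib_left)
  ultimately show "Bhat (\<lambda>i \<omega>. U i \<omega> + c) l n \<omega> = Bhat U l n \<omega>"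
    unfolding Bhat_def Let_def by (intro arg_cong2[where f="(*)"] sum.cong refl) (simp add: algebra_simps)
qed

context stationary_process
begin

text \<open>A window functional is exactly measurable with respect to its window, so lag k + 2 m
  leaves a gap k and the covariances inherit the mixing rate.\<close>

lemma summable_acov_bounded_window:
  assumes h: "h \<in> borel_measurable (window_alg m)" and b: "\<And>x. \<bar>h x\<bar> \<le> K"
    and mix: "\<And>k. 1 \<le> k \<Longrightarrow> alpha_mix M Y k \<le> C * real k powr (- 8)"
  shows "summable (\<lambda>k. \<bar>acov h k\<bar>)"
proof -
  have "\<bar>acov h (k + 2 * m)\<bar> \<le> 4 * K * K * C * real k powr (- 8)" if k: "1 \<le> k" for k
  proof -
    have "\<bar>acov h (k + 2 * m)\<bar> \<le> 4 * K * K * alpha_mix M Y k"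
      unfolding acov_def
    proof (rule covar_le_alpha_mix[of "1 + int m"])
      show "Xproc h Y 1 \<in> borel_measurable (gen_subalg M Y {..1 + int m})"
        by (rule measurable_gen_subalg_mono[OF measurable_Xproc_window[OF h]]) auto
      show "Xproc h Y (1 + int (k + 2 * m)) \<in> borel_measurable (gen_subalg M Y {1 + int m + int k..})"
        by (rule measurable_gen_subalg_mono[OF measurable_Xproc_window[OF h]]) auto
    qed (use b in \<open>auto simp: Xproc_def\<close>)
    also have "\<dots> \<le> 4 * K * K * (C * real k powr (- 8))" by (intro mult_left_mono mix k) auto
    finally show ?thesis by (simp add: mult.assoc)
  qed
  then have le: "norm \<bar>acov h (k + 2 * m)\<bar> \<le> 4 * K * K * C * real k powr (- 8)" if "1 \<le> k" for k using that by simp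
  have "summable (\<lambda>k. 4 * K * K * C * real k powr (- 8))"
    by (intro summable_mult) (simp add: summable_real_powr_iff)
  then have "summable (\<lambda>k. \<bar>acov h (k + 2 * m)\<bar>)"
    by (rule summable_comparison_test') (rule le)
  then show ?thesis using summable_iff_shift[of "\<lambda>k. \<bar>acov h k\<bar>" "2 * m"] by simp
qed

text \<open>The times 1 and k + 2 in \<open>sigma2\<close> are k + 1 apart, hence the shifted index
  on the right.\<close>

lemma sigma2_eq: "sigma2 M (Xproc f Y) = acov f 0 + 2 * (\<Sum>k. acov f (Suc k))"
  unfolding sigma2_def acov_def covar_def by (simp add: power2_eq_square add.commute)

end

section \<open>Comparison of the estimator with a bounded window functional\<close>

context mixing_functional
begin

abbreviation "Xc \<equiv> Xproc (centered f) Y"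

lemma Xc_moments:
  "centered f \<in> borel_measurable path_space" "integrable M (\<lambda>\<omega>. (Xc 1 \<omega>)\<^sup>2)"
  "expectation (Xc 1) = 0" "summable (\<lambda>k. \<bar>acov (centered f) k\<bar>)"
  using measurable_centered[OF f_measurable] centered_square[OF f_measurable f_square] summable_acov_f by auto

text \<open>Three errors are separated: between the estimator and the scaled block average of the
  bounded functional, between that average and its limit, and between the two standard deviations.
  The first and the third are controlled by the summed autocovariance of the residual, up to the
  effect of centring at the sample mean.\<close>

lemma Bhat_limit_bound:
  fixes l :: "nat \<Rightarrow> nat"
  assumes eps: "0 < \<epsilon>" and l0: "\<And>n. 0 < l n" and l: "filterlim l at_top sequentially"
    and k: "filterlim (\<lambda>n. n div l n) at_top sequentially" and ln: "(\<lambda>n. real (l n) / real n) \<longlonglongrightarrow> 0"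
  shows "eventually (\<lambda>n. expectation (\<lambda>\<omega>. (Bhat (Xproc f Y) (l n) n \<omega> - sqrt (sigma2 M (Xproc f Y)))\<^sup>2) < \<epsilon>) sequentially"
proof -
  \<comment> \<open>The limit of the error bound will be 6 (pi/2) DW + 3 DW with DW \<le>
    \<epsilon>/30. Since pi < 4 this is at most 15 DW \<le> \<epsilon>/2, which explains the
    60.\<close>
  obtain h m K where h: "h \<in> borel_measurable (window_alg m)" "\<And>x. \<bar>h x\<bar> \<le> K"
    "integrable M (\<lambda>\<omega>. (Xproc (\<lambda>x. f x - h x) Y 1 \<omega>)\<^sup>2)"
    "summable (\<lambda>k. \<bar>acov (\<lambda>x. f x - h x) k\<bar>)" "(\<Sum>k. \<bar>acov (\<lambda>x. f x - h x) k\<bar>) \<le> \<epsilon> / 60"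
    using bounded_window_approximation[of "\<epsilon> / 60"] eps by auto
  let ?w = "\<lambda>x. f x - h x"
  have hp: "h \<in> borel_measurable path_space" by (rule measurable_window_alg_path_space) fact
  have wp: "?w \<in> borel_measurable path_space" by (rule borel_measurable_diff[OF f_measurable hp])
  have hsq: "integrable M (\<lambda>\<omega>. (Xproc h Y 1 \<omega>)\<^sup>2)"
    by (rule integrable_const_bound[of _ "K\<^sup>2"])
       (use measurable_Xproc[OF hp] power_mono[OF h(2), of _ 2] in \<open>auto simp: Xproc_def[abs_def]\<close>)
  have mix8: "alpha_mix M Y k \<le> C * real k powr (- 8)" if "1 \<le> k" for k
    using that \<mu>_large C_nonneg
    by (intro order_trans[OF mixing_rate] mult_left_mono powr_mono) auto
  define K' where "K' = K + \<bar>expectation (Xproc h Y 1)\<bar>"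
  have hb: "\<bar>centered h x\<bar> \<le> K'" for x
    using h(2)[of x] unfolding centered_def K'_def by linarith
  interpret Z: bounded_window_process M Y "centered h" m K' C
  proof
    show "centered h \<in> borel_measurable (window_alg m)" by (rule measurable_centered) fact
    then show "summable (\<lambda>k. \<bar>acov (centered h) k\<bar>)" by (rule summable_acov_bounded_window[OF _ hb mix8])
    show "expectation (Xproc (centered h) Y 1) = 0" by (rule centered_square[OF hp hsq])
  qed (use hb mix8 C_nonneg in auto)
  let ?W = "Xproc (centered ?w) Y"
  have W: "centered ?w \<in> borel_measurable path_space" "integrable M (\<lambda>\<omega>. (?W 1 \<omega>)\<^sup>2)" "expectation (?W 1) = 0"
    "summable (\<lambda>k. \<bar>acov (centered ?w) k\<bar>)"
    using measurable_centered[OF wp] centered_square[OF wp h(3)] h(4) by auto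
  define DW where "DW = 2 * (\<Sum>k. \<bar>acov (centered ?w) k\<bar>)"
  define DF where "DF = 2 * (\<Sum>k. \<bar>acov (centered f) k\<bar>)"
  have DW: "DW \<le> \<epsilon> / 30" "0 \<le> DW" unfolding DW_def
    using h(5) suminf_nonneg[OF W(4)] by (simp_all add: centered_square(3)[OF wp h(3)])
  have split: "Xc i \<omega> = Z.X i \<omega> + ?W i \<omega>" for i \<omega>
  proof -
    have "expectation (Xproc ?w Y 1) = expectation (Xproc f Y 1) - expectation (Xproc h Y 1)"
      using integrable_Xproc_square(2)[OF f_measurable f_square, of 1] integrable_Xproc_square(2)[OF hp hsq, of 1]
      by (simp add: Xproc_def[abs_def])
    then show ?thesis unfolding Xproc_centered by (simp add: Xproc_def)
  qed
  have sumW: "integrable M (\<lambda>\<omega>. (\<Sum>j\<in>G. ?W j \<omega>)\<^sup>2)" "expectation (\<lambda>\<omega>. (\<Sum>j\<in>G. ?W j \<omega>)\<^sup>2) \<le> real (card G) * DW"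
    if "finite G" for G
    using second_moment_sum(1)[OF W(1-3) that] second_moment_sum_le[OF W(1-3) that W(4)] by (auto simp: DW_def)
  have sumF: "integrable M (\<lambda>\<omega>. (\<Sum>j\<in>G. Xc j \<omega>)\<^sup>2)" "expectation (\<lambda>\<omega>. (\<Sum>j\<in>G. Xc j \<omega>)\<^sup>2) \<le> real (card G) * DF"
    if "finite G" for G
    using second_moment_sum(1)[OF Xc_moments(1-3) that] second_moment_sum_le[OF Xc_moments(1-3) that Xc_moments(4)] by (auto simp: DF_def)
  have [measurable]: "Xc i \<in> borel_measurable M" "?W i \<in> borel_measurable M" for i
    by (rule measurable_Xproc; rule W Xc_moments)+
  let ?\<sigma> = "sqrt (sigma2 M (Xproc f Y))" and ?\<tau> = "sqrt Z.long_run_var"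
  \<comment> \<open>Both roots are limits of L^2-norms of sums divided by sqrt n, and the two sums
    differ by a sum over the residual, whose normalised second moment is at most
    \<open>DW\<close>.\<close>
  have close: "(?\<tau> - ?\<sigma>)\<^sup>2 \<le> DW"
  proof -
    let ?V = "\<lambda>n. expectation (\<lambda>\<omega>. (\<Sum>i=1..int n. Xc i \<omega>)\<^sup>2)"
    have "(\<lambda>n. ?V n / n) \<longlonglongrightarrow> sigma2 M (Xproc f Y)"
      using second_moment_sum_limit[OF Xc_moments] by (simp add: sigma2_eq centered_square(3)[OF f_measurable f_square])
    then have lim: "(\<lambda>n. (sqrt (Z.sum_var n / n) - sqrt (?V n / n))\<^sup>2) \<longlonglongrightarrow> (?\<tau> - ?\<sigma>)\<^sup>2"
      by (intro tendsto_intros Z.sum_var_limit)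
    have "(sqrt (Z.sum_var n / n) - sqrt (?V n / n))\<^sup>2 \<le> DW" if n: "1 \<le> n" for n :: nat
    proof -
      have d: "(\<Sum>i=1..int n. Z.X i \<omega>) - (\<Sum>i=1..int n. Xc i \<omega>) = - (\<Sum>i=1..int n. ?W i \<omega>)" for \<omega>
        by (simp add: split sum.distrib)
      have "(sqrt (Z.sum_var n / n) - sqrt (?V n / n))\<^sup>2 = (sqrt (Z.sum_var n) - sqrt (?V n))\<^sup>2 / n"
        by (simp add: real_sqrt_divide diff_divide_distrib[symmetric] power_divide)
      also have "\<dots> \<le> expectation (\<lambda>\<omega>. ((\<Sum>i=1..int n. Z.X i \<omega>) - (\<Sum>i=1..int n. Xc i \<omega>))\<^sup>2) / n"
        unfolding Z.sum_var_def by (intro divide_right_mono L2_reverse_triangle Z.sum_X_square sumF) auto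
      also have "\<dots> = expectation (\<lambda>\<omega>. (\<Sum>i=1..int n. ?W i \<omega>)\<^sup>2) / n" unfolding d by simp
      also have "\<dots> \<le> (real n * DW) / n" using sumW(2)[of "{1..int n}"] by (intro divide_right_mono) auto
      finally show ?thesis using n by simp
    qed
    then show ?thesis by (intro LIMSEQ_le_const2[OF lim]) auto
  qed
  \<comment> \<open>The inverse of E|N| = sqrt(2/pi) for a standard normal N; it turns the limit of
    the block average into the standard deviation.\<close>
  define c0 where "c0 = sqrt (pi / 2)"
  have c0: "c0\<^sup>2 = pi / 2" "0 \<le> c0" by (auto simp: c0_def)
  have c0s: "c0 * (?\<tau> * sqrt (2 / pi)) = ?\<tau>"
  proof -
    have "c0 * sqrt (2 / pi) = 1" unfolding c0_def by (simp add: real_sqrt_mult[symmetric])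
    then show ?thesis by (simp add: mult.left_commute)
  qed
  define Q where "Q n \<omega> = Z.block_mean (l n) (n div l n) \<omega>" for n \<omega>
  let ?s = "?\<tau> * sqrt (2 / pi)"
  let ?T = "\<lambda>n. 3 * c0\<^sup>2 * (2 * DW + 2 * DF * (real (l n) / real n)) + 3 * c0\<^sup>2 * expectation (\<lambda>\<omega>. (Q n \<omega> - ?s)\<^sup>2) + 3 * DW"
  have bound: "expectation (\<lambda>\<omega>. (Bhat (Xproc f Y) (l n) n \<omega> - ?\<sigma>)\<^sup>2) \<le> ?T n"
    if n: "0 < n" "4 * m + 2 \<le> l n" "0 < n div l n" for n
  proof -
    define L where "L = l n"
    define k where "k = n div L"
    have k0: "0 < k" "0 < real k" and L0: "0 < L" "0 < real L" using n l0 by (auto simp: k_def L_def)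
    define I where "I i = {int ((i - 1) * L) + 1..int ((i - 1) * L) + int L}" for i
    have cI: "card (I i) = L" "finite (I i)" for i by (auto simp: I_def)
    let ?A = "\<lambda>\<omega>. (\<Sum>j=1..int n. Xc j \<omega>) / n"
    \<comment> \<open>Each block difference is at most the absolute value of the residual block sum
      minus L times the sample mean, by the reverse triangle inequality. Squaring, with a factor 2
      for the two terms, and dividing by L gives these summands.\<close>
    let ?G = "\<lambda>\<omega>. (\<Sum>i=1..k. 2 * ((\<Sum>j\<in>I i. ?W j \<omega>)\<^sup>2 / L) + 2 * (L * (?A \<omega>)\<^sup>2)) / k"
    have B: "Bhat (Xproc f Y) L n \<omega> = c0 * ((\<Sum>i=1..k. \<bar>(\<Sum>j\<in>I i. Xc j \<omega>) - L * ?A \<omega>\<bar> / sqrt L) / k)" for \<omega>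
    proof -
      have "Xproc f Y = (\<lambda>i \<omega>. Xc i \<omega> + expectation (Xproc f Y 1))" by (auto simp: Xproc_centered)
      then have F: "Bhat (Xproc f Y) L n = Bhat Xc L n" using Bhat_add_const[OF n(1)] by metis
      have S1: "(\<Sum>j=(i - 1) * L + 1..i * L. Xc (int j) \<omega>) = (\<Sum>j\<in>I i. Xc j \<omega>)" if "i \<in> {1..k}" for i
      proof -
        have "int ((i - 1) * L) + int L = int (i * L)" using that by (cases i) (auto simp: algebra_simps)
        then show ?thesis unfolding I_def by (simp only: sum_nat_eq_sum_int[of "\<lambda>j. Xc j \<omega>"])
      qed
      have S2: "(\<Sum>j=1..n. Xc (int j) \<omega>) = (\<Sum>j=1..int n. Xc j \<omega>)"
        using sum_nat_eq_sum_int[of "\<lambda>j. Xc j \<omega>" 0 n] by simp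
      have "(\<Sum>i=1..k. \<bar>(\<Sum>j=(i - 1) * L + 1..i * L. Xc (int j) \<omega>) - real L * (1 / real n * (\<Sum>j=1..n. Xc (int j) \<omega>))\<bar> / sqrt L)
        = (\<Sum>i=1..k. \<bar>(\<Sum>j\<in>I i. Xc j \<omega>) - L * ?A \<omega>\<bar> / sqrt L)" (is "?l = ?r")
      proof (rule sum.cong[OF refl])
        fix i assume i: "i \<in> {1..k}"
        show "\<bar>(\<Sum>j=(i - 1) * L + 1..i * L. Xc (int j) \<omega>) - real L * (1 / real n * (\<Sum>j=1..n. Xc (int j) \<omega>))\<bar> / sqrt L
          = \<bar>(\<Sum>j\<in>I i. Xc j \<omega>) - L * ?A \<omega>\<bar> / sqrt L" unfolding S1[OF i] S2 by simp
      qed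
      moreover have "Bhat Xc L n \<omega> = 1 / real k * c0 * ?l"
        unfolding Bhat_def Let_def k_def c0_def ..
      ultimately have "Bhat Xc L n \<omega> = 1 / real k * c0 * ?r" by (simp only:)
      then show ?thesis unfolding F by simp
    qed
    have Qk: "Q n \<omega> = (\<Sum>i=1..k. \<bar>\<Sum>j\<in>I i. Z.X j \<omega>\<bar> / sqrt L) / k" for \<omega>
      unfolding Q_def Z.block_mean_def Z.block_def k_def L_def I_def ..
    have BQ: "(Bhat (Xproc f Y) L n \<omega> - c0 * Q n \<omega>)\<^sup>2 \<le> c0\<^sup>2 * ?G \<omega>" for \<omega>
    proof -
      let ?d = "\<lambda>i. (\<bar>(\<Sum>j\<in>I i. Xc j \<omega>) - L * ?A \<omega>\<bar> - \<bar>\<Sum>j\<in>I i. Z.X j \<omega>\<bar>) / sqrt L"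
      have "Bhat (Xproc f Y) L n \<omega> - c0 * Q n \<omega> = c0 * ((\<Sum>i=1..k. ?d i) / k)"
        unfolding B Qk right_diff_distrib[symmetric] by (simp add: sum_subtractf diff_divide_distrib)
      then have "(Bhat (Xproc f Y) L n \<omega> - c0 * Q n \<omega>)\<^sup>2 = c0\<^sup>2 * ((\<Sum>i=1..k. ?d i) / k)\<^sup>2"
        by (simp only: power_mult_distrib)
      also have "\<dots> \<le> c0\<^sup>2 * ((\<Sum>i=1..k. (?d i)\<^sup>2) / k)" by (intro mult_left_mono power2_mean_le k0) auto
      also have "\<dots> \<le> c0\<^sup>2 * ?G \<omega>"
      proof (intro mult_left_mono divide_right_mono sum_mono)
        fix i
        let ?a = "\<Sum>j\<in>I i. ?W j \<omega>" and ?b = "real L * ?A \<omega>"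
        have e: "(\<Sum>j\<in>I i. Xc j \<omega>) = (\<Sum>j\<in>I i. Z.X j \<omega>) + ?a" by (simp add: split sum.distrib)
        have "\<bar>\<bar>(\<Sum>j\<in>I i. Xc j \<omega>) - ?b\<bar> - \<bar>\<Sum>j\<in>I i. Z.X j \<omega>\<bar>\<bar> \<le> \<bar>?a - ?b\<bar>"
        proof -
          have "\<bar>\<bar>z + x - y\<bar> - \<bar>z\<bar>\<bar> \<le> \<bar>x - y\<bar>" for x y z :: real by linarith
          then show ?thesis unfolding e .
        qed
        then have "(\<bar>(\<Sum>j\<in>I i. Xc j \<omega>) - ?b\<bar> - \<bar>\<Sum>j\<in>I i. Z.X j \<omega>\<bar>)\<^sup>2 \<le> (?a + - ?b)\<^sup>2"
          by (intro abs_le_square_iff[THEN iffD1]) simp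
        also have "\<dots> \<le> 2 * ?a\<^sup>2 + 2 * ?b\<^sup>2" using power2_add_le[of ?a "- ?b"] by simp
        finally have "(?d i)\<^sup>2 \<le> (2 * ?a\<^sup>2 + 2 * ?b\<^sup>2) / L"
          using L0 by (simp add: power_divide divide_right_mono)
        also have "\<dots> = 2 * (?a\<^sup>2 / L) + 2 * (L * (?A \<omega>)\<^sup>2)"
          using L0 by (simp add: power_mult_distrib add_divide_distrib power2_eq_square)
        finally show "(?d i)\<^sup>2 \<le> 2 * (?a\<^sup>2 / L) + 2 * (L * (?A \<omega>)\<^sup>2)" .
      qed auto
      finally show ?thesis .
    qed
    have pw: "(Bhat (Xproc f Y) L n \<omega> - ?\<sigma>)\<^sup>2 \<le> 3 * c0\<^sup>2 * ?G \<omega> + 3 * c0\<^sup>2 * (Q n \<omega> - ?s)\<^sup>2 + 3 * DW" for \<omega>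
    proof -
      have "Bhat (Xproc f Y) L n \<omega> - ?\<sigma> = (Bhat (Xproc f Y) L n \<omega> - c0 * Q n \<omega>) + c0 * (Q n \<omega> - ?s) + (?\<tau> - ?\<sigma>)"
        unfolding right_diff_distrib c0s by simp
      then have "(Bhat (Xproc f Y) L n \<omega> - ?\<sigma>)\<^sup>2
        \<le> 3 * (Bhat (Xproc f Y) L n \<omega> - c0 * Q n \<omega>)\<^sup>2 + 3 * (c0 * (Q n \<omega> - ?s))\<^sup>2 + 3 * (?\<tau> - ?\<sigma>)\<^sup>2"
        using power2_add3_le by metis
      also have "\<dots> \<le> 3 * (c0\<^sup>2 * ?G \<omega>) + 3 * (c0 * (Q n \<omega> - ?s))\<^sup>2 + 3 * DW"
        using BQ[of \<omega>] close by linarith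
      finally show ?thesis by (simp only: power_mult_distrib mult.assoc)
    qed
    have A2: "(?A \<omega>)\<^sup>2 = (\<Sum>j=1..int n. Xc j \<omega>)\<^sup>2 / (real n)\<^sup>2" for \<omega> by (simp add: power_divide)
    have iA: "integrable M (\<lambda>\<omega>. (?A \<omega>)\<^sup>2)" unfolding A2 using sumF(1)[of "{1..int n}"] by simp
    \<comment> \<open>The sample mean has second moment O(1/n); multiplied by the block length it is
      O(l/n), which is where l = o(n) makes centring harmless.\<close>
    have EA: "expectation (\<lambda>\<omega>. (?A \<omega>)\<^sup>2) \<le> DF / n"
    proof -
      have "expectation (\<lambda>\<omega>. (?A \<omega>)\<^sup>2) \<le> (real n * DF) / (real n)\<^sup>2"
        unfolding A2 integral_divide_zero using sumF(2)[of "{1..int n}"] by (intro divide_right_mono) auto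
      then show ?thesis using n(1) by (simp add: power2_eq_square)
    qed
    have iW: "integrable M (\<lambda>\<omega>. (\<Sum>j\<in>I i. ?W j \<omega>)\<^sup>2)" for i by (rule sumW(1)[OF cI(2)])
    have iG: "integrable M ?G" using iA iW by auto
    have EG: "expectation ?G \<le> 2 * DW + 2 * DF * (real L / real n)"
    proof -
      have "expectation ?G = (\<Sum>i=1..k. 2 * (expectation (\<lambda>\<omega>. (\<Sum>j\<in>I i. ?W j \<omega>)\<^sup>2) / L) + 2 * (L * expectation (\<lambda>\<omega>. (?A \<omega>)\<^sup>2))) / k"
        using iA iW by simp
      also have "\<dots> \<le> (\<Sum>i=1..k. 2 * ((real L * DW) / L) + 2 * (L * (DF / n))) / k"
      proof (intro divide_right_mono sum_mono add_mono mult_left_mono EA)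
        show "expectation (\<lambda>\<omega>. (\<Sum>j\<in>I i. ?W j \<omega>)\<^sup>2) \<le> real L * DW" for i
          using sumW(2)[OF cI(2), of i] by (simp only: cI)
      qed auto
      also have "\<dots> = 2 * ((real L * DW) / L) + 2 * (L * (DF / n))" using k0 by simp
      also have "\<dots> = 2 * DW + 2 * DF * (real L / real n)" using L0 by simp
      finally show ?thesis .
    qed
    have iQ: "integrable M (\<lambda>\<omega>. (Q n \<omega> - ?s)\<^sup>2)"
      unfolding Q_def by (rule Z.block_mean_variance(1)) (use n in auto)
    have iR: "integrable M (\<lambda>\<omega>. 3 * c0\<^sup>2 * ?G \<omega> + 3 * c0\<^sup>2 * (Q n \<omega> - ?s)\<^sup>2 + 3 * DW)"
      by (intro Bochner_Integration.integrable_add integrable_mult_right iG iQ) simp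
    \<comment> \<open>\<open>integral_mono'\<close> asks for integrability of the majorant alone,
      together with its nonnegativity.\<close>
    have "expectation (\<lambda>\<omega>. (Bhat (Xproc f Y) L n \<omega> - ?\<sigma>)\<^sup>2)
       \<le> expectation (\<lambda>\<omega>. 3 * c0\<^sup>2 * ?G \<omega> + 3 * c0\<^sup>2 * (Q n \<omega> - ?s)\<^sup>2 + 3 * DW)"
      by (rule integral_mono'[OF iR pw]) (rule order_trans[OF zero_le_power2 pw])
    also have "\<dots> = 3 * c0\<^sup>2 * expectation ?G + 3 * c0\<^sup>2 * expectation (\<lambda>\<omega>. (Q n \<omega> - ?s)\<^sup>2) + 3 * DW"
    proof -
      have i1: "integrable M (\<lambda>\<omega>. 3 * c0\<^sup>2 * ?G \<omega>)" by (rule integrable_mult_right[OF iG])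
      have i2: "integrable M (\<lambda>\<omega>. 3 * c0\<^sup>2 * (Q n \<omega> - ?s)\<^sup>2)" by (rule integrable_mult_right[OF iQ])
      show ?thesis
        unfolding Bochner_Integration.integral_add[OF Bochner_Integration.integrable_add[OF i1 i2] integrable_const]
          Bochner_Integration.integral_add[OF i1 i2] integral_mult_right_zero by (simp add: prob_space)
    qed
    also have "\<dots> \<le> 3 * c0\<^sup>2 * (2 * DW + 2 * DF * (real L / real n)) + 3 * c0\<^sup>2 * expectation (\<lambda>\<omega>. (Q n \<omega> - ?s)\<^sup>2) + 3 * DW"
      by (intro add_mono mult_left_mono EG order_refl) auto
    finally show ?thesis unfolding L_def .
  qed
  have "?T \<longlonglongrightarrow> 3 * c0\<^sup>2 * (2 * DW + 2 * DF * 0) + 3 * c0\<^sup>2 * 0 + 3 * DW"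
    unfolding Q_def by (intro tendsto_intros ln Z.block_mean_limit l k)
  moreover have "3 * c0\<^sup>2 * (2 * DW + 2 * DF * 0) + 3 * c0\<^sup>2 * 0 + 3 * DW < \<epsilon>"
  proof -
    have "c0\<^sup>2 * DW \<le> 2 * DW" unfolding c0 using DW pi_less_4 by (intro mult_right_mono) auto
    then show ?thesis using DW eps by simp
  qed
  ultimately have ev: "eventually (\<lambda>n. ?T n < \<epsilon>) sequentially" by (rule order_tendstoD(2))
  have "eventually (\<lambda>n. 4 * m + 2 \<le> l n) sequentially" "eventually (\<lambda>n. 1 \<le> n div l n) sequentially"
    using l k by (auto simp: filterlim_at_top)
  then show ?thesis using ev eventually_gt_at_top[of 0]
    by eventually_elim (rule le_less_trans[OF bound], auto)
qed

end

section \<open>Choice of exponents, error sequence and constants for the theorem\<close>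

theorem theorem1:
  fixes M :: "'a measure" and Y :: "int \<Rightarrow> 'a \<Rightarrow> real"
    and f :: "(int \<Rightarrow> real) \<Rightarrow> real" and \<delta> \<mu> :: real and l :: "nat \<Rightarrow> nat"
  assumes "prob_space M"
    and "\<And>j. Y j \<in> borel_measurable M"
    and "stationary_proc M Y"
    and "(\<lambda>k. alpha_mix M Y k) \<longlonglongrightarrow> 0"
    and "f \<in> borel_measurable (PiM UNIV (\<lambda>_::int. borel :: real measure))"
    and "\<delta> > 0"
    and "integrable M (\<lambda>\<omega>. \<bar>Xproc f Y 1 \<omega>\<bar> powr (2 + \<delta>))"
    and "summable (\<lambda>k. psi_coeff M Y f \<delta> (Suc k) powr ((1 + \<delta>) / (2 + \<delta>)))"
    and "\<mu> > (2 + \<delta>)\<^sup>2 / \<delta>"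
    and "(\<lambda>k. alpha_mix M Y k) \<in> O(\<lambda>k. real k powr (- \<mu>))"
    and "\<And>n. l n > 0"
    and "mono l"
    and "filterlim l at_top sequentially"
    and "(\<lambda>n. real (l n)) \<in> o(\<lambda>n. real n)"
  shows "(\<lambda>n. integral\<^sup>L M (\<lambda>\<omega>. (Bhat (Xproc f Y) (l n) n \<omega> - sqrt (sigma2 M (Xproc f Y)))\<^sup>2))
           \<longlonglongrightarrow> 0"
proof -
  interpret stationary_process M Y
    using assms(1-3) by (simp add: stationary_process_def stationary_process_axioms_def)
  define p q B where "p = 2 + \<delta>" and "q = (2 + \<delta>) / (1 + \<delta>)" and "B = expectation (\<lambda>\<omega>. \<bar>Xproc f Y 1 \<omega>\<bar> powr p)"
  \<comment> \<open>The exponent is 1/q, so the first summand is the L^q-norm of the approximation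
    error and is summable by assumption; the second absorbs truncation and mixing errors. At j = 0
    the latter is 0 by the convention on division.\<close>
  define \<rho> where "\<rho> j = psi_coeff M Y f \<delta> j powr ((1 + \<delta>) / (2 + \<delta>)) + 1 / (real j)\<^sup>2" for j
  have d: "0 < \<delta>" by fact
  have pq: "2 < p" "1 < q" "1 / p + 1 / q = 1" "q \<le> p"
    using d by (simp_all add: p_def q_def field_simps add_divide_distrib[symmetric] pos_divide_le_eq)
  have fm: "moment_le M p B (Xproc f Y 1)"
    using assms(7) measurable_Xproc[OF assms(5)] by (simp add: moment_le_def p_def B_def)
  have psi: "psi_coeff M Y f \<delta> j = expectation (\<lambda>\<omega>. \<bar>Xproc f Y 1 \<omega> - real_cond_exp M (gen_subalg M Y {1 - int j..1 + int j}) (Xproc f Y 1) \<omega>\<bar> powr q)" for j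
    by (simp add: psi_coeff_def q_def)
  have "\<forall>j. \<exists>g. g \<in> borel_measurable (window_alg j) \<and> moment_le M p B (Xproc g Y 1)
     \<and> integrable M (\<lambda>\<omega>. \<bar>Xproc f Y 1 \<omega> - Xproc g Y 1 \<omega>\<bar> powr q)
     \<and> expectation (\<lambda>\<omega>. \<bar>Xproc f Y 1 \<omega> - Xproc g Y 1 \<omega>\<bar> powr q) = psi_coeff M Y f \<delta> j"
    using window_approximation[OF assms(5) pq(2,4) fm] unfolding psi[symmetric] by blast
  from choice[OF this] obtain g where g: "\<And>j. g j \<in> borel_measurable (window_alg j)" "\<And>j. moment_le M p B (Xproc (g j) Y 1)"
    "\<And>j. integrable M (\<lambda>\<omega>. \<bar>Xproc f Y 1 \<omega> - Xproc (g j) Y 1 \<omega>\<bar> powr q)"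
    "\<And>j. expectation (\<lambda>\<omega>. \<bar>Xproc f Y 1 \<omega> - Xproc (g j) Y 1 \<omega>\<bar> powr q) = psi_coeff M Y f \<delta> j"
    by blast
  have psi0: "0 \<le> psi_coeff M Y f \<delta> j" for j unfolding psi by simp
  have g_err: "psi_coeff M Y f \<delta> j \<le> \<rho> j powr q" for j
  proof -
    have "psi_coeff M Y f \<delta> j = (psi_coeff M Y f \<delta> j powr ((1 + \<delta>) / (2 + \<delta>))) powr q"
      using psi0[of j] d by (simp add: q_def powr_powr)
    also have "\<dots> \<le> \<rho> j powr q" unfolding \<rho>_def using pq by (intro powr_mono2) auto
    finally show ?thesis .
  qed
  have "summable (\<lambda>k. 1 / (real (Suc k))\<^sup>2)"
    using inverse_power_summable[of 2, where 'a=real] summable_Suc_iff[of "\<lambda>k. inverse ((real k)\<^sup>2)"]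
    by (simp add: inverse_eq_divide)
  then have "summable (\<lambda>k. \<rho> (Suc k))" unfolding \<rho>_def by (intro summable_add assms(8))
  then have \<rho>: "summable \<rho>" by (simp only: summable_Suc_iff)
  have \<mu>: "4 / \<delta> + 4 < \<mu>" "8 < \<mu>"
  proof -
    have e: "(2 + \<delta>)\<^sup>2 / \<delta> = 4 / \<delta> + 4 + \<delta>" using d by (simp add: power2_eq_square field_simps)
    show "4 / \<delta> + 4 < \<mu>" using assms(9) d unfolding e by simp
    have "8 \<le> (2 + \<delta>)\<^sup>2 / \<delta>"
      using d zero_le_power2[of "2 - \<delta>"] by (simp add: le_divide_eq power2_eq_square algebra_simps)
    then show "8 < \<mu>" using assms(9) by simp
  qed
  obtain c where c: "0 < c" "eventually (\<lambda>k. norm (alpha_mix M Y k) \<le> c * norm (real k powr (- \<mu>))) sequentially"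
    using landau_o.bigE[OF assms(10)] by blast
  obtain N where N: "\<And>k. N \<le> k \<Longrightarrow> norm (alpha_mix M Y k) \<le> c * norm (real k powr (- \<mu>))"
    using c(2) unfolding eventually_sequentially by blast
  \<comment> \<open>The O-bound is available only from \<open>N\<close> on. For smaller k the
    trivial bound \<alpha>_k \<le> 1 is at most N^\<mu> k^(-\<mu>), which the second entry of the
    maximum covers.\<close>
  define C where "C = max c (real N powr \<mu>)"
  have mix: "alpha_mix M Y k \<le> C * real k powr (- \<mu>)" if k: "1 \<le> k" for k
  proof (cases "N \<le> k")
    case True
    have "alpha_mix M Y k \<le> c * real k powr (- \<mu>)" using N[OF True] by simp
    also have "\<dots> \<le> C * real k powr (- \<mu>)" by (intro mult_right_mono) (auto simp: C_def)
    finally show ?thesis .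
  next
    case False
    have "alpha_mix M Y k \<le> real k powr \<mu> * real k powr (- \<mu>)"
      using alpha_mix_bounds(2)[of k] k by (simp add: powr_add[symmetric])
    also have "\<dots> \<le> C * real k powr (- \<mu>)"
    proof (rule mult_right_mono)
      have "real k powr \<mu> \<le> real N powr \<mu>" using False \<mu> by (intro powr_mono2) auto
      then show "real k powr \<mu> \<le> C" by (simp add: C_def)
    qed simp
    finally show ?thesis .
  qed
  interpret mixing_functional M Y f p q B C \<mu> \<rho> g
  proof
    show "4 / (p - 2) + 2 \<le> \<mu>" using \<mu>(1) by (simp add: p_def)
    show "1 / (real j)\<^sup>2 \<le> \<rho> j" for j by (simp add: \<rho>_def)
  qed (use assms(5) pq fm mix \<mu> g g_err \<rho> c in \<open>auto simp: C_def\<close>)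
  have k: "filterlim (\<lambda>n. n div l n) at_top sequentially"
    unfolding filterlim_at_top
  proof
    fix a :: nat
    \<comment> \<open>With this constant (a + 1) l_n \<le> n, so at least \<open>a\<close> full
      blocks fit into the sample.\<close>
    have "eventually (\<lambda>n. norm (real (l n)) \<le> (1 / (real a + 1)) * norm (real n)) sequentially"
      by (rule landau_o.smallD[OF assms(14)]) simp
    then show "eventually (\<lambda>n. a \<le> n div l n) sequentially"
    proof eventually_elim
      case (elim n)
      then have "real a * real (l n) + real (l n) \<le> real n" by (simp add: field_simps)
      then have "real (a * l n) \<le> real n" by simp
      then have "a * l n \<le> n" by (simp only: of_nat_le_iff)
      then show ?case using assms(11)[of n] by (simp add: less_eq_div_iff_mult_less_eq)
    qed
  qed
  have ln: "(\<lambda>n. real (l n) / real n) \<longlonglongrightarrow> 0" by (rule smalloD_tendsto[OF assms(14)])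
  show ?thesis
  proof (rule LIMSEQ_I)
    fix r :: real assume "0 < r"
    from Bhat_limit_bound[OF this assms(11,13) k ln]
    show "\<exists>no. \<forall>n\<ge>no. norm (expectation (\<lambda>\<omega>. (Bhat (Xproc f Y) (l n) n \<omega> - sqrt (sigma2 M (Xproc f Y)))\<^sup>2) - 0) < r"
      unfolding eventually_sequentially by simp
  qed
qed

end
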